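(* Let $n\ge2$, let $(\mathcal M,g)$ be a $D=2n+\varepsilon$ dimensional Riemannian space with an orthonormal coframe $e^\mu,\hat e^\mu$ ($\mu=1,\dots,n$) and, if $\varepsilon=1$, $\hat e^0$, and let $x_1,\dots,x_n$ be functionally independent functions on $\mathcal M$. Put $h=\sum_\mu x_\mu\,e^\mu\wedge\hat e^\mu$. Consider, at points where the $x_\mu^2$ are pairwise distinct and all $x_\mu\neq0$, the integrability condition of the conformal Killing-Yano equation $$(D-2)\mathcal R^{ab}{}_{e[c}h^e{}_{d]}-\delta^{[a}_{[c}\mathcal R^{b]}{}_{d]}{}^{ef}h_{ef}-2\mathcal R^{[a}{}_e\,\delta^{b]}_{[c}h^e{}_{d]}=0,\qquad \mathcal R_{ab}:=\mathcal R^c{}_{acb},$$ as a homogeneous linear system $\mathcal I[\mathcal R]=0$ on a Riemann-symmetric tensor $\mathcal R$. Restricted to the subspace of totally zero weight Riemann-symmetric tensors, this system has rank $n^2+(\varepsilon-2)n$. Moreover, writing such tensors as $$\mathcal R=\sum_{\mu<\nu}\left[\Omega_{\mu\nu}(h_\mu\odot h_\nu)+\alpha_{\mu\nu}(Q_\mu\odot Q_\nu)\right]+\sum_\mu\left[\tfrac12\Omega_{\mu\mu}(h_\mu\odot h_\mu)+\alpha^{(\epsilon)}_\mu(Q_\mu\odot Q_\epsilon)\right]$$ (with $\Omega_{\mu\nu}=\Omega_{\nu\mu}$, $\alpha_{\mu\nu}=\alpha_{\nu\mu}$), the general solution is given, for $\mu\neq\nu$, by $$\alpha_{\mu\nu}=\frac{x_\mu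 d_\mu-x_\nu d_\nu}{x_\mu^2-x_\nu^2}-\varepsilon\left(\frac{d_\mu}{x_\mu}+\frac{d_\nu}{x_\nu}\right),\qquad \Omega_{\mu\nu}=\frac{x_\mu d_\nu-x_\nu d_\mu}{x_\mu^2-x_\nu^2},\qquad \alpha^{(\epsilon)}_\mu=\varepsilon\frac{d_\mu}{x_\mu},$$ where $d_1,\dots,d_n$ are $n$ independent real parameters.
   Context: Greek indices run over $1,\dots,n$; repeated Greek indices are not summed unless a sum is written. $\varepsilon\in\{0,1\}$; when $\varepsilon=0$ the coefficients $\alpha^{(\epsilon)}_\mu$ are absent (set to $0$). Functionally independent means that $dx_1,\dots,dx_n$ are linearly independent at every point. $e\wedge f=e\otimes f-f\otimes e$. Square brackets denote normalized antisymmetrization. $h_\mu=e^\mu\wedge\hat e^\mu$, $Q_\mu=e^\mu\otimes e^\mu+\hat e^\mu\otimes\hat e^\mu$, $Q_\epsilon=\varepsilon g$. For antisymmetric $h,f$: $$(h\odot f)_{abcd}=\tfrac14h_{ab}f_{cd}+\tfrac14f_{ab}h_{cd}+\tfrac18h_{ac}f_{bd}+\tfrac18f_{ac}h_{bd}-\tfrac18h_{ad}f_{bc}-\tfrac18f_{ad}h_{bc};$$ for symmetric $Q,k$: $$(Q\odot k)_{abcd}=\tfrac18Q_{ad}k_{bc}+\tfrac18k_{ad}Q_{bc}-\tfrac18Q_{ac}k_{bd}-\tfrac18k_{ac}Q_{bd}.$$ A Riemann-symmetric tensor is a 4-tensor with $r_{abcd}=r_{[ab][cd]}=r_{cdab}$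 and $r_{a[bcd]}=0$. With $e^{\pm\mu}=e^\mu\pm i\hat e^\mu$, a tensor has totally zero weight if it is a linear combination of tensor monomials in $e^{\pm\mu},\hat e^0$ in which, for each $\mu$, the number of factors $e^{+\mu}$ equals the number of factors $e^{-\mu}$. The totally zero weight Riemann-symmetric tensors form a space of dimension $n^2+\varepsilon n$, uniquely parametrized by the coefficients $\Omega_{\mu\nu}$ ($\mu\le\nu$), $\alpha_{\mu\nu}$ ($\mu<\nu$) and (if $\varepsilon=1$) $\alpha^{(\epsilon)}_\mu$ displayed in the claim. *)

theory Defs
  imports "HOL-Analysis.Analysis"
begin

section \<open>Smooth manifolds and tensor fields in charts\<close>

text \<open>Both notions of smoothness are only used on open sets.\<close>

fun Ck_on :: "nat \<Rightarrow> 'a::real_normed_vector set \<Rightarrow> ('a \<Rightarrow> 'b::real_normed_vector) \<Rightarrow> bool" where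
  "Ck_on 0 S f \<longleftrightarrow> continuous_on S f"
| "Ck_on (Suc k) S f \<longleftrightarrow>
     f differentiable_on S \<and> (\<forall>v. Ck_on k S (\<lambda>x. frechet_derivative f (at x) v))"

definition smooth_on :: "'a::real_normed_vector set \<Rightarrow> ('a \<Rightarrow> 'b::real_normed_vector) \<Rightarrow> bool" where
  "smooth_on S f \<longleftrightarrow> (\<forall>k. Ck_on k S f)"

type_synonym ('m, 'd) chart = "'m set \<times> ('m \<Rightarrow> real^'d)"

definition in_chart :: "('m, 'd) chart \<Rightarrow> ('m \<Rightarrow> 'b) \<Rightarrow> real^'d \<Rightarrow> 'b" where
  "in_chart c f = f \<circ> inv_into (fst c) (snd c)"

definition smooth_atlas ::
  "('m::{t2_space, second_countable_topology}, 'd::finite) chart set \<Rightarrow> bool" where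
  "smooth_atlas A \<longleftrightarrow>
     (\<Union>c\<in>A. fst c) = UNIV \<and>
     (\<forall>c\<in>A. open (fst c) \<and> open (snd c ` fst c) \<and>
        homeomorphism (fst c) (snd c ` fst c) (snd c) (inv_into (fst c) (snd c))) \<and>
     (\<forall>c\<in>A. \<forall>c'\<in>A. smooth_on (snd c ` (fst c \<inter> fst c')) (in_chart c (snd c')))"

definition smooth_function :: "('m, 'd::finite) chart set \<Rightarrow> ('m \<Rightarrow> real) \<Rightarrow> bool" where
  "smooth_function A f \<longleftrightarrow> (\<forall>c\<in>A. smooth_on (snd c ` fst c) (in_chart c f))"

definition jacobian ::
  "('m, 'd::finite) chart \<Rightarrow> ('m, 'd) chart \<Rightarrow> 'm \<Rightarrow> real^'d^'d" where
  "jacobian c c' p = matrix (frechet_derivative (in_chart c (snd c')) (at (snd c p)))"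

text \<open>
  A tensor field assigns to each chart and each point of its domain the components in the
  coordinate frame, subject to the transformation law under a change of charts.
\<close>

definition covector_field ::
  "('m, 'd::finite) chart set \<Rightarrow> (('m, 'd) chart \<Rightarrow> 'm \<Rightarrow> real^'d) \<Rightarrow> bool" where
  "covector_field A \<theta> \<longleftrightarrow>
     (\<forall>c\<in>A. smooth_on (snd c ` fst c) (in_chart c (\<theta> c))) \<and>
     (\<forall>c\<in>A. \<forall>c'\<in>A. \<forall>p\<in>fst c \<inter> fst c'. \<theta> c p = transpose (jacobian c c' p) *v \<theta> c' p)"

definition riemannian_metric ::
  "('m, 'd::finite) chart set \<Rightarrow> (('m, 'd) chart \<Rightarrow> 'm \<Rightarrow> real^'d^'d) \<Rightarrow> bool" where
  "riemannian_metric A g \<longleftrightarrow>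
     (\<forall>c\<in>A. smooth_on (snd c ` fst c) (in_chart c (g c))) \<and>
     (\<forall>c\<in>A. \<forall>c'\<in>A. \<forall>p\<in>fst c \<inter> fst c'.
        g c p = transpose (jacobian c c' p) ** g c' p ** jacobian c c' p) \<and>
     (\<forall>c\<in>A. \<forall>p\<in>fst c. transpose (g c p) = g c p \<and> (\<forall>v. v \<noteq> 0 \<longrightarrow> v \<bullet> (g c p *v v) > 0))"

definition differential :: "('m, 'd::finite) chart \<Rightarrow> ('m \<Rightarrow> real) \<Rightarrow> 'm \<Rightarrow> real^'d" where
  "differential c f p = (\<chi> i. frechet_derivative (in_chart c f) (at (snd c p)) (axis i 1))"

definition functionally_independent ::
  "('m, 'd::finite) chart set \<Rightarrow> nat \<Rightarrow> (nat \<Rightarrow> 'm \<Rightarrow> real) \<Rightarrow> bool" where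
  "functionally_independent A n x \<longleftrightarrow>
     (\<forall>c\<in>A. \<forall>p\<in>fst c.
        inj_on (\<lambda>\<mu>. differential c (x \<mu>) p) {1..n} \<and>
        independent ((\<lambda>\<mu>. differential c (x \<mu>) p) ` {1..n}))"

section \<open>The coframe\<close>

text \<open>
  The coframe consists of \<open>e \<mu>\<close> for \<open>\<mu> \<in> {1..n}\<close> and \<open>eh \<mu>\<close> for \<open>\<mu> \<in> hat_indices n \<epsilon>\<close>;
  the odd covector is \<open>eh 0\<close>.
\<close>

definition hat_indices :: "nat \<Rightarrow> nat \<Rightarrow> nat set" where
  "hat_indices n \<epsilon> = {1..n} \<union> (if \<epsilon> = 1 then {0} else {})"

definition cometric :: "real^'d^'d \<Rightarrow> real^'d \<Rightarrow> real^'d::finite \<Rightarrow> real" where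
  "cometric G \<theta> \<phi> = \<theta> \<bullet> (matrix_inv G *v \<phi>)"

definition orthonormal_coframe ::
  "real^'d^'d \<Rightarrow> nat \<Rightarrow> nat \<Rightarrow> (nat \<Rightarrow> real^'d) \<Rightarrow> (nat \<Rightarrow> real^'d::finite) \<Rightarrow> bool" where
  "orthonormal_coframe G n \<epsilon> e eh \<longleftrightarrow>
     (\<forall>\<mu>\<in>{1..n}. \<forall>\<nu>\<in>{1..n}. cometric G (e \<mu>) (e \<nu>) = (if \<mu> = \<nu> then 1 else 0)) \<and>
     (\<forall>\<mu>\<in>hat_indices n \<epsilon>. \<forall>\<nu>\<in>hat_indices n \<epsilon>.
        cometric G (eh \<mu>) (eh \<nu>) = (if \<mu> = \<nu> then 1 else 0)) \<and>
     (\<forall>\<mu>\<in>{1..n}. \<forall>\<nu>\<in>hat_indices n \<epsilon>. cometric G (e \<mu>) (eh \<nu>) = 0)"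

section \<open>Tensors at a point\<close>

text \<open>
  Covariant tensors on a tangent space, given by their components in the coordinate frame of a
  chart: \<open>T $ a $ b\<close> is $T_{ab}$ and \<open>R $ a $ b $ c $ d\<close> is $R_{abcd}$.
\<close>

type_synonym 'd tensor2 = "real^'d^'d"
type_synonym 'd tensor4 = "real^'d^'d^'d^'d"

definition wedge :: "real^'d \<Rightarrow> real^'d \<Rightarrow> 'd::finite tensor2" where
  "wedge e f = (\<chi> a b. e $ a * f $ b - f $ a * e $ b)"

definition Q_tensor :: "real^'d \<Rightarrow> real^'d \<Rightarrow> 'd::finite tensor2" where
  "Q_tensor e f = (\<chi> a b. e $ a * e $ b + f $ a * f $ b)"

definition odot_antisym :: "'d tensor2 \<Rightarrow> 'd tensor2 \<Rightarrow> 'd::finite tensor4" where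
  "odot_antisym h f = (\<chi> a b c d.
      1/4 * h$a$b * f$c$d + 1/4 * f$a$b * h$c$d
    + 1/8 * h$a$c * f$b$d + 1/8 * f$a$c * h$b$d
    - 1/8 * h$a$d * f$b$c - 1/8 * f$a$d * h$b$c)"

definition odot_sym :: "'d tensor2 \<Rightarrow> 'd tensor2 \<Rightarrow> 'd::finite tensor4" where
  "odot_sym Q k = (\<chi> a b c d.
      1/8 * Q$a$d * k$b$c + 1/8 * k$a$d * Q$b$c
    - 1/8 * Q$a$c * k$b$d - 1/8 * k$a$c * Q$b$d)"

definition asym :: "('i \<Rightarrow> 'i \<Rightarrow> real) \<Rightarrow> 'i \<Rightarrow> 'i \<Rightarrow> real" where
  "asym X a b = (X a b - X b a) / 2"

definition asym3 :: "('i \<Rightarrow> 'i \<Rightarrow> 'i \<Rightarrow> real) \<Rightarrow> 'i \<Rightarrow> 'i \<Rightarrow> 'i \<Rightarrow> real" where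
  "asym3 X a b c = (X a b c - X a c b + X b c a - X b a c + X c a b - X c b a) / 6"

definition riemann_symmetric :: "'d::finite tensor4 set" where
  "riemann_symmetric = {R. \<forall>a b c d.
     R$a$b$c$d = asym (\<lambda>a b. asym (\<lambda>c d. R$a$b$c$d) c d) a b \<and>
     R$a$b$c$d = R$c$d$a$b \<and>
     asym3 (\<lambda>b c d. R$a$b$c$d) b c d = 0}"

datatype weight_index = Plus nat | Minus nat | Hat0

fun weight_covector ::
  "(nat \<Rightarrow> real^'d) \<Rightarrow> (nat \<Rightarrow> real^'d) \<Rightarrow> weight_index \<Rightarrow> complex^'d::finite" where
  "weight_covector e eh (Plus \<mu>) = (\<chi> a. of_real (e \<mu> $ a) + \<i> * of_real (eh \<mu> $ a))"
| "weight_covector e eh (Minus \<mu>) = (\<chi> a. of_real (e \<mu> $ a) - \<i> * of_real (eh \<mu> $ a))"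
| "weight_covector e eh Hat0 = (\<chi> a. of_real (eh 0 $ a))"

definition weight_indices :: "nat \<Rightarrow> nat \<Rightarrow> weight_index set" where
  "weight_indices n \<epsilon> = Plus ` {1..n} \<union> Minus ` {1..n} \<union> (if \<epsilon> = 1 then {Hat0} else {})"

text \<open>The list \<open>[i, j, k, l]\<close> stands for the monomial formed by the four covectors it indexes.\<close>

definition zero_weight_monomials :: "nat \<Rightarrow> nat \<Rightarrow> weight_index list set" where
  "zero_weight_monomials n \<epsilon> = {m. length m = 4 \<and> set m \<subseteq> weight_indices n \<epsilon> \<and>
     (\<forall>\<mu>\<in>{1..n}. count_list m (Plus \<mu>) = count_list m (Minus \<mu>))}"

definition zero_weight ::
  "nat \<Rightarrow> nat \<Rightarrow> (nat \<Rightarrow> real^'d) \<Rightarrow> (nat \<Rightarrow> real^'d) \<Rightarrow> 'd::finite tensor4 set" where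
  "zero_weight n \<epsilon> e eh = {R. \<exists>\<kappa> :: weight_index list \<Rightarrow> complex. \<forall>a b c d.
     complex_of_real (R$a$b$c$d) = (\<Sum>m\<in>zero_weight_monomials n \<epsilon>. \<kappa> m *
        weight_covector e eh (m!0) $ a * weight_covector e eh (m!1) $ b *
        weight_covector e eh (m!2) $ c * weight_covector e eh (m!3) $ d)}"

section \<open>The integrability condition\<close>

definition delta :: "'i \<Rightarrow> 'i \<Rightarrow> real" where
  "delta a b = (if a = b then 1 else 0)"

text \<open>$R^{ab}{}_{cd}$\<close>

definition riem_up2 :: "'d tensor2 \<Rightarrow> 'd tensor4 \<Rightarrow> 'd::finite \<Rightarrow> 'd \<Rightarrow> 'd \<Rightarrow> 'd \<Rightarrow> real" where
  "riem_up2 G R a b c d =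
     (\<Sum>p\<in>UNIV. \<Sum>q\<in>UNIV. matrix_inv G $ a $ p * matrix_inv G $ b $ q * R$p$q$c$d)"

text \<open>$R^b{}_d{}^{ef}$\<close>

definition riem_up3 :: "'d tensor2 \<Rightarrow> 'd tensor4 \<Rightarrow> 'd::finite \<Rightarrow> 'd \<Rightarrow> 'd \<Rightarrow> 'd \<Rightarrow> real" where
  "riem_up3 G R b d e f =
     (\<Sum>p\<in>UNIV. \<Sum>q\<in>UNIV. \<Sum>r\<in>UNIV.
        matrix_inv G $ b $ p * matrix_inv G $ e $ q * matrix_inv G $ f $ r * R$p$d$q$r)"

text \<open>$R_{ab} = R^c{}_{acb}$ and $R^a{}_b$\<close>

definition ricci :: "'d tensor2 \<Rightarrow> 'd tensor4 \<Rightarrow> 'd::finite \<Rightarrow> 'd \<Rightarrow> real" where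
  "ricci G R a b = (\<Sum>c\<in>UNIV. \<Sum>p\<in>UNIV. matrix_inv G $ c $ p * R$p$a$c$b)"

definition ricci_up :: "'d tensor2 \<Rightarrow> 'd tensor4 \<Rightarrow> 'd::finite \<Rightarrow> 'd \<Rightarrow> real" where
  "ricci_up G R a b = (\<Sum>p\<in>UNIV. matrix_inv G $ a $ p * ricci G R p b)"

text \<open>$h^a{}_b$\<close>

definition form_up :: "'d tensor2 \<Rightarrow> 'd tensor2 \<Rightarrow> 'd::finite \<Rightarrow> 'd \<Rightarrow> real" where
  "form_up G h a b = (\<Sum>p\<in>UNIV. matrix_inv G $ a $ p * h$p$b)"

text \<open>The left-hand side of the integrability condition, with index order ${}^{ab}{}_{cd}$.\<close>

definition integrability :: "'d tensor2 \<Rightarrow> 'd tensor2 \<Rightarrow> 'd tensor4 \<Rightarrow> 'd::finite tensor4" where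
  "integrability G h R = (\<chi> a b c d.
     (real CARD('d) - 2) *
       asym (\<lambda>c d. \<Sum>e\<in>UNIV. riem_up2 G R a b e c * form_up G h e d) c d
     - asym (\<lambda>a b. asym (\<lambda>c d.
         delta a c * (\<Sum>e\<in>UNIV. \<Sum>f\<in>UNIV. riem_up3 G R b d e f * h$e$f)) c d) a b
     - 2 * asym (\<lambda>a b. asym (\<lambda>c d.
         \<Sum>e\<in>UNIV. ricci_up G R a e * delta b c * form_up G h e d) c d) a b)"

section \<open>Parametrization of the zero weight tensors\<close>

type_synonym coefficients = "(nat \<Rightarrow> nat \<Rightarrow> real) \<times> (nat \<Rightarrow> nat \<Rightarrow> real) \<times> (nat \<Rightarrow> real)"

text \<open>
  The independent coefficients are \<open>\<Omega> \<mu> \<nu>\<close> for \<open>\<mu> \<le> \<nu>\<close>, \<open>\<alpha> \<mu> \<nu>\<close> for \<open>\<mu> < \<nu>\<close> and, if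
  \<open>\<epsilon> = 1\<close>, \<open>\<alpha>\<epsilon> \<mu>\<close>; the remaining values are fixed by symmetry or set to 0.
\<close>

definition coefficient_systems :: "nat \<Rightarrow> nat \<Rightarrow> coefficients set" where
  "coefficient_systems n \<epsilon> = {(\<Omega>, \<alpha>, \<alpha>\<epsilon>).
     (\<forall>\<mu> \<nu>. \<Omega> \<mu> \<nu> = \<Omega> \<nu> \<mu> \<and> \<alpha> \<mu> \<nu> = \<alpha> \<nu> \<mu>) \<and>
     (\<forall>\<mu>. \<alpha> \<mu> \<mu> = 0) \<and>
     (\<forall>\<mu> \<nu>. \<mu> \<notin> {1..n} \<longrightarrow> \<Omega> \<mu> \<nu> = 0 \<and> \<alpha> \<mu> \<nu> = 0 \<and> \<alpha>\<epsilon> \<mu> = 0) \<and>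
     (\<epsilon> = 0 \<longrightarrow> (\<forall>\<mu>. \<alpha>\<epsilon> \<mu> = 0))}"

definition zero_weight_tensor ::
  "'d tensor2 \<Rightarrow> nat \<Rightarrow> nat \<Rightarrow> (nat \<Rightarrow> real^'d) \<Rightarrow> (nat \<Rightarrow> real^'d) \<Rightarrow> coefficients \<Rightarrow>
   'd::finite tensor4" where
  "zero_weight_tensor G n \<epsilon> e eh = (\<lambda>(\<Omega>, \<alpha>, \<alpha>\<epsilon>).
     let hm = (\<lambda>\<mu>. wedge (e \<mu>) (eh \<mu>)); Q = (\<lambda>\<mu>. Q_tensor (e \<mu>) (eh \<mu>)); Q\<epsilon> = real \<epsilon> *\<^sub>R G in
     (\<Sum>\<mu>\<in>{1..n}. \<Sum>\<nu>\<in>{\<mu><..n}.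
        \<Omega> \<mu> \<nu> *\<^sub>R odot_antisym (hm \<mu>) (hm \<nu>) + \<alpha> \<mu> \<nu> *\<^sub>R odot_sym (Q \<mu>) (Q \<nu>)) +
     (\<Sum>\<mu>\<in>{1..n}.
        (1/2 * \<Omega> \<mu> \<mu>) *\<^sub>R odot_antisym (hm \<mu>) (hm \<mu>) + \<alpha>\<epsilon> \<mu> *\<^sub>R odot_sym (Q \<mu>) Q\<epsilon>))"

end

theory Submission
  imports Defs
begin

text \<open>
  The null covectors \<open>e \<mu> \<plusminus> \<i> eh \<mu>\<close> and \<open>eh 0\<close> diagonalize \<open>h\<close>. Let \<open>f i\<close> be the dual null
  frame, \<open>bar i\<close> the conjugate index, and \<open>lam i\<close> the eigenvalue of \<open>h\<close> on \<open>f i\<close>, which is \<open>-\<i> X \<mu>\<close>, \<open>\<i> X \<mu>\<close> or 0;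
  thus \<open>lam (bar i) = - lam i\<close>. A tensor has totally zero weight iff its component \<open>R i j k l\<close> vanishes
  unless the four indices form two conjugate pairs (\<open>zero_weight_iff\<close>). For a Riemann-symmetric \<open>R\<close> the
  Bianchi identity then leaves only the sectional components \<open>A i j = R i j (bar i) (bar j)\<close>, which are
  symmetric, real and invariant under conjugation of both indices, and they determine \<open>R\<close>
  (\<open>r_determined\<close>). On the displayed tensors the sectional components are given by a triangular
  system in the coefficients (\<open>sectional_zero_weight_tensor\<close>). Solving it proves that the parametrization
  is bijective.
  
  In the null frame the integrability condition is nearly diagonal. If \<open>kappa i\<close> denotes the norm
  factor 2 or 1 of the null covector \<open>i\<close>, if \<open>B i j = kappa i * kappa j * (lam i + lam j) * A i j\<close>, and if
  \<open>V i\<close> is half the sum of \<open>B i j\<close> over all \<open>j\<close>, then the condition reads \<open>(D - 2) / 2 * B i j = V i + V j\<close> for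
  all \<open>j\<close> other than \<open>i\<close> and \<open>bar i\<close> (\<open>integrability_component_iff\<close>); the contraction with \<open>h\<close> and the Ricci
  term have merged into \<open>V\<close>. As \<open>B\<close> is odd under conjugation, so is \<open>V\<close>. The equation says that
  \<open>B i j = \<delta> i + \<delta> j\<close> with an odd function \<open>\<delta>\<close>, and any odd \<open>\<delta>\<close> occurs, because summing over the \<open>D - 2\<close>
  admissible \<open>j\<close> returns \<open>V i = (D - 2) / 2 * \<delta> i\<close> (\<open>flux_equation_iff\<close>).
  
  An odd \<open>\<delta>\<close> amounts to \<open>n\<close> parameters \<open>d \<mu>\<close>. Written out for the index pairs \<open>(\<mu>, \<nu>)\<close>, \<open>(\<mu>, bar \<nu>)\<close> and
  \<open>(\<mu>, 0)\<close>, the equation \<open>B i j = \<delta> i + \<delta> j\<close> is a linear system with the factors \<open>X \<mu> + X \<nu>\<close>, \<open>X \<mu> - X \<nu>\<close>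
  and \<open>X \<mu>\<close>, whose solution is the stated one (\<open>crossed_system_iff\<close>,
  \<open>integrability_zero_weight_tensor_iff\<close>). Since \<open>lam i + lam (bar i) = 0\<close>, the components
  \<open>A \<mu> (bar \<mu>)\<close>, hence the \<open>\<Omega> \<mu> \<mu>\<close>, stay free. The kernel therefore has dimension \<open>2 * n\<close>, and the rank
  follows from the dimension \<open>n * (n + \<epsilon>)\<close> of the whole space.
\<close>

section \<open>Rank, nullity and coordinates\<close>

text \<open>
  On the orthogonal complement of the kernel within \<open>V\<close> the map is injective and has the same image
  as on \<open>V\<close>.
\<close>

lemma rank_nullity_on_subspace:
  fixes f :: "'a::euclidean_space \<Rightarrow> 'b::euclidean_space"
  assumes "linear f" and "subspace V"
  shows "dim (f ` V) + dim {v \<in> V. f v = 0} = dim V"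
proof -
  interpret linear f by fact
  let ?K = "{v \<in> V. f v = 0}"
  let ?U = "{y \<in> V. \<forall>x\<in>?K. orthogonal x y}"
  have K: "subspace ?K"
    using assms(2) by (auto simp: subspace_def add scale)
  have split: "dim ?U + dim ?K = dim V"
    using dim_subspace_orthogonal_to_vectors[OF K assms(2)] by auto
  have U: "subspace ?U"
    using assms(2) by (auto simp: subspace_def orthogonal_clauses)
  have "inj_on f ?U"
    unfolding linear_inj_on_iff_eq_0[OF assms(1) U]
  proof (intro ballI impI)
    fix y assume "y \<in> ?U" "f y = 0"
    then have "orthogonal y y" by blast
    then show "y = 0" by (simp add: orthogonal_def)
  qed
  moreover have "span ?U = ?U"
    using U by (rule span_eq_iff[THEN iffD2])
  ultimately have "dim (f ` ?U) = dim ?U"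
    using dim_image_eq[OF assms(1), of ?U] by (simp only:)
  moreover have "f ` V = f ` ?U"
  proof
    show "f ` V \<subseteq> f ` ?U"
    proof
      fix w assume "w \<in> f ` V"
      then obtain v where v: "v \<in> V" "w = f v" by blast
      obtain y z where y: "y \<in> span ?K" and z: "\<And>u. u \<in> span ?K \<Longrightarrow> orthogonal z u"
        and vyz: "v = y + z"
        by (rule orthogonal_subspace_decomp_exists[of ?K v]) blast
      have yK: "y \<in> ?K" using y K by (simp add: span_eq_iff[THEN iffD2])
      have "z = v - y" using vyz by simp
      then have "z \<in> V" using v yK assms(2) by (simp add: subspace_diff)
      moreover have "\<forall>u\<in>?K. orthogonal u z"
        using z by (meson orthogonal_commute span_base)
      ultimately have "z \<in> ?U" by blast
      moreover have "f z = w" using v vyz yK by (simp add: add)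
      ultimately show "w \<in> f ` ?U" by blast
    qed
  qed auto
  ultimately show ?thesis using split by simp
qed

text \<open>
  The dual family \<open>b\<close>, on which the coordinate \<open>\<phi> k\<close> takes the value 1 at \<open>b k\<close> and 0 at the other
  members, is a basis. In this form a dimension can be counted from linear functionals that
  separate points and take arbitrary values, and no basis of tensors has to be exhibited.
\<close>

lemma dim_eq_card_coordinates:
  fixes V :: "'a::euclidean_space set" and \<phi> :: "'k \<Rightarrow> 'a \<Rightarrow> real"
  assumes "subspace V" and "finite K" and lin: "\<And>k. k \<in> K \<Longrightarrow> linear (\<phi> k)"
    and inj: "\<And>v. v \<in> V \<Longrightarrow> (\<And>k. k \<in> K \<Longrightarrow> \<phi> k v = 0) \<Longrightarrow> v = 0"
    and surj: "\<And>t. \<exists>v\<in>V. \<forall>k\<in>K. \<phi> k v = t k"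
  shows "dim V = card K"
proof -
  have "\<exists>v. v \<in> V \<and> (\<forall>k\<in>K. \<phi> k v = (if k = j then 1 else 0))" for j
    using surj[of "\<lambda>k. if k = j then 1 else 0"] by blast
  then obtain b where bV: "\<And>j. b j \<in> V"
    and b: "\<And>j k. k \<in> K \<Longrightarrow> \<phi> k (b j) = (if k = j then 1 else 0)"
    by metis
  have coord: "\<phi> k (\<Sum>j\<in>K. u j *\<^sub>R b j) = u k" if "k \<in> K" for u k
  proof -
    interpret linear "\<phi> k" using lin[OF that] .
    have "\<phi> k (\<Sum>j\<in>K. u j *\<^sub>R b j) = (\<Sum>j\<in>K. if k = j then u j else 0)"
      by (auto simp: sum scale b[OF that] intro!: sum.cong)
    then show ?thesis using that \<open>finite K\<close> by simp
  qed
  have b_inj: "inj_on b K"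
    by (rule inj_onI) (metis b zero_neq_one)
  have "independent (b ` K)"
  proof (rule independent_if_scalars_zero)
    show "finite (b ` K)" using \<open>finite K\<close> by simp
    fix u y assume eq: "(\<Sum>x\<in>b ` K. u x *\<^sub>R x) = 0" and "y \<in> b ` K"
    then obtain k where k: "k \<in> K" "y = b k" by blast
    have "(\<Sum>j\<in>K. u (b j) *\<^sub>R b j) = 0"
      using eq by (simp add: sum.reindex[OF b_inj])
    then have "u (b k) = \<phi> k 0" using coord[OF k(1), of "u \<circ> b"] by simp
    also have "\<dots> = 0" using lin[OF k(1)] by (rule linear_0)
    finally show "u y = 0" using k by simp
  qed
  moreover have "V \<subseteq> span (b ` K)"
  proof
    fix v assume v: "v \<in> V"
    let ?w = "\<Sum>j\<in>K. \<phi> j v *\<^sub>R b j"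
    have "v - ?w = 0"
    proof (rule inj)
      show "v - ?w \<in> V"
        using v bV assms(1) by (intro subspace_diff subspace_sum subspace_scale) auto
      show "\<phi> k (v - ?w) = 0" if "k \<in> K" for k
        using coord[OF that] by (simp add: linear_diff[OF lin[OF that]])
    qed
    then have "v = ?w" by simp
    moreover have "?w \<in> span (b ` K)"
      by (intro span_sum span_scale span_base) auto
    ultimately show "v \<in> span (b ` K)" by metis
  qed
  ultimately have "dim V = card (b ` K)"
    using bV by (intro basis_card_eq_dim[symmetric, THEN trans]) auto
  then show ?thesis using b_inj by (simp add: card_image)
qed

section \<open>Zero weight monomials\<close>

fun bar :: "weight_index \<Rightarrow> weight_index" where
  "bar (Plus \<mu>) = Minus \<mu>"
| "bar (Minus \<mu>) = Plus \<mu>"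
| "bar Hat0 = Hat0"

definition paired :: "weight_index \<Rightarrow> weight_index \<Rightarrow> weight_index \<Rightarrow> weight_index \<Rightarrow> bool" where
  "paired i j k l \<longleftrightarrow>
     (j = bar i \<and> l = bar k) \<or> (k = bar i \<and> l = bar j) \<or> (l = bar i \<and> k = bar j)"

lemma bar_bar [simp]: "bar (bar i) = i"
  by (cases i) auto

lemma bar_eq_iff [simp]: "bar i = bar j \<longleftrightarrow> i = j"
  by (metis bar_bar)

lemma bar_eq_self_iff [simp]: "bar i = i \<longleftrightarrow> i = Hat0" "i = bar i \<longleftrightarrow> i = Hat0"
  by (cases i; simp)+

lemma bar_eq_Hat0_iff [simp]: "bar i = Hat0 \<longleftrightarrow> i = Hat0" "Hat0 = bar i \<longleftrightarrow> i = Hat0"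
  by (cases i; simp)+

lemma bar_in_weight_indices [simp]:
  "bar i \<in> weight_indices n \<epsilon> \<longleftrightarrow> i \<in> weight_indices n \<epsilon>"
  by (cases i) (auto simp: weight_indices_def)

lemma finite_weight_indices [simp]: "finite (weight_indices n \<epsilon>)"
  by (simp add: weight_indices_def)

lemma count_paired:
  assumes "\<And>\<mu>. count_list m (Plus \<mu>) = count_list m (Minus \<mu>)"
  shows "count_list m (bar i) = count_list m i"
  using assms by (cases i) auto

text \<open>
  The weight condition that defines the zero weight monomials, extended to \<open>Hat0\<close>, where it is
  trivial, so that it can be used uniformly in the index.
\<close>

definition balanced :: "weight_index list \<Rightarrow> bool" where
  "balanced m \<longleftrightarrow> (\<forall>a. count_list m (bar a) = count_list m a)"

lemma balanced_mset: "balanced m \<Longrightarrow> mset m = mset m' \<Longrightarrow> balanced m'"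
  unfolding balanced_def by (metis count_mset)

lemma balanced_Cons_bar: "balanced (a # bar a # m) \<longleftrightarrow> balanced m"
proof -
  have "count_list (a # bar a # m) (bar b) = count_list (a # bar a # m) b \<longleftrightarrow>
        count_list m (bar b) = count_list m b" for b
    by (cases "b = a"; cases "b = bar a") auto
  then show ?thesis by (simp add: balanced_def)
qed

lemma bar_mem_balanced: "balanced m \<Longrightarrow> a \<in> set m \<Longrightarrow> bar a \<in> set m"
  unfolding balanced_def by (metis count_list_0_iff)

lemma balanced_pair: 
  assumes "balanced [k, l]" shows "l = bar k"
proof (cases "k = Hat0")
  case True
  then show ?thesis using bar_mem_balanced[OF assms, of l] by auto
next
  case False
  then show ?thesis using bar_mem_balanced[OF assms, of k] by auto
qed

lemma paired_imp_balanced: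
  assumes "paired i j k l" shows "balanced [i, j, k, l]"
proof -
  have nil: "balanced []" by (simp add: balanced_def)
  have ij: "balanced [i, bar i, j, bar j]" for i j
    by (simp add: balanced_Cons_bar nil)
  have "balanced [i, j, bar i, bar j]" "balanced [i, j, bar j, bar i]"
    by (rule balanced_mset[OF ij[of i j]]; simp)+
  with assms ij show ?thesis unfolding paired_def by (elim disjE conjE) simp_all
qed

text \<open>
  An index other than \<open>Hat0\<close> must meet its conjugate among the other three; when this pair is removed
  the remaining two indices are balanced, hence conjugate to each other.
\<close>

lemma balanced_imp_paired:
  assumes "balanced [i, j, k, l]" shows "paired i j k l"
proof -
  have *: "paired a b c d" if "a \<noteq> Hat0" and bal: "balanced [a, b, c, d]" for a b c d
  proof -
    have "bar a \<in> {b, c, d}"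
      using bar_mem_balanced[OF bal, of a] that(1) by auto
    then consider "b = bar a" | "c = bar a" | "d = bar a" by blast
    then show ?thesis
    proof cases
      case 1
      then have "balanced [c, d]" using bal by (simp add: balanced_Cons_bar)
      then show ?thesis using 1 balanced_pair by (simp add: paired_def)
    next
      case 2
      have "balanced [a, c, b, d]" by (rule balanced_mset[OF bal]) simp
      then have "balanced [b, d]" by (simp add: 2 balanced_Cons_bar)
      then show ?thesis using 2 balanced_pair by (simp add: paired_def)
    next
      case 3
      have "balanced [a, d, b, c]" by (rule balanced_mset[OF bal]) simp
      then have "balanced [b, c]" by (simp add: 3 balanced_Cons_bar)
      then show ?thesis using 3 balanced_pair by (simp add: paired_def)
    qed
  qed
  show ?thesis
  proof (cases "i = Hat0")
    case i: True
    show ?thesis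
    proof (cases "j = Hat0")
      case True
      then have "balanced [k, l]"
        using assms i balanced_Cons_bar[of Hat0] by simp
      then show ?thesis using i True balanced_pair by (simp add: paired_def)
    next
      case False
      have "balanced [j, i, k, l]" by (rule balanced_mset[OF assms]) simp
      then have "paired j i k l" by (rule *[OF False])
      then show ?thesis using i unfolding paired_def by auto
    qed
  qed (use * assms in blast)
qed

lemma zero_weight_monomials_paired:
  "zero_weight_monomials n \<epsilon> =
     {[i, j, k, l] | i j k l. {i, j, k, l} \<subseteq> weight_indices n \<epsilon> \<and> paired i j k l}"
proof (intro equalityI subsetI)
  fix m assume m: "m \<in> zero_weight_monomials n \<epsilon>"
  then have "length m = 4" by (simp add: zero_weight_monomials_def)
  then obtain i j k l where ijkl: "m = [i, j, k, l]"
    by (auto simp: length_Suc_conv numeral_eq_Suc)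
  have J: "{i, j, k, l} \<subseteq> weight_indices n \<epsilon>"
    using m by (simp add: zero_weight_monomials_def ijkl)
  have "count_list m (Plus \<mu>) = count_list m (Minus \<mu>)" for \<mu>
  proof (cases "\<mu> \<in> {1..n}")
    case False
    then have "Plus \<mu> \<notin> weight_indices n \<epsilon>" "Minus \<mu> \<notin> weight_indices n \<epsilon>"
      by (auto simp: weight_indices_def)
    then have "Plus \<mu> \<notin> set m" "Minus \<mu> \<notin> set m"
      using J by (auto simp: ijkl)
    then show ?thesis by (simp add: count_notin)
  qed (use m in \<open>simp add: zero_weight_monomials_def\<close>)
  then have "count_list m (bar a) = count_list m a" for a
    by (rule count_paired)
  then have "paired i j k l"
    by (intro balanced_imp_paired) (simp add: balanced_def ijkl)
  then show "m \<in> {[i, j, k, l] | i j k l. {i, j, k, l} \<subseteq> weight_indices n \<epsilon> \<and> paired i j k l}"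
    using ijkl J by blast
next
  fix m assume "m \<in> {[i, j, k, l] | i j k l. {i, j, k, l} \<subseteq> weight_indices n \<epsilon> \<and> paired i j k l}"
  then obtain i j k l where m: "m = [i, j, k, l]" "{i, j, k, l} \<subseteq> weight_indices n \<epsilon>" "paired i j k l"
    by blast
  have "count_list m (Plus \<mu>) = count_list m (Minus \<mu>)" for \<mu>
    using paired_imp_balanced[OF m(3)] unfolding m(1) balanced_def by (metis bar.simps(1))
  moreover have "length m = 4" "set m \<subseteq> weight_indices n \<epsilon>"
    using m(1,2) by simp_all
  ultimately show "m \<in> zero_weight_monomials n \<epsilon>"
    unfolding zero_weight_monomials_def by blast
qed

section \<open>Zero weight curvature components\<close>

text \<open>
  The norms of the null covectors: \<open>e \<plusminus> \<i> eh\<close> pair with their conjugates to 2 and \<open>eh 0\<close> with itself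
  to 1. Raising the index of the covector \<open>i\<close> therefore gives \<open>frame_scale i\<close> times the vector of
  the dual null frame with the index \<open>bar i\<close>.
\<close>

definition frame_scale :: "weight_index \<Rightarrow> complex" where
  "frame_scale i = (if i = Hat0 then 1 else 2)"

lemma frame_scale_bar [simp]: "frame_scale (bar i) = frame_scale i"
  by (simp add: frame_scale_def)

lemma frame_scale_nonzero [simp]: "frame_scale i \<noteq> 0"
  by (simp add: frame_scale_def)

lemma sum_bar:
  "(\<Sum>i\<in>weight_indices n \<epsilon>. F (bar i)) = (\<Sum>i\<in>weight_indices n \<epsilon>. F i)"
  by (rule sum.reindex_bij_witness[of _ bar bar]) auto

text \<open>
  The left-hand side of the integrability condition in null components, with both upper indices
  lowered up to the factors \<open>frame_scale\<close>: \<open>lam\<close> are the eigenvalues of \<open>h\<close>, the inverse metric has the only entries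
  \<open>frame_scale i\<close> at \<open>(i, bar i)\<close>, \<open>P\<close> is the contraction of the last index pair of the curvature
  with \<open>h\<close>, and \<open>S\<close> is the Ricci tensor.
\<close>

definition integrability_component ::
  "nat \<Rightarrow> nat \<Rightarrow> (weight_index \<Rightarrow> complex) \<Rightarrow>
   (weight_index \<Rightarrow> weight_index \<Rightarrow> weight_index \<Rightarrow> weight_index \<Rightarrow> complex) \<Rightarrow>
   weight_index \<Rightarrow> weight_index \<Rightarrow> weight_index \<Rightarrow> weight_index \<Rightarrow> complex" where
  "integrability_component n \<epsilon> lam r i j k l = (
     let J = weight_indices n \<epsilon>;
         P = (\<lambda>a b. \<Sum>m\<in>J. frame_scale m * lam m * r a b m (bar m));
         S = (\<lambda>a b. \<Sum>m\<in>J. frame_scale m * r m a (bar m) b);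
         dl = (\<lambda>a b. of_bool (b = bar a) :: complex)
     in (of_nat (card J) - 2) / 2 * frame_scale i * frame_scale j * (lam l * r i j l k - lam k * r i j k l)
       - (dl i k * frame_scale j * P j l - dl j k * frame_scale i * P i l
          - dl i l * frame_scale j * P j k + dl j l * frame_scale i * P i k) / 4
       - (dl j k * lam l * frame_scale i * S i l - dl i k * lam l * frame_scale j * S j l
          - dl j l * lam k * frame_scale i * S i k + dl i l * lam k * frame_scale j * S j k) / 2)"

text \<open>
  The analogue, for the complex plane spanned by the null vectors \<open>i\<close> and \<open>j\<close>, of a sectional
  curvature: the second pair of arguments is the conjugate of the first.
\<close>

definition sectional ::
  "(weight_index \<Rightarrow> weight_index \<Rightarrow> weight_index \<Rightarrow> weight_index \<Rightarrow> complex) \<Rightarrow>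
   weight_index \<Rightarrow> weight_index \<Rightarrow> complex" where
  "sectional r i j = r i j (bar i) (bar j)"

text \<open>
  Up to transposition and simultaneous conjugation there are only four kinds of pairs of distinct
  null indices.
\<close>

lemma weight_index_pair_cases [consumes 3, case_names sym bar plus_plus plus_minus plane axis]:
  assumes "i \<in> weight_indices n \<epsilon>" "j \<in> weight_indices n \<epsilon>" "i \<noteq> j"
    and sym: "\<And>i j. P i j \<Longrightarrow> P j i" and bar: "\<And>i j. P i j \<Longrightarrow> P (bar i) (bar j)"
    and pp: "\<And>a b. a \<in> {1..n} \<Longrightarrow> b \<in> {1..n} \<Longrightarrow> a \<noteq> b \<Longrightarrow> P (Plus a) (Plus b)"
    and pm: "\<And>a b. a \<in> {1..n} \<Longrightarrow> b \<in> {1..n} \<Longrightarrow> a \<noteq> b \<Longrightarrow> P (Plus a) (Minus b)"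
    and plane: "\<And>a. a \<in> {1..n} \<Longrightarrow> P (Plus a) (Minus a)"
    and axis: "\<And>a. a \<in> {1..n} \<Longrightarrow> Hat0 \<in> weight_indices n \<epsilon> \<Longrightarrow> P (Plus a) Hat0"
  shows "P i j"
proof -
  have range: "Plus a \<in> weight_indices n \<epsilon> \<Longrightarrow> a \<in> {1..n}" "Minus a \<in> weight_indices n \<epsilon> \<Longrightarrow> a \<in> {1..n}"
    for a
    by (auto simp: weight_indices_def split: if_splits)
  have mm: "P (Minus a) (Minus b)" if "a \<in> {1..n}" "b \<in> {1..n}" "a \<noteq> b" for a b
    using bar[OF pp[OF that]] by simp
  have pm': "P (Plus a) (Minus b)" if "a \<in> {1..n}" "b \<in> {1..n}" for a b
    using pm plane that by (cases "a = b") auto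
  have axis': "P (Minus a) Hat0" if "a \<in> {1..n}" "Hat0 \<in> weight_indices n \<epsilon>" for a
    using bar[OF axis[OF that]] by simp
  show ?thesis
    using assms(1-3)
  proof (cases i; cases j)
    fix a b assume "i = Plus a" "j = Plus b"
    with assms(1-3) show ?thesis using range(1) pp by simp
  next
    fix a b assume "i = Plus a" "j = Minus b"
    with assms(1-3) show ?thesis using range(1,2) pm' by simp
  next
    fix a b assume "i = Minus a" "j = Plus b"
    with assms(1-3) show ?thesis using range(1,2) pm'[THEN sym] by simp
  next
    fix a b assume "i = Minus a" "j = Minus b"
    with assms(1-3) show ?thesis using range(2) mm by simp
  next
    fix a assume "i = Plus a" "j = Hat0"
    with assms(1-3) show ?thesis using range(1) axis by simp
  next
    fix a assume "i = Minus a" "j = Hat0"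
    with assms(1-3) show ?thesis using range(2) axis' by simp
  next
    fix a assume "i = Hat0" "j = Plus a"
    with assms(1-3) show ?thesis using range(1) axis[THEN sym] by simp
  next
    fix a assume "i = Hat0" "j = Minus a"
    with assms(1-3) show ?thesis using range(2) axis'[THEN sym] by simp
  qed simp
qed

locale zero_weight_components =
  fixes n \<epsilon> :: nat
    and r :: "weight_index \<Rightarrow> weight_index \<Rightarrow> weight_index \<Rightarrow> weight_index \<Rightarrow> complex"
  assumes skew: "r j i k l = - r i j k l"
    and pair: "r k l i j = r i j k l"
    and bianchi: "r i j k l + r i k l j + r i l j k = 0"
    and weight: "\<lbrakk>i \<in> weight_indices n \<epsilon>; j \<in> weight_indices n \<epsilon>; k \<in> weight_indices n \<epsilon>;
        l \<in> weight_indices n \<epsilon>; \<not> paired i j k l\<rbrakk> \<Longrightarrow> r i j k l = 0"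
begin

abbreviation sec :: "weight_index \<Rightarrow> weight_index \<Rightarrow> complex" where
  "sec \<equiv> sectional r"

lemma skew': "r i j l k = - r i j k l"
  by (metis skew pair)

lemma r_same [simp]: "r i i k l = 0" "r i j k k = 0"
  using skew[of i i k l] skew'[of i j k k] by simp_all

lemma sec_sym: "sec j i = sec i j"
  unfolding sectional_def by (metis skew skew' minus_minus)

lemma sec_bar: "sec (bar i) (bar j) = sec i j"
  unfolding sectional_def by (simp add: pair)

lemma sec_self [simp]: "sec i i = 0"
  by (simp add: sectional_def)

text \<open>
  The first Bianchi identity expresses the components with two adjacent conjugate pairs through the
  sectional ones.
\<close>

lemma r_bar_bar: "r i (bar i) k (bar k) = sec i k - sec i (bar k)"
proof -
  have "r i (bar i) k (bar k) + r i k (bar k) (bar i) + r i (bar k) (bar i) k = 0"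
    by (rule bianchi)
  moreover have "r i k (bar k) (bar i) = - sec i k"
    unfolding sectional_def by (rule skew')
  moreover have "r i (bar k) (bar i) k = sec i (bar k)"
    unfolding sectional_def by simp
  ultimately show ?thesis by (simp add: algebra_simps add_eq_0_iff)
qed

text \<open>
  Contracting a conjugate pair in a paired multi-index leaves a conjugate pair, so that the Ricci
  tensor, and in the next lemma the contraction with \<open>h\<close>, is antidiagonal in the null frame.
\<close>

lemma ricci_zero:
  assumes "i \<in> weight_indices n \<epsilon>" "j \<in> weight_indices n \<epsilon>" "m \<in> weight_indices n \<epsilon>" "j \<noteq> bar i"
  shows "r m i (bar m) j = 0"
proof (rule weight)
  show "\<not> paired m i (bar m) j"
    using assms(4) by (auto simp: paired_def)
qed (use assms in auto)

lemma trace_zero: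
  assumes "i \<in> weight_indices n \<epsilon>" "j \<in> weight_indices n \<epsilon>" "m \<in> weight_indices n \<epsilon>" "j \<noteq> bar i"
  shows "r i j m (bar m) = 0"
proof (rule weight)
  show "\<not> paired i j m (bar m)"
    using assms(4) by (auto simp: paired_def)
qed (use assms in auto)

text \<open>
  For each of the three ways in which four indices can be paired, the component is a sectional one up
  to sign, or a difference of two sectional ones.
\<close>

lemma r_determined:
  assumes "zero_weight_components n \<epsilon> r'"
    and eq: "\<And>i j. i \<in> weight_indices n \<epsilon> \<Longrightarrow> j \<in> weight_indices n \<epsilon> \<Longrightarrow> i \<noteq> j \<Longrightarrow>
      sec i j = sectional r' i j"
    and J: "i \<in> weight_indices n \<epsilon>" "j \<in> weight_indices n \<epsilon>" "k \<in> weight_indices n \<epsilon>"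
      "l \<in> weight_indices n \<epsilon>"
  shows "r i j k l = r' i j k l"
proof -
  interpret r': zero_weight_components n \<epsilon> r' by fact
  have eq': "sec a b = sectional r' a b" if "a \<in> weight_indices n \<epsilon>" "b \<in> weight_indices n \<epsilon>" for a b
    using eq[OF that] by (cases "a = b") auto
  show ?thesis
  proof (cases "paired i j k l")
    case True
    then consider "j = bar i" "l = bar k" | "k = bar i" "l = bar j" | "l = bar i" "k = bar j"
      unfolding paired_def by blast
    then show ?thesis
    proof cases
      case 1
      then show ?thesis using eq' J by (simp add: r_bar_bar r'.r_bar_bar)
    next
      case 2
      then show ?thesis using eq'[OF J(1,2)] by (simp add: sectional_def)
    next
      case 3
      then show ?thesis using eq'[OF J(1,2)] skew'[of i j k l] r'.skew'[of i j k l]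
        by (simp add: sectional_def)
    qed
  qed (use weight[OF J] r'.weight[OF J] in simp)
qed

text \<open>
  The combination of sectional component and eigenvalues on which the integrability condition
  acts. It vanishes for \<open>j = bar i\<close>, because the eigenvalues cancel there, and this is why the sectional
  components in the planes \<open>(Plus \<mu>, Minus \<mu>)\<close> are unconstrained.
\<close>

definition flux :: "(weight_index \<Rightarrow> complex) \<Rightarrow> weight_index \<Rightarrow> weight_index \<Rightarrow> complex" where
  "flux lam i j = frame_scale i * frame_scale j * (lam i + lam j) * sec i j"

definition total_flux :: "(weight_index \<Rightarrow> complex) \<Rightarrow> weight_index \<Rightarrow> complex" where
  "total_flux lam i = (\<Sum>j\<in>weight_indices n \<epsilon>. flux lam i j) / 2"

context
  fixes lam :: "weight_index \<Rightarrow> complex"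
  assumes lam_bar: "\<And>i. lam (bar i) = - lam i"
begin

text \<open>
  Up to the antisymmetry in each index pair, a component can be nonzero only if \<open>k = bar i\<close>,
  \<open>l = bar j\<close> and \<open>j\<close> is neither \<open>i\<close> nor \<open>bar i\<close>. In this pattern the first term is a multiple of the
  flux, and the contraction with \<open>h\<close> and the Ricci term add up to the total fluxes of \<open>i\<close> and \<open>j\<close>.
\<close>

lemma integrability_component_iff:
  "(\<forall>i\<in>weight_indices n \<epsilon>. \<forall>j\<in>weight_indices n \<epsilon>. \<forall>k\<in>weight_indices n \<epsilon>. \<forall>l\<in>weight_indices n \<epsilon>.
      integrability_component n \<epsilon> lam r i j k l = 0) \<longleftrightarrow>
   (\<forall>i\<in>weight_indices n \<epsilon>. \<forall>j\<in>weight_indices n \<epsilon>. j \<noteq> i \<and> j \<noteq> bar i \<longrightarrow>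
      (of_nat (card (weight_indices n \<epsilon>)) - 2) / 2 * flux lam i j =
        total_flux lam i + total_flux lam j)"
proof -
  let ?J = "weight_indices n \<epsilon>"
  define P where "P a b = (\<Sum>m\<in>?J. frame_scale m * lam m * r a b m (bar m))" for a b
  define S where "S a b = (\<Sum>m\<in>?J. frame_scale m * r m a (bar m) b)" for a b
  define dl where "dl a b = (of_bool (b = bar a) :: complex)" for a b
  define D where "D = (of_nat (card ?J) - 2 :: complex)"
  define X where "X = integrability_component n \<epsilon> lam r"
  have X: "X i j k l =
      D / 2 * frame_scale i * frame_scale j * (lam l * r i j l k - lam k * r i j k l)
       - (dl i k * frame_scale j * P j l - dl j k * frame_scale i * P i l
          - dl i l * frame_scale j * P j k + dl j l * frame_scale i * P i k) / 4
       - (dl j k * lam l * frame_scale i * S i l - dl i k * lam l * frame_scale j * S j l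
          - dl j l * lam k * frame_scale i * S i k + dl i l * lam k * frame_scale j * S j k) / 2"
    for i j k l
    by (simp add: X_def integrability_component_def Let_def P_def S_def dl_def D_def)
  have P_skew: "P b a = - P a b" for a b
    unfolding P_def sum_negf[symmetric] by (intro sum.cong refl) (simp add: skew[of a b])
  have S_sym: "S b a = S a b" for a b
  proof -
    have "S b a = (\<Sum>m\<in>?J. frame_scale (bar m) * r (bar m) b m a)"
      unfolding S_def by (subst sum_bar[symmetric]) simp
    also have "\<dots> = S a b" unfolding S_def by (intro sum.cong refl) (simp add: pair)
    finally show ?thesis .
  qed
  have P_zero: "P a b = 0" if "a \<in> ?J" "b \<in> ?J" "b \<noteq> bar a" for a b
    unfolding P_def by (intro sum.neutral ballI) (simp add: trace_zero that)
  have S_zero: "S a b = 0" if "a \<in> ?J" "b \<in> ?J" "b \<noteq> bar a" for a b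
    unfolding S_def by (intro sum.neutral ballI) (simp add: ricci_zero that)
  have V: "total_flux lam a = frame_scale a * (P a (bar a) / 4 + lam a * S a (bar a) / 2)" for a
  proof -
    \<comment> \<open>Conjugating the summation index changes the sign of \<open>lam\<close>, so the two parts of the Bianchi difference reinforce each other.\<close>
    have "P a (bar a) = (\<Sum>m\<in>?J. frame_scale m * lam m * sec a m) - (\<Sum>m\<in>?J. frame_scale m * lam m * sec a (bar m))"
      unfolding P_def by (simp add: r_bar_bar algebra_simps sum_subtractf)
    also have "(\<Sum>m\<in>?J. frame_scale m * lam m * sec a (bar m)) = (\<Sum>m\<in>?J. - (frame_scale m * lam m * sec a m))"
      by (subst sum_bar[symmetric]) (simp add: lam_bar)
    finally have P: "P a (bar a) = 2 * (\<Sum>m\<in>?J. frame_scale m * lam m * sec a m)"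
      by (simp add: sum_negf)
    have S: "S a (bar a) = (\<Sum>m\<in>?J. frame_scale m * sec a m)"
      unfolding S_def by (intro sum.cong refl) (metis sectional_def sec_sym)
    have "total_flux lam a = frame_scale a * ((\<Sum>m\<in>?J. frame_scale m * lam m * sec a m) +
        lam a * (\<Sum>m\<in>?J. frame_scale m * sec a m)) / 2"
      unfolding total_flux_def flux_def
      by (simp add: sum_distrib_left sum_distrib_right sum.distrib[symmetric] algebra_simps)
    then show ?thesis by (simp add: P S field_simps)
  qed
  have main: "X i j (bar i) (bar j) = D / 2 * flux lam i j - total_flux lam i - total_flux lam j"
    if "j \<noteq> i" "j \<noteq> bar i" for i j
  proof -
    have "bar j \<noteq> bar i" "bar i \<noteq> bar j" "bar i \<noteq> bar (bar j)" "bar i \<noteq> j" "bar j \<noteq> i"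
      using that by auto
    then have "dl j (bar i) = 0" "dl i (bar j) = 0" "dl i (bar i) = 1" "dl j (bar j) = 1"
      by (simp_all add: dl_def)
    then show ?thesis
      unfolding X V flux_def sectional_def
      using skew'[of i j "bar j" "bar i"]
      by (simp add: lam_bar field_simps)
  qed
  have X_skew: "X j i k l = - X i j k l" for i j k l
    unfolding X by (simp add: skew[of i j] field_simps)
  have X_skew': "X i j l k = - X i j k l" for i j k l
    unfolding X by (simp add: skew'[of i j k l] field_simps)
  have zero: "X i j k l = 0"
    if cond: "\<And>a b. a \<in> ?J \<Longrightarrow> b \<in> ?J \<Longrightarrow> b \<noteq> a \<Longrightarrow> b \<noteq> bar a \<Longrightarrow> X a b (bar a) (bar b) = 0"
      and J: "i \<in> ?J" "j \<in> ?J" "k \<in> ?J" "l \<in> ?J" for i j k l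
  proof -
    have crossed: "X a b (bar a) (bar b) = 0" if ab: "a \<in> ?J" "b \<in> ?J" for a b
    proof -
      \<comment> \<open>For \<open>b = bar a\<close> the eigenvalues cancel in the first term, and the other terms cancel because the contraction with \<open>h\<close> is skew and the Ricci tensor is symmetric.\<close>
      consider "b = a" | "b = bar a" "b \<noteq> a" | "b \<noteq> a" "b \<noteq> bar a" by blast
      then show ?thesis
      proof cases
        case 1
        then show ?thesis using X_skew[of a a "bar a" "bar a"] by simp
      next
        case 2
        then have "dl a a = 0" "dl (bar a) (bar a) = 0" "dl a (bar a) = 1" "dl (bar a) a = 1"
          by (auto simp: dl_def)
        then show ?thesis
          unfolding X 2(1) using P_skew[of "bar a" a] S_sym[of "bar a" a] skew'[of a "bar a" "bar a" a]
          by (simp add: lam_bar)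
      next
        case 3
        then show ?thesis using cond ab by blast
      qed
    qed
    consider "k = bar i" "l = bar j" | "l = bar i" "k = bar j" |
      "\<not> (k = bar i \<and> l = bar j)" "\<not> (l = bar i \<and> k = bar j)" by blast
    then show ?thesis
    proof cases
      case 1
      then show ?thesis using crossed J by simp
    next
      case 2
      then show ?thesis using crossed[OF J(1,2)] X_skew'[of i j "bar j" "bar i"] by simp
    next
      case 3
      have a: "dl i k = 0 \<or> P j l = 0 \<and> S j l = 0" "dl i l = 0 \<or> P j k = 0 \<and> S j k = 0"
        "dl j k = 0 \<or> P i l = 0 \<and> S i l = 0" "dl j l = 0 \<or> P i k = 0 \<and> S i k = 0"
        using 3 J P_zero S_zero by (auto simp: dl_def)
      have b: "lam l * r i j l k - lam k * r i j k l = 0"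
      proof (cases "l = bar k")
        case True
        then show ?thesis using skew'[of i j l k] by (simp add: lam_bar)
      next
        case False
        then have "\<not> paired i j k l" "\<not> paired i j l k"
          using 3 by (auto simp: paired_def)
        then show ?thesis using weight J by simp
      qed
      show ?thesis unfolding X using a b by auto
    qed
  qed
  show ?thesis
    unfolding X_def[symmetric] D_def[symmetric]
  proof (intro iffI ballI impI)
    fix i j assume *: "\<forall>i\<in>?J. \<forall>j\<in>?J. \<forall>k\<in>?J. \<forall>l\<in>?J. X i j k l = 0"
      and "i \<in> ?J" "j \<in> ?J" "j \<noteq> i \<and> j \<noteq> bar i"
    then show "D / 2 * flux lam i j = total_flux lam i + total_flux lam j"
      using main[of j i] by (simp add: algebra_simps)
  next
    fix i j k l assume *: "\<forall>i\<in>?J. \<forall>j\<in>?J. j \<noteq> i \<and> j \<noteq> bar i \<longrightarrow>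
        D / 2 * flux lam i j = total_flux lam i + total_flux lam j"
      and J: "i \<in> ?J" "j \<in> ?J" "k \<in> ?J" "l \<in> ?J"
    show "X i j k l = 0"
    proof (rule zero[OF _ J])
      fix a b assume "a \<in> ?J" "b \<in> ?J" "b \<noteq> a" "b \<noteq> bar a"
      then show "X a b (bar a) (bar b) = 0" using * main[of b a] by (simp add: algebra_simps)
    qed
  qed
qed

lemma flux_odd: "flux lam (bar i) (bar j) = - flux lam i j"
  by (simp add: flux_def lam_bar sec_bar algebra_simps)

text \<open>
  Let \<open>D\<close> be the number of null indices. The equation says that the flux is \<open>\<delta> i + \<delta> j\<close> with
  \<open>\<delta> = 2 / (D - 2) * total_flux\<close>, which is odd because the flux is. Conversely, every odd \<open>\<delta>\<close> is allowed:
  the sum of \<open>\<delta> i + \<delta> j\<close> over the indices \<open>j\<close> other than \<open>i\<close> and \<open>bar i\<close> is \<open>(D - 2) * \<delta> i\<close>, since the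
  \<open>\<delta> j\<close> cancel in conjugate pairs. For \<open>i = Hat0\<close> there are \<open>D - 1\<close> such \<open>j\<close>, but \<open>\<delta> Hat0 = 0\<close>. Thus
  the equations are consistent with the definition of the total flux and leave \<open>\<delta>\<close> free.
\<close>

lemma flux_equation_iff:
  assumes "card (weight_indices n \<epsilon>) > 2"
  shows "(\<forall>i\<in>weight_indices n \<epsilon>. \<forall>j\<in>weight_indices n \<epsilon>. j \<noteq> i \<and> j \<noteq> bar i \<longrightarrow>
      (of_nat (card (weight_indices n \<epsilon>)) - 2) / 2 * flux lam i j =
        total_flux lam i + total_flux lam j) \<longleftrightarrow>
   (\<exists>\<delta>. (\<forall>i. \<delta> (bar i) = - \<delta> i) \<and>
     (\<forall>i\<in>weight_indices n \<epsilon>. \<forall>j\<in>weight_indices n \<epsilon>. j \<noteq> i \<and> j \<noteq> bar i \<longrightarrow>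
        flux lam i j = \<delta> i + \<delta> j))"
    (is "?L \<longleftrightarrow> ?R")
proof
  let ?J = "weight_indices n \<epsilon>"
  define D where "D = (of_nat (card ?J) - 2 :: complex)"
  have D: "D \<noteq> 0"
    using assms unfolding D_def
    by (metis eq_iff_diff_eq_0 nat_neq_iff of_nat_eq_iff of_nat_numeral)
  {
    assume L: ?L
    have odd: "total_flux lam (bar i) = - total_flux lam i" for i
      unfolding total_flux_def
      by (subst sum_bar[symmetric]) (simp add: flux_odd sum_negf)
    show ?R
    proof (intro exI[of _ "\<lambda>i. 2 / D * total_flux lam i"] conjI allI ballI impI)
      fix i j assume ij: "i \<in> ?J" "j \<in> ?J" "j \<noteq> i \<and> j \<noteq> bar i"
      then have "D / 2 * flux lam i j = total_flux lam i + total_flux lam j"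
        using L by (simp add: D_def)
      then show "flux lam i j = 2 / D * total_flux lam i + 2 / D * total_flux lam j"
        using D by (simp add: field_simps)
    qed (simp add: odd)
  }
  {
    assume ?R
    then obtain \<delta> where odd: "\<And>i. \<delta> (bar i) = - \<delta> i"
      and \<delta>: "\<And>i j. i \<in> ?J \<Longrightarrow> j \<in> ?J \<Longrightarrow> j \<noteq> i \<Longrightarrow> j \<noteq> bar i \<Longrightarrow> flux lam i j = \<delta> i + \<delta> j"
      by blast
    \<comment> \<open>Oddness makes the sum over all indices equal to its negative.\<close>
    have "(\<Sum>j\<in>?J. \<delta> (bar j)) = (\<Sum>j\<in>?J. \<delta> j)" by (rule sum_bar)
    then have sum0: "(\<Sum>j\<in>?J. \<delta> j) = 0" by (simp add: odd sum_negf)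
    have \<delta>0: "\<delta> Hat0 = 0" using odd[of Hat0] by simp
    have V: "total_flux lam i = D / 2 * \<delta> i" if i: "i \<in> ?J" for i
    proof -
      have diag: "flux lam i i = 0" "flux lam i (bar i) = 0"
        by (simp_all add: flux_def lam_bar)
      have sub: "{i, bar i} \<subseteq> ?J" using i by simp
      have "(\<Sum>j\<in>?J. flux lam i j) = (\<Sum>j\<in>?J - {i, bar i}. flux lam i j)"
        by (intro sum.mono_neutral_right) (auto simp: diag)
      also have "\<dots> = (\<Sum>j\<in>?J - {i, bar i}. \<delta> i + \<delta> j)"
        using i by (intro sum.cong) (auto simp: \<delta>)
      also have "\<dots> = of_nat (card (?J - {i, bar i})) * \<delta> i + (\<Sum>j\<in>?J - {i, bar i}. \<delta> j)"
        by (simp add: sum.distrib)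
      also have "(\<Sum>j\<in>?J - {i, bar i}. \<delta> j) = (\<Sum>j\<in>?J. \<delta> j) - (\<Sum>j\<in>{i, bar i}. \<delta> j)"
        using sub by (intro sum_diff) auto
      \<comment> \<open>This covers \<open>i = Hat0\<close>, where the set is a singleton.\<close>
      also have "(\<Sum>j\<in>{i, bar i}. \<delta> j) = 0"
        by (cases "i = Hat0") (auto simp: odd \<delta>0)
      also have "of_nat (card (?J - {i, bar i})) * \<delta> i = D * \<delta> i"
      proof (cases "i = Hat0")
        case False
        then have "card {i, bar i} = 2" by simp
        then have "card (?J - {i, bar i}) = card ?J - 2"
          using sub by (simp add: card_Diff_subset)
        then show ?thesis using assms by (simp add: D_def of_nat_diff)
      qed (simp add: \<delta>0)
      finally show ?thesis by (simp add: total_flux_def sum0)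
    qed
    show ?L
      using \<delta> V by (auto simp: D_def[symmetric] algebra_simps)
  }
qed

end

end

section \<open>Contractions\<close>

text \<open>
  Contractions are iterated one slot at a time, so that an identity for one index can be applied
  inside a tensor of any rank.
\<close>

definition pairing :: "('d::finite \<Rightarrow> complex) \<Rightarrow> ('d \<Rightarrow> complex) \<Rightarrow> complex" where
  "pairing t u = (\<Sum>a\<in>UNIV. t a * u a)"

definition contract2 ::
  "('d::finite \<Rightarrow> 'd \<Rightarrow> complex) \<Rightarrow> ('d \<Rightarrow> complex) \<Rightarrow> ('d \<Rightarrow> complex) \<Rightarrow> complex" where
  "contract2 T u v = pairing (\<lambda>a. pairing (\<lambda>b. T a b) v) u"

definition contract4 ::
  "('d::finite \<Rightarrow> 'd \<Rightarrow> 'd \<Rightarrow> 'd \<Rightarrow> complex) \<Rightarrow>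
   ('d \<Rightarrow> complex) \<Rightarrow> ('d \<Rightarrow> complex) \<Rightarrow> ('d \<Rightarrow> complex) \<Rightarrow> ('d \<Rightarrow> complex) \<Rightarrow> complex" where
  "contract4 T u v w z = contract2 (\<lambda>a b. contract2 (\<lambda>c d. T a b c d) w z) u v"

lemma pairing_add: "pairing (\<lambda>a. s a + t a) u = pairing s u + pairing t u"
  by (simp add: pairing_def sum.distrib algebra_simps)

lemma pairing_diff: "pairing (\<lambda>a. s a - t a) u = pairing s u - pairing t u"
  by (simp add: pairing_def sum_subtractf algebra_simps)

lemma pairing_uminus: "pairing (\<lambda>a. - t a) u = - pairing t u"
  by (simp add: pairing_def sum_negf)

lemma pairing_scale: "pairing (\<lambda>a. c * t a) u = c * pairing t u"
  by (simp add: pairing_def sum_distrib_left mult.assoc)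

lemma pairing_scale': "pairing (\<lambda>a. t a * c) u = pairing t u * c"
  by (simp add: pairing_def sum_distrib_left sum_distrib_right ac_simps)

lemma pairing_divide: "pairing (\<lambda>a. t a / c) u = pairing t u / c"
  by (simp add: pairing_def sum_divide_distrib)

lemma pairing_sum: "pairing (\<lambda>a. \<Sum>m\<in>M. t m a) u = (\<Sum>m\<in>M. pairing (t m) u)"
  unfolding pairing_def sum_distrib_right by (rule sum.swap)

lemma pairing_zero: "pairing (\<lambda>a. 0) u = 0"
  by (simp add: pairing_def)

lemma pairing_scale_right: "pairing t (\<lambda>a. c * u a) = c * pairing t u"
  by (simp add: pairing_def sum_distrib_left ac_simps)

lemma pairing_swap:
  "pairing (\<lambda>a. pairing (\<lambda>b. T a b) v) u = pairing (\<lambda>b. pairing (\<lambda>a. T a b) u) v"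
  unfolding pairing_def sum_distrib_right
  by (subst sum.swap) (simp add: ac_simps)

lemma pairing_matrix:
  "pairing (\<lambda>a. \<Sum>p\<in>UNIV. M a p * t p) u = pairing t (\<lambda>p. pairing (\<lambda>a. M a p) u)"
  unfolding pairing_def sum_distrib_left sum_distrib_right
  by (subst sum.swap) (simp add: ac_simps)

lemmas pairing_linear = pairing_add pairing_diff pairing_uminus pairing_scale pairing_scale'
  pairing_divide pairing_sum pairing_zero

lemma contract2_swap: "contract2 (\<lambda>a b. T b a) u v = contract2 T v u"
  unfolding contract2_def by (rule pairing_swap)

lemma contract4_swap12: "contract4 (\<lambda>a b c d. T b a c d) u v w z = contract4 T v u w z"
  unfolding contract4_def by (rule contract2_swap)

lemma contract4_swap34: "contract4 (\<lambda>a b c d. T a b d c) u v w z = contract4 T u v z w"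
proof -
  have "(\<lambda>a b. contract2 (\<lambda>c d. T a b d c) w z) = (\<lambda>a b. contract2 (T a b) z w)"
    by (intro ext contract2_swap)
  then show ?thesis by (simp add: contract4_def)
qed

lemma contract4_swap23: "contract4 (\<lambda>a b c d. T a c b d) u v w z = contract4 T u w v z"
proof -
  have "pairing (\<lambda>b. pairing (\<lambda>c. pairing (\<lambda>d. T a c b d) z) w) v =
      pairing (\<lambda>c. pairing (\<lambda>b. pairing (\<lambda>d. T a c b d) z) v) w" for a
    by (rule pairing_swap)
  then show ?thesis by (simp add: contract4_def contract2_def)
qed

lemma contract2_linear:
  "contract2 (\<lambda>a b. S a b + T a b) u v = contract2 S u v + contract2 T u v"
  "contract2 (\<lambda>a b. S a b - T a b) u v = contract2 S u v - contract2 T u v"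
  "contract2 (\<lambda>a b. - T a b) u v = - contract2 T u v"
  "contract2 (\<lambda>a b. c * T a b) u v = c * contract2 T u v"
  "contract2 (\<lambda>a b. T a b * c) u v = contract2 T u v * c"
  "contract2 (\<lambda>a b. T a b / c) u v = contract2 T u v / c"
  "contract2 (\<lambda>a b. \<Sum>m\<in>M. F m a b) u v = (\<Sum>m\<in>M. contract2 (F m) u v)"
  by (simp_all add: contract2_def pairing_linear)

lemma contract4_linear:
  "contract4 (\<lambda>a b c d. S a b c d + T a b c d) u v w z = contract4 S u v w z + contract4 T u v w z"
  "contract4 (\<lambda>a b c d. S a b c d - T a b c d) u v w z = contract4 S u v w z - contract4 T u v w z"
  "contract4 (\<lambda>a b c d. - T a b c d) u v w z = - contract4 T u v w z"
  "contract4 (\<lambda>a b c d. s * T a b c d) u v w z = s * contract4 T u v w z"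
  "contract4 (\<lambda>a b c d. T a b c d / s) u v w z = contract4 T u v w z / s"
  "contract4 (\<lambda>a b c d. \<Sum>m\<in>M. F m a b c d) u v w z = (\<Sum>m\<in>M. contract4 (F m) u v w z)"
  by (simp_all add: contract4_def contract2_linear)

lemma contract2_prod: "contract2 (\<lambda>a b. s a * t b) u v = pairing s u * pairing t v"
  by (simp add: contract2_def pairing_linear)

lemma contract4_prod12_34:
  "contract4 (\<lambda>a b c d. S a b * T c d) u v w z = contract2 S u v * contract2 T w z"
  by (simp add: contract4_def contract2_linear)

lemma contract4_prod13_24:
  "contract4 (\<lambda>a b c d. S a c * T b d) u v w z = contract2 S u w * contract2 T v z"
  using contract4_swap23[of "\<lambda>a b c d. S a b * T c d" u v w z]
  by (simp add: contract4_prod12_34)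

lemma contract4_prod14_23:
  "contract4 (\<lambda>a b c d. S a d * T b c) u v w z = contract2 S u z * contract2 T v w"
  using contract4_swap34[of "\<lambda>a b c d. S a c * T b d" u v w z]
  by (simp add: contract4_prod13_24)

lemmas contract4_prod = contract4_prod12_34 contract4_prod13_24 contract4_prod14_23

text \<open>
  The completeness relations say that \<open>u\<close> and \<open>v\<close> have dual families, so a tensor is recovered from its
  contractions with them.
\<close>

lemma contract2_eq_0D:
  assumes compl: "\<And>a b. (\<Sum>i\<in>J. \<phi> i a * u i b) = of_bool (a = b)"
      "\<And>a b. (\<Sum>i\<in>J. \<psi> i a * v i b) = of_bool (a = b)"
    and zero: "\<And>i j. i \<in> J \<Longrightarrow> j \<in> J \<Longrightarrow> contract2 T (u i) (v j) = 0"
  shows "T a b = 0"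
proof -
  have one: "t a = 0" if compl: "\<And>a b. (\<Sum>i\<in>J. \<phi> i a * u i b) = of_bool (a = b)"
    and zero: "\<And>i. i \<in> J \<Longrightarrow> pairing t (u i) = 0" for t :: "'a \<Rightarrow> complex" and a \<phi> u
  proof -
    have "t a = (\<Sum>b\<in>UNIV. t b * (\<Sum>i\<in>J. \<phi> i a * u i b))"
      by (simp add: compl of_bool_def if_distrib cong: if_cong)
    also have "\<dots> = (\<Sum>i\<in>J. \<phi> i a * pairing t (u i))"
      unfolding pairing_def sum_distrib_left by (subst sum.swap) (simp add: ac_simps)
    also have "\<dots> = 0" by (simp add: zero)
    finally show ?thesis .
  qed
  have "pairing (\<lambda>b. T a b) (v j) = 0" if "j \<in> J" for j
    by (rule one[OF compl(1), where t = "\<lambda>a. pairing (\<lambda>b. T a b) (v j)"])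
      (use zero[OF _ that] in \<open>simp add: contract2_def\<close>)
  then show ?thesis by (rule one[OF compl(2)])
qed

lemma contract4_eq_0D:
  assumes compl: "\<And>a b. (\<Sum>i\<in>J. \<phi> i a * u i b) = of_bool (a = b)"
      "\<And>a b. (\<Sum>i\<in>J. \<psi> i a * v i b) = of_bool (a = b)"
    and zero: "\<And>i j k l. i \<in> J \<Longrightarrow> j \<in> J \<Longrightarrow> k \<in> J \<Longrightarrow> l \<in> J \<Longrightarrow>
      contract4 T (u i) (u j) (v k) (v l) = 0"
  shows "T a b c d = 0"
proof -
  have "contract2 (\<lambda>c d. T a b c d) (v k) (v l) = 0" if "k \<in> J" "l \<in> J" for k l
    by (rule contract2_eq_0D[OF compl(1) compl(1), where T = "\<lambda>a b. contract2 (\<lambda>c d. T a b c d) (v k) (v l)"])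
      (use zero that in \<open>simp add: contract4_def\<close>)
  then show ?thesis by (rule contract2_eq_0D[OF compl(2) compl(2)])
qed

section \<open>The null frame\<close>

text \<open>
  The eigenvalues of the endomorphism obtained from \<open>h\<close> by raising its first index.
\<close>

definition skew_eigenvalue :: "(nat \<Rightarrow> real) \<Rightarrow> weight_index \<Rightarrow> complex" where
  "skew_eigenvalue X i = (case i of
     Plus \<mu> \<Rightarrow> - \<i> * complex_of_real (X \<mu>) | Minus \<mu> \<Rightarrow> \<i> * complex_of_real (X \<mu>) | Hat0 \<Rightarrow> 0)"

lemma skew_eigenvalue_bar: "skew_eigenvalue X (bar i) = - skew_eigenvalue X i"
  by (cases i) (simp_all add: skew_eigenvalue_def)

lemma card_weight_indices: "\<epsilon> \<in> {0, 1} \<Longrightarrow> card (weight_indices n \<epsilon>) = 2 * n + \<epsilon>"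
  unfolding weight_indices_def
  by (subst card_Un_disjoint card_image; auto simp: inj_on_def)+

lemma riemann_symmetricI:
  assumes skew: "\<And>a b c d. R $ b $ a $ c $ d = - R $ a $ b $ c $ d"
    and pair: "\<And>a b c d. R $ c $ d $ a $ b = R $ a $ b $ c $ d"
    and cyclic: "\<And>a b c d. R $ a $ b $ c $ d + R $ a $ c $ d $ b + R $ a $ d $ b $ c = 0"
  shows "R \<in> riemann_symmetric"
  unfolding riemann_symmetric_def mem_Collect_eq
proof (intro allI conjI)
  fix a b c d
  have skew': "R $ a $ b $ d $ c = - R $ a $ b $ c $ d" for a b c d
  proof -
    have "R $ a $ b $ d $ c = R $ d $ c $ a $ b" by (rule pair)
    also have "\<dots> = - R $ c $ d $ a $ b" by (rule skew)
    also have "R $ c $ d $ a $ b = R $ a $ b $ c $ d" by (rule pair)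
    finally show ?thesis .
  qed
  show "R $ a $ b $ c $ d = asym (\<lambda>a b. asym (\<lambda>c d. R $ a $ b $ c $ d) c d) a b"
    using skew[of b a c d] skew[of b a d c] skew'[of a b d c] by (simp add: asym_def)
  show "R $ a $ b $ c $ d = R $ c $ d $ a $ b" by (rule pair)
  show "asym3 (\<lambda>b c d. R $ a $ b $ c $ d) b c d = 0"
    using cyclic[of a b c d] skew'[of a b d c] skew'[of a c b d] skew'[of a d c b]
    by (simp add: asym3_def)
qed

lemma riemann_symmetricD:
  assumes "R \<in> riemann_symmetric"
  shows "R $ b $ a $ c $ d = - R $ a $ b $ c $ d"
    and "R $ c $ d $ a $ b = R $ a $ b $ c $ d"
    and "R $ a $ b $ c $ d + R $ a $ c $ d $ b + R $ a $ d $ b $ c = 0"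
proof -
  have skew: "R $ a $ b $ c $ d = asym (\<lambda>a b. asym (\<lambda>c d. R $ a $ b $ c $ d) c d) a b"
    and pair: "R $ a $ b $ c $ d = R $ c $ d $ a $ b"
    and cyc: "asym3 (\<lambda>b c d. R $ a $ b $ c $ d) b c d = 0" for a b c d
    using assms unfolding riemann_symmetric_def by blast+
  have s: "R $ b $ a $ c $ d = - R $ a $ b $ c $ d" for a b c d
  proof -
    have flip: "asym X b a = - asym X a b" for X :: "'a \<Rightarrow> 'a \<Rightarrow> real"
      by (simp add: asym_def field_simps)
    show ?thesis
      unfolding skew[of a b c d] skew[of b a c d] by (rule flip)
  qed
  have s': "R $ a $ b $ d $ c = - R $ a $ b $ c $ d" for a b c d
    using pair[of a b d c] s[of d c a b] pair[of a b c d] by linarith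
  have b: "R $ a $ b $ c $ d + R $ a $ c $ d $ b + R $ a $ d $ b $ c = 0" for a b c d
  proof -
    have arith: "(u - u' + v - v' + w - w') / 6 = 0 \<Longrightarrow> u' = - u \<Longrightarrow> v' = - v \<Longrightarrow> w' = - w \<Longrightarrow>
      u + v + w = 0" for u u' v v' w w' :: real by simp
    show ?thesis by (rule arith[OF cyc[unfolded asym3_def] s' s' s'])
  qed
  show "R $ b $ a $ c $ d = - R $ a $ b $ c $ d" by (rule s)
  show "R $ c $ d $ a $ b = R $ a $ b $ c $ d" by (rule pair)
  show "R $ a $ b $ c $ d + R $ a $ c $ d $ b + R $ a $ d $ b $ c = 0" by (rule b)
qed

text \<open>
  The algebraic data at one point: an orthonormal coframe for a symmetric invertible bilinear form.
\<close>

locale point_coframe =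
  fixes G :: "real^'d^'d::finite" and n \<epsilon> :: nat and E Eh :: "nat \<Rightarrow> real^'d"
  assumes eps: "\<epsilon> \<in> {0, 1}"
    and dimension: "CARD('d) = 2 * n + \<epsilon>"
    and G_sym: "transpose G = G"
    and G_inv: "invertible G"
    and orthonormal: "orthonormal_coframe G n \<epsilon> E Eh"
begin

abbreviation "J \<equiv> weight_indices n \<epsilon>"

definition Gi :: "'d \<Rightarrow> 'd \<Rightarrow> complex" where
  "Gi a b = complex_of_real (matrix_inv G $ a $ b)"

definition coframe :: "weight_index \<Rightarrow> 'd \<Rightarrow> complex" where
  "coframe i a = weight_covector E Eh i $ a"

text \<open>
  The null frame dual to the null coframe. Because the conjugate of a null covector is its only
  partner of nonzero product, the dual vector is the raised conjugate covector, normalized.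
\<close>

definition frame :: "weight_index \<Rightarrow> 'd \<Rightarrow> complex" where
  "frame i a = (\<Sum>b\<in>UNIV. Gi a b * coframe (bar i) b) / frame_scale i"

lemma card_J: "card J = CARD('d)"
  using card_weight_indices[OF eps] dimension by simp

lemma G_inverse: "G ** matrix_inv G = mat 1" "matrix_inv G ** G = mat 1"
  using someI_ex[OF G_inv[unfolded invertible_def]] by (simp_all add: matrix_inv_def)

lemma Gi_sym: "Gi b a = Gi a b"
proof -
  have "G ** transpose (matrix_inv G) = transpose (matrix_inv G ** G)"
    by (simp add: matrix_transpose_mul G_sym)
  then have "G ** transpose (matrix_inv G) = mat 1" by (simp add: G_inverse)
  then have "matrix_inv G ** (G ** transpose (matrix_inv G)) = matrix_inv G" by simp
  then have "transpose (matrix_inv G) = matrix_inv G"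
    by (simp add: matrix_mul_assoc G_inverse)
  then have "transpose (matrix_inv G) $ a $ b = matrix_inv G $ a $ b" by simp
  then show ?thesis by (simp add: Gi_def transpose_def)
qed

lemma G_Gi: "(\<Sum>b\<in>UNIV. complex_of_real (G $ a $ b) * Gi b c) = of_bool (a = c)"
proof -
  have "(G ** matrix_inv G) $ a $ c = of_bool (a = c)"
    by (simp add: G_inverse mat_def)
  then have "complex_of_real ((G ** matrix_inv G) $ a $ c) = of_bool (a = c)" by simp
  then show ?thesis by (simp add: matrix_matrix_mult_def Gi_def)
qed

lemma complex_cometric:
  fixes s s' :: complex
  shows "(\<Sum>a\<in>UNIV. \<Sum>b\<in>UNIV. (complex_of_real (p $ a) + s * complex_of_real (q $ a)) * Gi a b *
       (complex_of_real (p' $ b) + s' * complex_of_real (q' $ b))) =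
   cometric G p p' + s' * cometric G p q' + s * cometric G q p' + s * s' * cometric G q q'"
proof -
  have c: "complex_of_real (cometric G p q) =
      (\<Sum>a\<in>UNIV. \<Sum>b\<in>UNIV. complex_of_real (p $ a) * Gi a b * complex_of_real (q $ b))" for p q
    by (simp add: cometric_def inner_vec_def matrix_vector_mult_def Gi_def sum_distrib_left ac_simps)
  show ?thesis
    unfolding c by (simp add: algebra_simps sum.distrib sum_distrib_left)
qed

lemma coframe_product:
  assumes "i \<in> J" "j \<in> J"
  shows "(\<Sum>a\<in>UNIV. \<Sum>b\<in>UNIV. coframe i a * Gi a b * coframe j b) =
    (if j = bar i then frame_scale i else 0)"
proof -
  have EE: "cometric G (E \<mu>) (E \<nu>) = of_bool (\<mu> = \<nu>)" if "\<mu> \<in> {1..n}" "\<nu> \<in> {1..n}" for \<mu> \<nu>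
    using orthonormal that by (simp add: orthonormal_coframe_def)
  have HH: "cometric G (Eh \<mu>) (Eh \<nu>) = of_bool (\<mu> = \<nu>)"
    if "\<mu> \<in> hat_indices n \<epsilon>" "\<nu> \<in> hat_indices n \<epsilon>" for \<mu> \<nu>
    using orthonormal that by (simp add: orthonormal_coframe_def)
  have EH: "cometric G (E \<mu>) (Eh \<nu>) = 0" if "\<mu> \<in> {1..n}" "\<nu> \<in> hat_indices n \<epsilon>" for \<mu> \<nu>
    using orthonormal that by (simp add: orthonormal_coframe_def)
  have sym: "cometric G p q = cometric G q p" for p q
  proof -
    have "transpose (matrix_inv G) = matrix_inv G"
      using Gi_sym by (simp add: Gi_def transpose_def vec_eq_iff)
    then have "p v* matrix_inv G = matrix_inv G *v p"
      using transpose_matrix_vector[of "matrix_inv G" p] by simp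
    then show ?thesis
      using dot_lmul_matrix[of p "matrix_inv G" q] by (simp add: cometric_def inner_commute)
  qed
  have HE: "cometric G (Eh \<nu>) (E \<mu>) = 0" if "\<mu> \<in> {1..n}" "\<nu> \<in> hat_indices n \<epsilon>" for \<mu> \<nu>
    using EH[OF that] sym by simp
  define re where "re i = (case i of Plus \<mu> \<Rightarrow> E \<mu> | Minus \<mu> \<Rightarrow> E \<mu> | Hat0 \<Rightarrow> Eh 0)" for i
  define im where "im i = (case i of Plus \<mu> \<Rightarrow> Eh \<mu> | Minus \<mu> \<Rightarrow> Eh \<mu> | Hat0 \<Rightarrow> 0)" for i
  define s where "s i = (case i of Plus \<mu> \<Rightarrow> \<i> | Minus \<mu> \<Rightarrow> - \<i> | Hat0 \<Rightarrow> 0)" for i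
  have cof: "coframe i a = complex_of_real (re i $ a) + s i * complex_of_real (im i $ a)" for i a
    by (cases i) (simp_all add: coframe_def re_def im_def s_def)
  have hat: "\<mu> \<in> {1..n} \<Longrightarrow> \<mu> \<in> hat_indices n \<epsilon>" for \<mu> by (simp add: hat_indices_def)
  have range: "Plus \<mu> \<in> J \<Longrightarrow> \<mu> \<in> {1..n}" "Minus \<mu> \<in> J \<Longrightarrow> \<mu> \<in> {1..n}"
    "Hat0 \<in> J \<Longrightarrow> 0 \<in> hat_indices n \<epsilon>" "Plus \<mu> \<in> J \<Longrightarrow> 0 < \<mu>" "Minus \<mu> \<in> J \<Longrightarrow> 0 < \<mu>" for \<mu>
    by (auto simp: weight_indices_def hat_indices_def split: if_splits)
  show ?thesis
    unfolding cof complex_cometric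
    using range(1,2)[THEN hat] range assms
    by (cases i; cases j)
      (auto simp: re_def im_def s_def frame_scale_def EE HH EH HE hat)
qed

lemma dual:
  assumes "i \<in> J" "j \<in> J"
  shows "pairing (coframe i) (frame j) = of_bool (i = j)"
proof -
  have "pairing (coframe i) (frame j) =
      (\<Sum>a\<in>UNIV. \<Sum>b\<in>UNIV. coframe i a * Gi a b * coframe (bar j) b) / frame_scale j"
    by (simp add: pairing_def frame_def sum_divide_distrib sum_distrib_left mult.assoc)
  then show ?thesis using assms by (simp add: coframe_product)
qed

text \<open>
  The null covectors are as many as the dimension, so the left inverse given by duality is also a
  right inverse.
\<close>

lemma complete: "(\<Sum>i\<in>J. frame i a * coframe i b) = of_bool (a = b)"
proof -
  \<comment> \<open>Frame indices are renamed to coordinate indices so that square matrices can be used.\<close>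
  obtain \<beta> :: "'d \<Rightarrow> weight_index" where \<beta>: "bij_betw \<beta> UNIV J"
    using finite_same_card_bij[of "UNIV :: 'd set" J] card_J by auto
  then have \<beta>J: "\<beta> k \<in> J" for k by (auto simp: bij_betw_def)
  have inj: "\<beta> k = \<beta> l \<longleftrightarrow> k = l" for k l
    using \<beta> by (auto simp: bij_betw_def inj_on_def)
  define M where "M = (\<chi> k a. coframe (\<beta> k) a)"
  define N where "N = (\<chi> a k. frame (\<beta> k) a)"
  have "M ** N = mat 1"
    using dual[OF \<beta>J \<beta>J]
    by (simp add: vec_eq_iff matrix_matrix_mult_def M_def N_def mat_def pairing_def inj)
  then have "N ** M = mat 1" by (simp add: matrix_left_right_inverse)
  then have "(N ** M) $ a $ b = of_bool (a = b)" by (simp add: mat_def)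
  then have "(\<Sum>k\<in>UNIV. frame (\<beta> k) a * coframe (\<beta> k) b) = of_bool (a = b)"
    by (simp add: matrix_matrix_mult_def M_def N_def)
  then show ?thesis
    by (simp add: sum.reindex_bij_betw[OF \<beta>, where g = "\<lambda>i. frame i a * coframe i b"])
qed

lemma complete': "(\<Sum>i\<in>J. coframe i a * frame i b) = of_bool (a = b)"
  using complete[of b a] by (auto simp: mult.commute of_bool_def)

lemma raise: "pairing (\<lambda>a. Gi a p) (coframe i) = frame_scale i * frame (bar i) p"
  by (simp add: frame_def pairing_def Gi_sym[of p])

lemma Gi_expansion: "Gi a p = (\<Sum>m\<in>J. frame_scale m * frame m a * frame (bar m) p)"
proof -
  have "Gi a p = (\<Sum>b\<in>UNIV. of_bool (a = b) * Gi b p)" by simp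
  also have "\<dots> = (\<Sum>m\<in>J. frame m a * pairing (\<lambda>b. Gi b p) (coframe m))"
    unfolding complete[symmetric] pairing_def sum_distrib_left sum_distrib_right
    by (subst sum.swap) (simp add: ac_simps)
  finally show ?thesis by (simp add: raise ac_simps)
qed

lemma metric_component:
  assumes "i \<in> J" "j \<in> J"
  shows "contract2 (\<lambda>a b. complex_of_real (G $ a $ b)) (frame i) (frame j) =
    (if j = bar i then 1 / frame_scale i else 0)"
proof -
  have "pairing (\<lambda>b. complex_of_real (G $ a $ b)) (frame j) = coframe (bar j) a / frame_scale j" for a
  proof -
    have "pairing (\<lambda>b. complex_of_real (G $ a $ b)) (frame j) =
        (\<Sum>c\<in>UNIV. (\<Sum>b\<in>UNIV. complex_of_real (G $ a $ b) * Gi b c) * coframe (bar j) c) / frame_scale j"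
      unfolding pairing_def frame_def sum_distrib_left sum_distrib_right sum_divide_distrib
        times_divide_eq_right
      by (subst sum.swap) (simp add: ac_simps)
    then show ?thesis by (simp add: G_Gi)
  qed
  then show ?thesis
    using assms dual[of "bar j" i] by (auto simp: contract2_def pairing_divide)
qed

text \<open>
  Complex conjugation of the frame is conjugation of the index. This makes the sectional components
  real below.
\<close>

lemma cnj_frame: "cnj (frame i a) = frame (bar i) a"
proof -
  have "cnj (coframe i b) = coframe (bar i) b" for i b
    by (cases i) (simp_all add: coframe_def)
  then show ?thesis by (simp add: frame_def frame_scale_def Gi_def)
qed

lemma pairing_E:
  assumes "\<mu> \<in> {1..n}" "i \<in> J"
  shows "pairing (\<lambda>a. complex_of_real (E \<mu> $ a)) (frame i) = (if i = Plus \<mu> \<or> i = Minus \<mu> then 1 / 2 else 0)"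
proof -
  have "(\<lambda>a. complex_of_real (E \<mu> $ a)) = (\<lambda>a. (coframe (Plus \<mu>) a + coframe (Minus \<mu>) a) / 2)"
    by (simp add: coframe_def)
  moreover have "Plus \<mu> \<in> J" "Minus \<mu> \<in> J" using assms by (auto simp: weight_indices_def)
  ultimately show ?thesis using assms by (simp only: pairing_linear dual) auto
qed

lemma pairing_Eh:
  assumes "\<mu> \<in> {1..n}" "i \<in> J"
  shows "pairing (\<lambda>a. complex_of_real (Eh \<mu> $ a)) (frame i) =
    (if i = Plus \<mu> then - \<i> / 2 else if i = Minus \<mu> then \<i> / 2 else 0)"
proof -
  have "(\<lambda>a. complex_of_real (Eh \<mu> $ a)) =
      (\<lambda>a. - \<i> * (coframe (Plus \<mu>) a - coframe (Minus \<mu>) a) / 2)"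
    by (simp add: coframe_def algebra_simps)
  moreover have "Plus \<mu> \<in> J" "Minus \<mu> \<in> J" using assms by (auto simp: weight_indices_def)
  ultimately show ?thesis using assms by (simp only: pairing_linear dual) auto
qed

definition component :: "real^'d^'d^'d^'d \<Rightarrow> weight_index \<Rightarrow> weight_index \<Rightarrow> weight_index \<Rightarrow> weight_index \<Rightarrow> complex" where
  "component R i j k l =
     contract4 (\<lambda>a b c d. complex_of_real (R $ a $ b $ c $ d)) (frame i) (frame j) (frame k) (frame l)"

lemma component_linear:
  "component (R + S) i j k l = component R i j k l + component S i j k l"
  "component (R - S) i j k l = component R i j k l - component S i j k l"
  "component (s *\<^sub>R R) i j k l = s * component R i j k l"
  "component 0 i j k l = 0"
  by (simp_all add: component_def contract4_linear)
    (simp add: contract4_def contract2_def pairing_zero)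

lemma component_sum: "component (\<Sum>m\<in>M. F m) i j k l = (\<Sum>m\<in>M. component (F m) i j k l)"
  by (induction M rule: infinite_finite_induct) (simp_all add: component_linear)

lemma component_eqI:
  assumes "\<And>i j k l. \<lbrakk>i \<in> J; j \<in> J; k \<in> J; l \<in> J\<rbrakk> \<Longrightarrow> component R i j k l = component S i j k l"
  shows "R = S"
proof -
  have "complex_of_real ((R - S) $ a $ b $ c $ d) = 0" for a b c d
    by (rule contract4_eq_0D[OF complete' complete',
          where T = "\<lambda>a b c d. complex_of_real ((R - S) $ a $ b $ c $ d)"])
      (fold component_def, use assms in \<open>simp add: component_linear\<close>)
  then show ?thesis by (simp add: vec_eq_iff)
qed

lemma cnj_component: "cnj (component R i j k l) = component R (bar i) (bar j) (bar k) (bar l)"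
  unfolding component_def contract4_def contract2_def pairing_def
  by (simp add: cnj_frame)

lemma riemann_symmetric_component:
  assumes "R \<in> riemann_symmetric"
  shows "component R j i k l = - component R i j k l"
    and "component R k l i j = component R i j k l"
    and "component R i j k l + component R i k l j + component R i l j k = 0"
proof -
  note s = riemann_symmetricD(1)[OF assms]
    and pair = riemann_symmetricD(2)[OF assms, symmetric]
    and b = riemann_symmetricD(3)[OF assms]
  let ?R = "\<lambda>a b c d. complex_of_real (R $ a $ b $ c $ d)"
  have "component R j i k l = contract4 (\<lambda>a b c d. ?R b a c d) (frame i) (frame j) (frame k) (frame l)"
    unfolding component_def by (simp add: contract4_swap12[of ?R])
  also have "(\<lambda>a b c d. ?R b a c d) = (\<lambda>a b c d. - ?R a b c d)"
    by (intro ext, subst s) simp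
  finally show "component R j i k l = - component R i j k l" by (simp add: contract4_linear component_def)
  have "component R k l i j = contract4 (\<lambda>a b c d. ?R c d a b) (frame i) (frame j) (frame k) (frame l)"
    using contract4_swap23[of "\<lambda>a b c d. ?R b d a c" "frame i" "frame j" "frame k" "frame l"]
      contract4_swap12[of "\<lambda>a b c d. ?R a d b c" "frame i" "frame k" "frame j" "frame l"]
      contract4_swap34[of "\<lambda>a b c d. ?R a c b d" "frame k" "frame i" "frame j" "frame l"]
      contract4_swap23[of ?R "frame k" "frame i" "frame l" "frame j"]
    by (simp add: component_def)
  then show "component R k l i j = component R i j k l"
    unfolding component_def by (simp add: pair[symmetric])
  have "component R i k l j = contract4 (\<lambda>a b c d. ?R a c d b) (frame i) (frame j) (frame k) (frame l)"
    using contract4_swap23[of "\<lambda>a b c d. ?R a b d c" "frame i" "frame j" "frame k" "frame l"]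
      contract4_swap34[of ?R "frame i" "frame k" "frame j" "frame l"]
    by (simp add: component_def)
  moreover have "component R i l j k = contract4 (\<lambda>a b c d. ?R a d b c) (frame i) (frame j) (frame k) (frame l)"
    using contract4_swap34[of "\<lambda>a b c d. ?R a c b d" "frame i" "frame j" "frame k" "frame l"]
      contract4_swap23[of ?R "frame i" "frame j" "frame l" "frame k"]
    by (simp add: component_def)
  ultimately have "component R i j k l + component R i k l j + component R i l j k =
    contract4 (\<lambda>a b c d. ?R a b c d + ?R a c d b + ?R a d b c) (frame i) (frame j) (frame k) (frame l)"
    unfolding contract4_linear component_def by simp
  also have "(\<lambda>a b c d. ?R a b c d + ?R a c d b + ?R a d b c) = (\<lambda>a b c d. 0)"
    by (intro ext) (simp add: b flip: of_real_add)
  also have "contract4 (\<lambda>a b c d. 0) (frame i) (frame j) (frame k) (frame l) = 0"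
    by (simp add: contract4_def contract2_def pairing_zero)
  finally show "component R i j k l + component R i k l j + component R i l j k = 0" .
qed

lemma contract4_monomials:
  assumes "i \<in> J" "j \<in> J" "k \<in> J" "l \<in> J"
  shows "contract4 (\<lambda>a b c d. \<Sum>m\<in>zero_weight_monomials n \<epsilon>. \<kappa> m *
        weight_covector E Eh (m!0) $ a * weight_covector E Eh (m!1) $ b *
        weight_covector E Eh (m!2) $ c * weight_covector E Eh (m!3) $ d)
      (frame i) (frame j) (frame k) (frame l) = (if paired i j k l then \<kappa> [i, j, k, l] else 0)"
proof -
  let ?Z = "zero_weight_monomials n \<epsilon>"
  let ?f = "\<lambda>m. contract4 (\<lambda>a b c d. \<kappa> m *
        weight_covector E Eh (m!0) $ a * weight_covector E Eh (m!1) $ b *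
        weight_covector E Eh (m!2) $ c * weight_covector E Eh (m!3) $ d)
      (frame i) (frame j) (frame k) (frame l)"
  have fin: "finite ?Z"
    by (rule finite_subset[OF _ finite_lists_length_eq[of J 4]])
      (auto simp: zero_weight_monomials_def)
  have f: "?f m = (if m = [i, j, k, l] then \<kappa> m else 0)" if m: "m \<in> ?Z" for m
  proof -
    obtain p q s t where "m = [p, q, s, t]" "{p, q, s, t} \<subseteq> J"
      using m unfolding zero_weight_monomials_paired by blast
    then show ?thesis
      using dual assms
      unfolding contract4_def contract2_def
      by (simp add: pairing_linear coframe_def[symmetric] mult.assoc numeral_2_eq_2 numeral_3_eq_3)
  qed
  have mem: "[i, j, k, l] \<in> ?Z \<longleftrightarrow> paired i j k l"
    using assms by (simp add: zero_weight_monomials_paired)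
  have "(\<Sum>m\<in>?Z. ?f m) = (\<Sum>m\<in>?Z. if m = [i, j, k, l] then \<kappa> m else 0)"
    by (intro sum.cong f refl)
  also have "\<dots> = (if paired i j k l then \<kappa> [i, j, k, l] else 0)"
    using fin mem by simp
  finally show ?thesis by (simp add: contract4_linear)
qed

text \<open>
  By duality a linear combination of zero weight monomials has its coefficients as null components,
  and by completeness every tensor is the combination of monomials with its null components as
  coefficients.
\<close>

lemma zero_weight_iff:
  "R \<in> zero_weight n \<epsilon> E Eh \<longleftrightarrow>
     (\<forall>i\<in>J. \<forall>j\<in>J. \<forall>k\<in>J. \<forall>l\<in>J. \<not> paired i j k l \<longrightarrow> component R i j k l = 0)"
proof
  assume "R \<in> zero_weight n \<epsilon> E Eh"
  then obtain \<kappa> :: "weight_index list \<Rightarrow> complex" where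
    \<kappa>: "\<And>a b c d. complex_of_real (R $ a $ b $ c $ d) = (\<Sum>m\<in>zero_weight_monomials n \<epsilon>. \<kappa> m *
        weight_covector E Eh (m!0) $ a * weight_covector E Eh (m!1) $ b *
        weight_covector E Eh (m!2) $ c * weight_covector E Eh (m!3) $ d)"
    unfolding zero_weight_def by blast
  show "\<forall>i\<in>J. \<forall>j\<in>J. \<forall>k\<in>J. \<forall>l\<in>J. \<not> paired i j k l \<longrightarrow> component R i j k l = 0"
    unfolding component_def \<kappa> by (intro ballI impI) (simp only: contract4_monomials if_False)
next
  assume zero: "\<forall>i\<in>J. \<forall>j\<in>J. \<forall>k\<in>J. \<forall>l\<in>J. \<not> paired i j k l \<longrightarrow> component R i j k l = 0"
  \<comment> \<open>Only the paired components enter here; the others vanish by assumption.\<close>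
  define \<kappa> where "\<kappa> m = component R (m!0) (m!1) (m!2) (m!3)" for m
  let ?S = "\<lambda>a b c d. \<Sum>m\<in>zero_weight_monomials n \<epsilon>. \<kappa> m *
        weight_covector E Eh (m!0) $ a * weight_covector E Eh (m!1) $ b *
        weight_covector E Eh (m!2) $ c * weight_covector E Eh (m!3) $ d"
  have "complex_of_real (R $ a $ b $ c $ d) - ?S a b c d = 0" for a b c d
  proof (rule contract4_eq_0D[OF complete' complete',
        where T = "\<lambda>a b c d. complex_of_real (R $ a $ b $ c $ d) - ?S a b c d"])
    fix i j k l assume J: "i \<in> J" "j \<in> J" "k \<in> J" "l \<in> J"
    show "contract4 (\<lambda>a b c d. complex_of_real (R $ a $ b $ c $ d) - ?S a b c d)
        (frame i) (frame j) (frame k) (frame l) = 0"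
      using zero J
      by (simp only: contract4_linear(2) contract4_monomials[OF J] component_def[symmetric])
        (simp add: \<kappa>_def numeral_2_eq_2 numeral_3_eq_3)
  qed
  then show "R \<in> zero_weight n \<epsilon> E Eh"
    unfolding zero_weight_def by (auto simp: exI[of _ \<kappa>])
qed

end

section \<open>The integrability condition in the null frame\<close>

text \<open>
  The conformal Killing-Yano form at a point, which is skew-diagonal in the orthonormal coframe.
\<close>

definition skew_form :: "nat \<Rightarrow> (nat \<Rightarrow> real) \<Rightarrow> (nat \<Rightarrow> real^'d) \<Rightarrow> (nat \<Rightarrow> real^'d) \<Rightarrow> real^'d^'d::finite" where
  "skew_form n X E Eh = (\<Sum>\<mu>\<in>{1..n}. X \<mu> *\<^sub>R wedge (E \<mu>) (Eh \<mu>))"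

lemma sum_rotate:
  "(\<Sum>p\<in>A. \<Sum>c\<in>B. \<Sum>m\<in>C. f p c m) = (\<Sum>m\<in>C. \<Sum>p\<in>A. \<Sum>c\<in>B. f p c m)"
proof -
  have "(\<Sum>p\<in>A. \<Sum>c\<in>B. \<Sum>m\<in>C. f p c m) = (\<Sum>p\<in>A. \<Sum>m\<in>C. \<Sum>c\<in>B. f p c m)"
    by (intro sum.cong refl sum.swap)
  also have "\<dots> = (\<Sum>m\<in>C. \<Sum>p\<in>A. \<Sum>c\<in>B. f p c m)" by (rule sum.swap)
  finally show ?thesis .
qed

lemma contract2_of_partial_trace:
  "contract2 (\<lambda>a b. pairing (\<lambda>p. pairing (\<lambda>c. T p a c b) w) u) v z = contract4 T u v w z"
proof -
  have "pairing (\<lambda>b. pairing (\<lambda>p. pairing (\<lambda>c. T p a c b) w) u) z =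
      pairing (\<lambda>p. pairing (\<lambda>c. pairing (\<lambda>b. T p a c b) z) w) u" for a
  proof -
    have "pairing (\<lambda>b. pairing (\<lambda>p. pairing (\<lambda>c. T p a c b) w) u) z =
        pairing (\<lambda>p. pairing (\<lambda>b. pairing (\<lambda>c. T p a c b) w) z) u"
      by (rule pairing_swap)
    moreover have "pairing (\<lambda>b. pairing (\<lambda>c. T p a c b) w) z =
        pairing (\<lambda>c. pairing (\<lambda>b. T p a c b) z) w" for p
      by (rule pairing_swap)
    ultimately show ?thesis by simp
  qed
  then have "contract2 (\<lambda>a b. pairing (\<lambda>p. pairing (\<lambda>c. T p a c b) w) u) v z =
      pairing (\<lambda>a. pairing (\<lambda>p. pairing (\<lambda>c. pairing (\<lambda>b. T p a c b) z) w) u) v"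
    by (simp add: contract2_def)
  also have "\<dots> = pairing (\<lambda>p. pairing (\<lambda>a. pairing (\<lambda>c. pairing (\<lambda>b. T p a c b) z) w) v) u"
    by (rule pairing_swap)
  finally show ?thesis by (simp add: contract4_def contract2_def)
qed

context point_coframe
begin

lemma contract2_raise:
  "contract2 (\<lambda>a b. \<Sum>p\<in>UNIV. Gi a p * T p b) (coframe i) v =
     frame_scale i * contract2 T (frame (bar i)) v"
proof -
  have "pairing (\<lambda>b. \<Sum>p\<in>UNIV. Gi a p * T p b) v = (\<Sum>p\<in>UNIV. Gi a p * pairing (T p) v)" for a
    by (simp add: pairing_linear)
  then show ?thesis
    by (simp add: contract2_def pairing_matrix raise pairing_scale_right)
qed

lemma contract2_raise':
  "contract2 (\<lambda>a b. \<Sum>p\<in>UNIV. Gi b p * T a p) u (coframe j) =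
     frame_scale j * contract2 T u (frame (bar j))"
  by (simp add: contract2_def pairing_matrix raise pairing_scale_right pairing_scale)

lemma contract2_Kronecker:
  assumes "i \<in> J" "k \<in> J"
  shows "contract2 (\<lambda>a c. complex_of_real (delta a c)) (coframe i) (frame k) = of_bool (i = k)"
proof -
  have "pairing (\<lambda>c. complex_of_real (delta a c)) (frame k) = frame k a" for a
    by (simp add: pairing_def delta_def if_distrib if_distribR cong: if_cong)
  then have "contract2 (\<lambda>a c. complex_of_real (delta a c)) (coframe i) (frame k) = pairing (coframe i) (frame k)"
    by (simp add: contract2_def pairing_def mult.commute)
  then show ?thesis using assms by (simp add: dual)
qed

context
  fixes X :: "nat \<Rightarrow> real" and h :: "real^'d^'d" and lam :: "weight_index \<Rightarrow> complex"
  defines "h \<equiv> skew_form n X E Eh" and "lam \<equiv> skew_eigenvalue X"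
begin

lemma h_nth: "h $ a $ b = (\<Sum>\<mu>\<in>{1..n}. X \<mu> * (E \<mu> $ a * Eh \<mu> $ b - Eh \<mu> $ a * E \<mu> $ b))"
  by (simp add: h_def skew_form_def wedge_def)

lemma h_skew: "h $ b $ a = - h $ a $ b"
  unfolding h_nth sum_negf[symmetric] by (intro sum.cong refl) (simp add: algebra_simps)

text \<open>
  The null frame consists of eigenvectors of \<open>h\<close>; with the index raised this becomes
  \<open>form_frame\<close>.
\<close>

lemma h_frame:
  assumes "l \<in> J"
  shows "pairing (\<lambda>b. complex_of_real (h $ a $ b)) (frame l) =
    lam l / frame_scale l * coframe (bar l) a"
proof -
  have "pairing (\<lambda>b. complex_of_real (h $ a $ b)) (frame l) =
    (\<Sum>\<mu>\<in>{1..n}. X \<mu> * (E \<mu> $ a * pairing (\<lambda>b. complex_of_real (Eh \<mu> $ b)) (frame l) -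
        Eh \<mu> $ a * pairing (\<lambda>b. complex_of_real (E \<mu> $ b)) (frame l)))"
    by (simp add: h_nth pairing_linear)
  also have "\<dots> = (\<Sum>\<mu>\<in>{1..n}. if l = Plus \<mu> \<or> l = Minus \<mu> then lam l / 2 * coframe (bar l) a else 0)"
    using assms
    by (intro sum.cong refl)
      (auto simp: pairing_E pairing_Eh lam_def skew_eigenvalue_def coframe_def field_simps)
  also have "\<dots> = lam l / frame_scale l * coframe (bar l) a"
    using assms
    by (cases l) (auto simp: frame_scale_def weight_indices_def lam_def skew_eigenvalue_def split: if_splits)
  finally show ?thesis .
qed

lemma form_frame:
  assumes "l \<in> J"
  shows "pairing (\<lambda>d. complex_of_real (form_up G h e d)) (frame l) = lam l * frame l e"
proof -
  have "(\<lambda>d. complex_of_real (form_up G h e d)) = (\<lambda>d. \<Sum>p\<in>UNIV. Gi e p * complex_of_real (h $ p $ d))"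
    by (simp add: form_up_def Gi_def)
  then have "pairing (\<lambda>d. complex_of_real (form_up G h e d)) (frame l) =
      (\<Sum>p\<in>UNIV. Gi e p * (lam l / frame_scale l * coframe (bar l) p))"
    using assms by (simp add: pairing_linear h_frame)
  also have "\<dots> = lam l * frame l e"
    unfolding frame_def by (simp add: sum_distrib_left sum_divide_distrib ac_simps)
  finally show ?thesis .
qed

lemma contract2_form:
  assumes "l \<in> J"
  shows "contract2 (\<lambda>c d. \<Sum>e\<in>UNIV. T c e * complex_of_real (form_up G h e d)) w (frame l) =
    lam l * contract2 T w (frame l)"
proof -
  have "pairing (\<lambda>d. \<Sum>e\<in>UNIV. T c e * complex_of_real (form_up G h e d)) (frame l) =
      lam l * pairing (T c) (frame l)" for c
    using assms by (simp add: pairing_linear form_frame) (simp add: pairing_def sum_distrib_left ac_simps)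
  then show ?thesis by (simp add: contract2_def pairing_linear)
qed

text \<open>
  The contravariant form of \<open>h\<close> in the null frame, which turns the contraction of the curvature with
  \<open>h\<close> into a weighted sum over conjugate pairs.
\<close>

lemma h_raised:
  "(\<Sum>e\<in>UNIV. \<Sum>f\<in>UNIV. Gi e q * Gi f s * complex_of_real (h $ e $ f)) =
     (\<Sum>m\<in>J. frame_scale m * lam m * frame m q * frame (bar m) s)"
proof -
  have inner: "(\<Sum>e\<in>UNIV. \<Sum>f\<in>UNIV. frame m e * Gi f s * complex_of_real (h $ e $ f)) =
      - lam m * frame m s" if "m \<in> J" for m
  proof -
    have "(\<Sum>e\<in>UNIV. \<Sum>f\<in>UNIV. frame m e * Gi f s * complex_of_real (h $ e $ f)) =
        - (\<Sum>f\<in>UNIV. Gi f s * pairing (\<lambda>e. complex_of_real (h $ f $ e)) (frame m))"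
      unfolding pairing_def sum_distrib_left sum_negf[symmetric]
      by (subst sum.swap, intro sum.cong refl, subst h_skew) simp
    also have "\<dots> = - (lam m / frame_scale m * pairing (\<lambda>f. Gi f s) (coframe (bar m)))"
      unfolding h_frame[OF that] by (simp add: pairing_def sum_distrib_left ac_simps)
    also have "\<dots> = - lam m * frame m s" by (simp add: raise)
    finally show ?thesis .
  qed
  have "(\<Sum>e\<in>UNIV. \<Sum>f\<in>UNIV. Gi e q * Gi f s * complex_of_real (h $ e $ f)) =
      (\<Sum>e\<in>UNIV. \<Sum>f\<in>UNIV. \<Sum>m\<in>J. frame_scale m * frame (bar m) q *
        (frame m e * Gi f s * complex_of_real (h $ e $ f)))"
    unfolding Gi_expansion[of _ q] sum_distrib_right by (simp add: ac_simps)
  also have "\<dots> = (\<Sum>m\<in>J. \<Sum>e\<in>UNIV. \<Sum>f\<in>UNIV. frame_scale m * frame (bar m) q *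
        (frame m e * Gi f s * complex_of_real (h $ e $ f)))"
    by (rule sum_rotate)
  also have "\<dots> = (\<Sum>m\<in>J. - (frame_scale m * lam m * frame (bar m) q * frame m s))"
    unfolding sum_distrib_left[symmetric]
    by (intro sum.cong refl) (simp add: inner)
  also have "\<dots> = (\<Sum>m\<in>J. frame_scale m * lam m * frame m q * frame (bar m) s)"
    by (subst sum_bar[symmetric]) (simp add: lam_def skew_eigenvalue_bar)
  finally show ?thesis .
qed

lemma contract4_riem_up2:
  "contract4 (\<lambda>a b c d. complex_of_real (riem_up2 G R a b c d)) (coframe i) (coframe j) w z =
     frame_scale i * frame_scale j *
     contract4 (\<lambda>a b c d. complex_of_real (R $ a $ b $ c $ d)) (frame (bar i)) (frame (bar j)) w z"
proof -
  define K where "K p q = contract2 (\<lambda>c d. complex_of_real (R $ p $ q $ c $ d)) w z" for p q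
  have "contract2 (\<lambda>c d. complex_of_real (riem_up2 G R a b c d)) w z =
      (\<Sum>p\<in>UNIV. Gi a p * (\<Sum>q\<in>UNIV. Gi b q * K p q))" for a b
    by (simp add: riem_up2_def Gi_def[symmetric] contract2_linear K_def sum_distrib_left mult.assoc)
  then have "contract4 (\<lambda>a b c d. complex_of_real (riem_up2 G R a b c d)) (coframe i) (coframe j) w z =
      contract2 (\<lambda>a b. \<Sum>p\<in>UNIV. Gi a p * (\<Sum>q\<in>UNIV. Gi b q * K p q)) (coframe i) (coframe j)"
    by (simp add: contract4_def)
  also have "\<dots> = frame_scale i * contract2 (\<lambda>p b. \<Sum>q\<in>UNIV. Gi b q * K p q) (frame (bar i)) (coframe j)"
    by (rule contract2_raise)
  also have "contract2 (\<lambda>p b. \<Sum>q\<in>UNIV. Gi b q * K p q) (frame (bar i)) (coframe j) =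
      frame_scale j * contract2 K (frame (bar i)) (frame (bar j))"
    by (rule contract2_raise')
  finally show ?thesis by (simp add: contract4_def K_def[abs_def])
qed

lemma contract2_ricci:
  "contract2 (\<lambda>a b. complex_of_real (ricci G R a b)) (frame i) (frame l) =
     (\<Sum>m\<in>J. frame_scale m * component R m i (bar m) l)"
proof -
  have "complex_of_real (ricci G R a b) = (\<Sum>m\<in>J. frame_scale m *
      pairing (\<lambda>p. pairing (\<lambda>c. complex_of_real (R $ p $ a $ c $ b)) (frame m)) (frame (bar m)))" for a b
  proof -
    have "complex_of_real (ricci G R a b) =
        (\<Sum>c\<in>UNIV. \<Sum>p\<in>UNIV. \<Sum>m\<in>J. frame_scale m * (complex_of_real (R $ p $ a $ c $ b) * frame m c * frame (bar m) p))"
      by (simp add: ricci_def Gi_def[symmetric] Gi_expansion sum_distrib_right sum_distrib_left ac_simps)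
    also have "\<dots> = (\<Sum>p\<in>UNIV. \<Sum>c\<in>UNIV. \<Sum>m\<in>J. frame_scale m * (complex_of_real (R $ p $ a $ c $ b) * frame m c * frame (bar m) p))"
      by (rule sum.swap)
    also have "\<dots> = (\<Sum>m\<in>J. \<Sum>p\<in>UNIV. \<Sum>c\<in>UNIV. frame_scale m * (complex_of_real (R $ p $ a $ c $ b) * frame m c * frame (bar m) p))"
      by (rule sum_rotate)
    finally show ?thesis
      by (simp add: pairing_def sum_distrib_left sum_distrib_right)
  qed
  then have "contract2 (\<lambda>a b. complex_of_real (ricci G R a b)) (frame i) (frame l) =
      (\<Sum>m\<in>J. frame_scale m * component R (bar m) i m l)"
    by (simp add: contract2_linear component_def contract2_of_partial_trace)
  also have "\<dots> = (\<Sum>m\<in>J. frame_scale m * component R m i (bar m) l)"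
    by (subst sum_bar[symmetric]) simp
  finally show ?thesis .
qed

lemma contract2_trace:
  "contract2 (\<lambda>b d. complex_of_real (\<Sum>e\<in>UNIV. \<Sum>f\<in>UNIV. riem_up3 G R b d e f * h $ e $ f))
     (coframe j) (frame l) =
   frame_scale j * (\<Sum>m\<in>J. frame_scale m * lam m * component R (bar j) l m (bar m))"
proof -
  define T where "T p d = (\<Sum>m\<in>J. frame_scale m * lam m *
      contract2 (\<lambda>q s. complex_of_real (R $ p $ d $ q $ s)) (frame m) (frame (bar m)))" for p d
  have T: "T p d = (\<Sum>q\<in>UNIV. \<Sum>s\<in>UNIV. complex_of_real (R $ p $ d $ q $ s) *
      (\<Sum>e\<in>UNIV. \<Sum>f\<in>UNIV. Gi e q * Gi f s * complex_of_real (h $ e $ f)))" for p d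
  proof -
    have "T p d = (\<Sum>m\<in>J. \<Sum>q\<in>UNIV. \<Sum>s\<in>UNIV. complex_of_real (R $ p $ d $ q $ s) *
        (frame_scale m * lam m * frame m q * frame (bar m) s))"
      by (simp add: T_def contract2_def pairing_def sum_distrib_left sum_distrib_right ac_simps)
    also have "\<dots> = (\<Sum>q\<in>UNIV. \<Sum>s\<in>UNIV. \<Sum>m\<in>J. complex_of_real (R $ p $ d $ q $ s) *
        (frame_scale m * lam m * frame m q * frame (bar m) s))"
      by (rule sum_rotate[symmetric])
    finally show ?thesis by (simp add: h_raised sum_distrib_left)
  qed
  have "complex_of_real (\<Sum>e\<in>UNIV. \<Sum>f\<in>UNIV. riem_up3 G R b d e f * h $ e $ f) =
      (\<Sum>p\<in>UNIV. Gi b p * T p d)" for b d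
  proof -
    let ?t = "\<lambda>e f p q s. Gi b p * (complex_of_real (R $ p $ d $ q $ s) * (Gi e q * Gi f s * complex_of_real (h $ e $ f)))"
    have "complex_of_real (\<Sum>e\<in>UNIV. \<Sum>f\<in>UNIV. riem_up3 G R b d e f * h $ e $ f) =
        (\<Sum>e\<in>UNIV. \<Sum>f\<in>UNIV. \<Sum>p\<in>UNIV. \<Sum>q\<in>UNIV. \<Sum>s\<in>UNIV. ?t e f p q s)"
      by (simp add: riem_up3_def Gi_def[symmetric] sum_distrib_right sum_distrib_left ac_simps)
    also have "\<dots> = (\<Sum>(e, f, p, q, s)\<in>UNIV. ?t e f p q s)"
      by (simp add: sum.cartesian_product)
    also have "\<dots> = (\<Sum>(p, q, s, e, f)\<in>UNIV. ?t e f p q s)"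
      by (rule sum.reindex_bij_witness[of _ "\<lambda>(p, q, s, e, f). (e, f, p, q, s)" "\<lambda>(e, f, p, q, s). (p, q, s, e, f)"]) auto
    also have "\<dots> = (\<Sum>p\<in>UNIV. \<Sum>q\<in>UNIV. \<Sum>s\<in>UNIV. \<Sum>e\<in>UNIV. \<Sum>f\<in>UNIV. ?t e f p q s)"
      by (simp add: sum.cartesian_product)
    finally show ?thesis by (simp add: T sum_distrib_left)
  qed
  then have "contract2 (\<lambda>b d. complex_of_real (\<Sum>e\<in>UNIV. \<Sum>f\<in>UNIV. riem_up3 G R b d e f * h $ e $ f))
     (coframe j) (frame l) = frame_scale j * contract2 T (frame (bar j)) (frame l)"
    by (simp only: contract2_raise)
  moreover have "contract2 T (frame (bar j)) (frame l) =
      (\<Sum>m\<in>J. frame_scale m * lam m * component R (bar j) l m (bar m))"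
    unfolding T_def by (simp add: contract2_linear component_def contract4_def)
  ultimately show ?thesis by simp
qed

text \<open>
  The three terms of the condition are products of contractions that are each diagonal or
  antidiagonal in the null frame. Contracting the upper indices with the conjugate null covectors
  lowers them up to the factors \<open>frame_scale\<close>.
\<close>

lemma integrability_contraction:
  assumes J: "i \<in> J" "j \<in> J" "k \<in> J" "l \<in> J"
  shows "contract4 (\<lambda>a b c d. complex_of_real (integrability G h R $ a $ b $ c $ d))
      (coframe (bar i)) (coframe (bar j)) (frame k) (frame l) =
    integrability_component n \<epsilon> lam (component R) i j k l"
proof -
  define N where "N = complex_of_real (real CARD('d) - 2)"
  define T1 where "T1 a b c d = complex_of_real (\<Sum>e\<in>UNIV. riem_up2 G R a b e c * form_up G h e d)" for a b c d
  define P where "P b d = complex_of_real (\<Sum>e\<in>UNIV. \<Sum>f\<in>UNIV. riem_up3 G R b d e f * h $ e $ f)" for b d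
  define S where "S a d = (\<Sum>e\<in>UNIV. complex_of_real (ricci_up G R a e) * complex_of_real (form_up G h e d))" for a d
  define \<Delta> where "\<Delta> a c = complex_of_real (delta (a :: 'd) c)" for a c
  have T1: "contract4 T1 (coframe (bar i)) (coframe (bar j)) w (frame l) =
      lam l * (frame_scale i * frame_scale j *
        contract4 (\<lambda>a b c d. complex_of_real (R $ a $ b $ c $ d)) (frame i) (frame j) (frame l) w)"
    if "l \<in> J" for w l
  proof -
    have "contract2 (T1 a b) w (frame l) =
        lam l * contract2 (\<lambda>c e. complex_of_real (riem_up2 G R a b e c)) w (frame l)" for a b
      unfolding T1_def of_real_sum of_real_mult by (rule contract2_form[OF that])
    then have "contract2 (T1 a b) w (frame l) =
        lam l * contract2 (\<lambda>c d. complex_of_real (riem_up2 G R a b c d)) (frame l) w" for a b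
      using contract2_swap[of "\<lambda>c d. complex_of_real (riem_up2 G R a b c d)" w "frame l"] by simp
    then have "contract4 T1 (coframe (bar i)) (coframe (bar j)) w (frame l) =
        lam l * contract4 (\<lambda>a b c d. complex_of_real (riem_up2 G R a b c d)) (coframe (bar i)) (coframe (bar j)) (frame l) w"
      by (simp add: contract4_def contract2_linear)
    then show ?thesis by (simp add: contract4_riem_up2)
  qed
  have P: "contract2 P (coframe (bar a)) (frame b) =
      frame_scale a * (\<Sum>m\<in>J. frame_scale m * lam m * component R a b m (bar m))" for a b
    using contract2_trace[of R "bar a" b] unfolding P_def by simp
  have S: "contract2 S (coframe (bar a)) (frame b) =
      lam b * (frame_scale a * (\<Sum>m\<in>J. frame_scale m * component R m a (bar m) b))"
    if "b \<in> J" for a b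
  proof -
    have "complex_of_real (ricci_up G R a e) = (\<Sum>p\<in>UNIV. Gi a p * complex_of_real (ricci G R p e))" for a e
      by (simp add: ricci_up_def Gi_def)
    then have "contract2 (\<lambda>a e. complex_of_real (ricci_up G R a e)) (coframe (bar a)) (frame b) =
        frame_scale a * contract2 (\<lambda>a e. complex_of_real (ricci G R a e)) (frame a) (frame b)"
      by (simp add: contract2_raise[where T = "\<lambda>p e. complex_of_real (ricci G R p e)"])
    then show ?thesis
      unfolding S_def by (simp add: contract2_form[OF that] contract2_ricci)
  qed
  have \<Delta>: "contract2 \<Delta> (coframe (bar a)) (frame b) = of_bool (b = bar a)" if "a \<in> J" "b \<in> J" for a b
    using contract2_Kronecker[of "bar a" b] that unfolding \<Delta>_def by (simp add: eq_commute)
  have I: "complex_of_real (integrability G h R $ a $ b $ c $ d) =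
      N * ((T1 a b c d - T1 a b d c) / 2)
      - ((\<Delta> a c * P b d - \<Delta> a d * P b c) / 2 - (\<Delta> b c * P a d - \<Delta> b d * P a c) / 2) / 2
      - 2 * (((S a d * \<Delta> b c - S a c * \<Delta> b d) / 2 - (S b d * \<Delta> a c - S b c * \<Delta> a d) / 2) / 2)"
    for a b c d
  proof -
    have S': "complex_of_real (\<Sum>e\<in>UNIV. ricci_up G R a e * delta b c * form_up G h e d) = S a d * \<Delta> b c"
      for a b c d
      by (simp add: S_def \<Delta>_def sum_distrib_left sum_distrib_right ac_simps)
    show ?thesis
      unfolding integrability_def vec_lambda_beta asym_def of_real_diff of_real_mult of_real_divide
        S' N_def[symmetric] T1_def[symmetric] P_def[symmetric] \<Delta>_def[symmetric]
      by (simp add: N_def)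
  qed
  let ?c = "\<lambda>T. contract4 T (coframe (bar i)) (coframe (bar j)) (frame k) (frame l)"
  have swaps: "?c (\<lambda>a b c d. T1 a b d c) = contract4 T1 (coframe (bar i)) (coframe (bar j)) (frame l) (frame k)"
    by (rule contract4_swap34)
  have dP: "?c (\<lambda>a b c d. \<Delta> b c * P a d) = contract2 \<Delta> (coframe (bar j)) (frame k) * contract2 P (coframe (bar i)) (frame l)"
    "?c (\<lambda>a b c d. \<Delta> b d * P a c) = contract2 \<Delta> (coframe (bar j)) (frame l) * contract2 P (coframe (bar i)) (frame k)"
    by (simp_all only: mult.commute[of "\<Delta> _ _"] contract4_prod) (simp_all only: mult.commute)
  have dS: "?c (\<lambda>a b c d. S b d * \<Delta> a c) = contract2 \<Delta> (coframe (bar i)) (frame k) * contract2 S (coframe (bar j)) (frame l)"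
    "?c (\<lambda>a b c d. S b c * \<Delta> a d) = contract2 \<Delta> (coframe (bar i)) (frame l) * contract2 S (coframe (bar j)) (frame k)"
    by (simp_all only: mult.commute[of "S _ _"] contract4_prod)
  have N: "N = of_nat (card J) - 2" by (simp add: N_def card_J)
  show ?thesis
    unfolding I contract4_linear swaps dP dS contract4_prod T1[OF J(4)] T1[OF J(3)] P
    using J
    by (simp add: S \<Delta> N integrability_component_def Let_def component_def[symmetric]) (simp add: field_simps)
qed

lemma integrability_eq_0_iff:
  "integrability G h R = 0 \<longleftrightarrow>
     (\<forall>i\<in>J. \<forall>j\<in>J. \<forall>k\<in>J. \<forall>l\<in>J. integrability_component n \<epsilon> lam (component R) i j k l = 0)"
proof
  assume "integrability G h R = 0"
  then show "\<forall>i\<in>J. \<forall>j\<in>J. \<forall>k\<in>J. \<forall>l\<in>J. integrability_component n \<epsilon> lam (component R) i j k l = 0"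
    by (simp add: integrability_contraction[symmetric])
      (simp add: contract4_def contract2_def pairing_zero)
next
  assume zero: "\<forall>i\<in>J. \<forall>j\<in>J. \<forall>k\<in>J. \<forall>l\<in>J. integrability_component n \<epsilon> lam (component R) i j k l = 0"
  have compl: "(\<Sum>i\<in>J. frame (bar i) a * coframe (bar i) b) = of_bool (a = b)" for a b
    using sum_bar[of "\<lambda>i. frame i a * coframe i b" n \<epsilon>] by (simp add: complete)
  have "complex_of_real (integrability G h R $ a $ b $ c $ d) = 0" for a b c d
    by (rule contract4_eq_0D[OF compl complete'])
      (use zero in \<open>simp add: integrability_contraction\<close>)
  then show "integrability G h R = 0" by (simp add: vec_eq_iff)
qed

end

end

section \<open>Sectional components of the basic tensors\<close>

lemma subspace_riemann_symmetric: "subspace riemann_symmetric"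
  unfolding subspace_def
proof (intro conjI ballI allI)
  show "0 \<in> riemann_symmetric"
    by (intro riemann_symmetricI) simp_all
next
  fix R S :: "real^'a^'a^'a^'a" assume "R \<in> riemann_symmetric" "S \<in> riemann_symmetric"
  note R = riemann_symmetricD[OF this(1)] and S = riemann_symmetricD[OF this(2)]
  show "R + S \<in> riemann_symmetric"
  proof (rule riemann_symmetricI)
    fix a b c d
    show "(R + S) $ b $ a $ c $ d = - (R + S) $ a $ b $ c $ d"
      using R(1)[of b a c d] S(1)[of b a c d] by simp
    show "(R + S) $ c $ d $ a $ b = (R + S) $ a $ b $ c $ d"
      using R(2)[of c d a b] S(2)[of c d a b] by simp
    show "(R + S) $ a $ b $ c $ d + (R + S) $ a $ c $ d $ b + (R + S) $ a $ d $ b $ c = 0"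
      using R(3)[of a b c d] S(3)[of a b c d] by simp
  qed
next
  fix s :: real and R :: "real^'a^'a^'a^'a" assume "R \<in> riemann_symmetric"
  note R = riemann_symmetricD[OF this]
  show "s *\<^sub>R R \<in> riemann_symmetric"
  proof (rule riemann_symmetricI)
    fix a b c d
    show "(s *\<^sub>R R) $ b $ a $ c $ d = - (s *\<^sub>R R) $ a $ b $ c $ d"
      using R(1)[of b a c d] by simp
    show "(s *\<^sub>R R) $ c $ d $ a $ b = (s *\<^sub>R R) $ a $ b $ c $ d"
      using R(2)[of c d a b] by simp
    show "(s *\<^sub>R R) $ a $ b $ c $ d + (s *\<^sub>R R) $ a $ c $ d $ b + (s *\<^sub>R R) $ a $ d $ b $ c = 0"
      using R(3)[of a b c d] by (simp flip: distrib_left)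
  qed
qed

lemma odot_antisym_riemann_symmetric:
  assumes h: "\<And>a b. h $ b $ a = - h $ a $ b" and k: "\<And>a b. k $ b $ a = - k $ a $ b"
  shows "odot_antisym h k \<in> riemann_symmetric"
proof (rule riemann_symmetricI)
  fix a b c d
  note hs = h[of a b] h[of a c] h[of a d] h[of b c] h[of b d] h[of c d]
    and ks = k[of a b] k[of a c] k[of a d] k[of b c] k[of b d] k[of c d]
  show "odot_antisym h k $ b $ a $ c $ d = - odot_antisym h k $ a $ b $ c $ d"
    by (simp add: odot_antisym_def hs ks algebra_simps)
  show "odot_antisym h k $ c $ d $ a $ b = odot_antisym h k $ a $ b $ c $ d"
    by (simp add: odot_antisym_def hs ks algebra_simps)
  show "odot_antisym h k $ a $ b $ c $ d + odot_antisym h k $ a $ c $ d $ b + odot_antisym h k $ a $ d $ b $ c = 0"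
    by (simp add: odot_antisym_def hs ks algebra_simps)
qed

lemma odot_sym_riemann_symmetric:
  assumes h: "\<And>a b. h $ b $ a = h $ a $ b" and k: "\<And>a b. k $ b $ a = k $ a $ b"
  shows "odot_sym h k \<in> riemann_symmetric"
proof (rule riemann_symmetricI)
  fix a b c d
  note hs = h[of a b] h[of a c] h[of a d] h[of b c] h[of b d] h[of c d]
    and ks = k[of a b] k[of a c] k[of a d] k[of b c] k[of b d] k[of c d]
  show "odot_sym h k $ b $ a $ c $ d = - odot_sym h k $ a $ b $ c $ d"
    by (simp add: odot_sym_def algebra_simps)
  show "odot_sym h k $ c $ d $ a $ b = odot_sym h k $ a $ b $ c $ d"
    by (simp add: odot_sym_def hs ks algebra_simps)
  show "odot_sym h k $ a $ b $ c $ d + odot_sym h k $ a $ c $ d $ b + odot_sym h k $ a $ d $ b $ c = 0"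
    by (simp add: odot_sym_def hs ks algebra_simps)
qed

lemma sum_of_bool_delta:
  fixes f :: "'a \<Rightarrow> complex"
  assumes "finite M" "a \<in> M"
  shows "(\<Sum>\<mu>\<in>M. f \<mu> * of_bool (\<mu> = a)) = f a"
proof -
  have "(\<Sum>\<mu>\<in>M. f \<mu> * of_bool (\<mu> = a)) = (\<Sum>\<mu>\<in>M. if \<mu> = a then f a else 0)"
    by (intro sum.cong) auto
  then show ?thesis using assms by simp
qed

text \<open>
  The double sum runs over ordered pairs \<open>\<mu> < \<nu>\<close>, so exactly one of the two indicators is hit, according
  to whether \<open>a < b\<close> or \<open>b < a\<close>.
\<close>

lemma sum_pairs_delta:
  fixes F :: "nat \<Rightarrow> nat \<Rightarrow> complex"
  assumes "a \<in> {1..n}" "b \<in> {1..n}" "a \<noteq> b" and sym: "F b a = F a b"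
  shows "(\<Sum>\<mu>\<in>{1..n}. \<Sum>\<nu>\<in>{\<mu><..n}. F \<mu> \<nu> * (of_bool (\<mu> = a \<and> \<nu> = b) + of_bool (\<mu> = b \<and> \<nu> = a))) = F a b"
proof -
  have one: "(\<Sum>\<mu>\<in>{1..n}. \<Sum>\<nu>\<in>{\<mu><..n}. F \<mu> \<nu> * of_bool (\<mu> = a \<and> \<nu> = b)) = (if a < b then F a b else 0)"
    if "a \<in> {1..n}" "b \<in> {1..n}" for a b
  proof -
    have "(\<Sum>\<mu>\<in>{1..n}. \<Sum>\<nu>\<in>{\<mu><..n}. F \<mu> \<nu> * of_bool (\<mu> = a \<and> \<nu> = b)) =
        (\<Sum>\<mu>\<in>{1..n}. if \<mu> = a then (\<Sum>\<nu>\<in>{a<..n}. if \<nu> = b then F a b else 0) else 0)"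
      by (intro sum.cong refl) (auto intro!: sum.cong sum.neutral)
    then show ?thesis using that by simp
  qed
  show ?thesis
    using assms by (simp only: distrib_left sum.distrib one) auto
qed

lemma sectional_eqI:
  assumes "zero_weight_components n \<epsilon> r" "zero_weight_components n \<epsilon> r'"
    and "\<And>a b. a \<in> {1..n} \<Longrightarrow> b \<in> {1..n} \<Longrightarrow> a \<noteq> b \<Longrightarrow>
      sectional r (Plus a) (Plus b) = sectional r' (Plus a) (Plus b)"
    and "\<And>a b. a \<in> {1..n} \<Longrightarrow> b \<in> {1..n} \<Longrightarrow> a \<noteq> b \<Longrightarrow>
      sectional r (Plus a) (Minus b) = sectional r' (Plus a) (Minus b)"
    and "\<And>a. a \<in> {1..n} \<Longrightarrow> sectional r (Plus a) (Minus a) = sectional r' (Plus a) (Minus a)"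
    and "\<And>a. a \<in> {1..n} \<Longrightarrow> Hat0 \<in> weight_indices n \<epsilon> \<Longrightarrow> sectional r (Plus a) Hat0 = sectional r' (Plus a) Hat0"
    and "i \<in> weight_indices n \<epsilon>" "j \<in> weight_indices n \<epsilon>" "i \<noteq> j"
  shows "sectional r i j = sectional r' i j"
proof -
  interpret r: zero_weight_components n \<epsilon> r by fact
  interpret r': zero_weight_components n \<epsilon> r' by fact
  from assms(7-9) show ?thesis
  proof (induction rule: weight_index_pair_cases)
    case (sym i j)
    then show ?case using r.sec_sym[of i j] r'.sec_sym[of i j] by simp
  next
    case (bar i j)
    then show ?case by (simp add: r.sec_bar r'.sec_bar)
  qed (use assms(3-6) in auto)
qed

lemma sum_pairs_same_delta:
  fixes n :: nat
  shows "(\<Sum>\<mu>\<in>{1..n}. \<Sum>\<nu>\<in>{\<mu><..n}. F \<mu> \<nu> * (of_bool (\<mu> = a \<and> \<nu> = a) :: complex)) = 0"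
  by (intro sum.neutral ballI) auto

context point_coframe
begin

definition zero_weight_riemann :: "(real^'d^'d^'d^'d) set" where
  "zero_weight_riemann = riemann_symmetric \<inter> zero_weight n \<epsilon> E Eh"

lemma subspace_zero_weight_riemann: "subspace zero_weight_riemann"
  unfolding zero_weight_riemann_def
  by (intro subspace_inter subspace_riemann_symmetric)
    (simp add: subspace_def zero_weight_iff component_linear)

lemma zero_weight_components:
  assumes "R \<in> zero_weight_riemann"
  shows "zero_weight_components n \<epsilon> (component R)"
  using assms unfolding zero_weight_riemann_def
  by unfold_locales (auto simp: zero_weight_iff dest: riemann_symmetric_component)

lemma cnj_sectional: 
  assumes "R \<in> zero_weight_riemann"
  shows "cnj (sectional (component R) i j) = sectional (component R) i j"
proof -
  interpret zero_weight_components n \<epsilon> "component R" by (rule zero_weight_components[OF assms])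
  show ?thesis using sec_bar[of i j] by (simp add: sectional_def cnj_component)
qed

lemma sectional_real:
  assumes "R \<in> zero_weight_riemann"
  shows "complex_of_real (Re (sectional (component R) i j)) = sectional (component R) i j"
  using cnj_sectional[OF assms, of i j] by (simp add: complex_eq_iff)

lemma zero_weight_riemann_eqI:
  assumes "R \<in> zero_weight_riemann" "R' \<in> zero_weight_riemann"
    and "\<And>i j. i \<in> J \<Longrightarrow> j \<in> J \<Longrightarrow> i \<noteq> j \<Longrightarrow> sectional (component R) i j = sectional (component R') i j"
  shows "R = R'"
proof -
  interpret zero_weight_components n \<epsilon> "component R" by (rule zero_weight_components[OF assms(1)])
  show ?thesis
    by (rule component_eqI, rule r_determined[OF zero_weight_components[OF assms(2)]])
      (use assms(3) in auto)
qed

definition component2 :: "real^'d^'d \<Rightarrow> weight_index \<Rightarrow> weight_index \<Rightarrow> complex" where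
  "component2 h i j = contract2 (\<lambda>a b. complex_of_real (h $ a $ b)) (frame i) (frame j)"

lemma component_odot_antisym:
  "component (odot_antisym h k) i j p q =
      (component2 h i j * component2 k p q + component2 k i j * component2 h p q) / 4
    + (component2 h i p * component2 k j q + component2 k i p * component2 h j q) / 8
    - (component2 h i q * component2 k j p + component2 k i q * component2 h j p) / 8"
  unfolding component_def odot_antisym_def component2_def
  by (simp add: mult.assoc contract4_linear contract4_prod add_divide_distrib diff_divide_distrib)

lemma component_odot_sym:
  "component (odot_sym h k) i j p q =
      (component2 h i q * component2 k j p + component2 k i q * component2 h j p) / 8
    - (component2 h i p * component2 k j q + component2 k i p * component2 h j q) / 8"
  unfolding component_def odot_sym_def component2_def
  by (simp add: mult.assoc contract4_linear contract4_prod add_divide_distrib diff_divide_distrib)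

lemma component2_wedge:
  assumes "\<mu> \<in> {1..n}" "i \<in> J" "j \<in> J"
  shows "component2 (wedge (E \<mu>) (Eh \<mu>)) i j =
    (if i = Plus \<mu> \<and> j = Minus \<mu> then \<i> / 2 else if i = Minus \<mu> \<and> j = Plus \<mu> then - \<i> / 2 else 0)"
  using assms
  by (auto simp: component2_def wedge_def contract2_linear contract2_prod pairing_E pairing_Eh)

lemma component2_Q:
  assumes "\<mu> \<in> {1..n}" "i \<in> J" "j \<in> J"
  shows "component2 (Q_tensor (E \<mu>) (Eh \<mu>)) i j =
    (if i = Plus \<mu> \<and> j = Minus \<mu> \<or> i = Minus \<mu> \<and> j = Plus \<mu> then 1 / 2 else 0)"
  using assms
  by (auto simp: component2_def Q_tensor_def contract2_linear contract2_prod pairing_E pairing_Eh)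

lemma component2_metric:
  assumes "i \<in> J" "j \<in> J"
  shows "component2 (s *\<^sub>R G) i j = (if j = bar i then complex_of_real s / frame_scale i else 0)"
  using metric_component[OF assms] by (simp add: component2_def contract2_linear)

text \<open>
  Both products distribute the four slots to two factors that are antidiagonal in the null frame,
  and each such distribution is a pairing.
\<close>

lemma zero_weight_odotI:
  assumes h: "\<And>i j. i \<in> J \<Longrightarrow> j \<in> J \<Longrightarrow> j \<noteq> bar i \<Longrightarrow> component2 h i j = 0"
    and k: "\<And>i j. i \<in> J \<Longrightarrow> j \<in> J \<Longrightarrow> j \<noteq> bar i \<Longrightarrow> component2 k i j = 0"
  shows "odot_antisym h k \<in> zero_weight n \<epsilon> E Eh" and "odot_sym h k \<in> zero_weight n \<epsilon> E Eh"
proof -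
  have zero: "component2 s i j * component2 t p q = 0" if "s \<in> {h, k}" "t \<in> {h, k}"
    "i \<in> J" "j \<in> J" "p \<in> J" "q \<in> J" "\<not> (j = bar i \<and> q = bar p)" for s t i j p q
    using that h k by auto
  show "odot_antisym h k \<in> zero_weight n \<epsilon> E Eh" "odot_sym h k \<in> zero_weight n \<epsilon> E Eh"
    unfolding zero_weight_iff component_odot_antisym component_odot_sym
    by (intro ballI impI, simp add: zero paired_def)+
qed

lemma zero_weight_tensor_mem: "zero_weight_tensor G n \<epsilon> E Eh w \<in> zero_weight_riemann"
proof -
  obtain \<Omega> \<alpha> \<alpha>\<epsilon> where w: "w = (\<Omega>, \<alpha>, \<alpha>\<epsilon>)" by (cases w) auto
  have hd: "component2 (wedge (E \<mu>) (Eh \<mu>)) i j = 0" if "\<mu> \<in> {1..n}" "i \<in> J" "j \<in> J" "j \<noteq> bar i" for \<mu> i j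
    using that by (auto simp: component2_wedge)
  have Qd: "component2 (Q_tensor (E \<mu>) (Eh \<mu>)) i j = 0" if "\<mu> \<in> {1..n}" "i \<in> J" "j \<in> J" "j \<noteq> bar i" for \<mu> i j
    using that by (auto simp: component2_Q)
  have Gd: "component2 (s *\<^sub>R G) i j = 0" if "i \<in> J" "j \<in> J" "j \<noteq> bar i" for s i j
    using that by (simp add: component2_metric)
  have G': "(s *\<^sub>R G) $ b $ a = (s *\<^sub>R G) $ a $ b" for s a b
  proof -
    have "transpose G $ a $ b = G $ a $ b" by (simp add: G_sym)
    then show ?thesis by (simp add: transpose_def)
  qed
  have hh: "odot_antisym (wedge (E \<mu>) (Eh \<mu>)) (wedge (E \<nu>) (Eh \<nu>)) \<in> zero_weight_riemann"
    if "\<mu> \<in> {1..n}" "\<nu> \<in> {1..n}" for \<mu> \<nu>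
    unfolding zero_weight_riemann_def using that
    by (intro IntI odot_antisym_riemann_symmetric zero_weight_odotI hd)
      (simp_all add: wedge_def)
  have QQ: "odot_sym (Q_tensor (E \<mu>) (Eh \<mu>)) (Q_tensor (E \<nu>) (Eh \<nu>)) \<in> zero_weight_riemann"
    if "\<mu> \<in> {1..n}" "\<nu> \<in> {1..n}" for \<mu> \<nu>
    unfolding zero_weight_riemann_def using that
    by (intro IntI odot_sym_riemann_symmetric zero_weight_odotI Qd)
      (simp_all add: Q_tensor_def)
  have QG: "odot_sym (Q_tensor (E \<mu>) (Eh \<mu>)) (real \<epsilon> *\<^sub>R G) \<in> zero_weight_riemann"
    if "\<mu> \<in> {1..n}" for \<mu>
    unfolding zero_weight_riemann_def using that
    by (intro IntI odot_sym_riemann_symmetric zero_weight_odotI Qd Gd G')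
      (simp_all add: Q_tensor_def)
  show ?thesis
    unfolding w zero_weight_tensor_def Let_def prod.case
    using subspace_zero_weight_riemann
    by (intro subspace_add subspace_sum subspace_scale hh QQ QG) auto
qed

lemma indices_mem:
  "a \<in> {1..n} \<Longrightarrow> Plus a \<in> J" "a \<in> {1..n} \<Longrightarrow> Minus a \<in> J"
  by (simp_all add: weight_indices_def)

lemma component2_wedge_values:
  assumes "\<mu> \<in> {1..n}"
  defines "w \<equiv> component2 (wedge (E \<mu>) (Eh \<mu>))"
  shows "\<lbrakk>Plus a \<in> J; Plus b \<in> J\<rbrakk> \<Longrightarrow> w (Plus a) (Plus b) = 0"
    and "\<lbrakk>Minus a \<in> J; Minus b \<in> J\<rbrakk> \<Longrightarrow> w (Minus a) (Minus b) = 0"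
    and "\<lbrakk>Plus a \<in> J; Minus b \<in> J\<rbrakk> \<Longrightarrow> w (Plus a) (Minus b) = \<i> / 2 * of_bool (\<mu> = a) * of_bool (\<mu> = b)"
    and "\<lbrakk>Plus a \<in> J; Minus b \<in> J\<rbrakk> \<Longrightarrow> w (Minus b) (Plus a) = - \<i> / 2 * of_bool (\<mu> = a) * of_bool (\<mu> = b)"
    and "\<lbrakk>i \<in> J; Hat0 \<in> J\<rbrakk> \<Longrightarrow> w i Hat0 = 0"
    and "\<lbrakk>i \<in> J; Hat0 \<in> J\<rbrakk> \<Longrightarrow> w Hat0 i = 0"
  by (simp_all add: w_def component2_wedge[OF assms(1)]) auto

lemma component2_Q_values:
  assumes "\<mu> \<in> {1..n}"
  defines "w \<equiv> component2 (Q_tensor (E \<mu>) (Eh \<mu>))"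
  shows "\<lbrakk>Plus a \<in> J; Plus b \<in> J\<rbrakk> \<Longrightarrow> w (Plus a) (Plus b) = 0"
    and "\<lbrakk>Minus a \<in> J; Minus b \<in> J\<rbrakk> \<Longrightarrow> w (Minus a) (Minus b) = 0"
    and "\<lbrakk>Plus a \<in> J; Minus b \<in> J\<rbrakk> \<Longrightarrow> w (Plus a) (Minus b) = 1 / 2 * of_bool (\<mu> = a) * of_bool (\<mu> = b)"
    and "\<lbrakk>Plus a \<in> J; Minus b \<in> J\<rbrakk> \<Longrightarrow> w (Minus b) (Plus a) = 1 / 2 * of_bool (\<mu> = a) * of_bool (\<mu> = b)"
    and "\<lbrakk>i \<in> J; Hat0 \<in> J\<rbrakk> \<Longrightarrow> w i Hat0 = 0"
    and "\<lbrakk>i \<in> J; Hat0 \<in> J\<rbrakk> \<Longrightarrow> w Hat0 i = 0"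
  by (simp_all add: w_def component2_Q[OF assms(1)]) auto

lemma sectional_hh:
  assumes "\<mu> \<in> {1..n}" "\<nu> \<in> {1..n}"
  defines "r \<equiv> component (odot_antisym (wedge (E \<mu>) (Eh \<mu>)) (wedge (E \<nu>) (Eh \<nu>)))"
  shows "\<lbrakk>a \<in> {1..n}; b \<in> {1..n}; a \<noteq> b\<rbrakk> \<Longrightarrow>
      sectional r (Plus a) (Plus b) = - (of_bool (\<mu> = a \<and> \<nu> = b) + of_bool (\<mu> = b \<and> \<nu> = a)) / 32"
    and "\<lbrakk>a \<in> {1..n}; b \<in> {1..n}; a \<noteq> b\<rbrakk> \<Longrightarrow>
      sectional r (Plus a) (Minus b) = (of_bool (\<mu> = a \<and> \<nu> = b) + of_bool (\<mu> = b \<and> \<nu> = a)) / 32"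
    and "a \<in> {1..n} \<Longrightarrow> sectional r (Plus a) (Minus a) = 3 / 16 * of_bool (\<mu> = a \<and> \<nu> = a)"
    and "\<lbrakk>a \<in> {1..n}; Hat0 \<in> J\<rbrakk> \<Longrightarrow> sectional r (Plus a) Hat0 = 0"
  using assms(1,2)
  by (simp_all add: r_def sectional_def component_odot_antisym component2_wedge_values indices_mem
      del: atLeastAtMost_iff, (auto simp: of_bool_def)?)

lemma sectional_QQ:
  assumes "\<mu> \<in> {1..n}" "\<nu> \<in> {1..n}"
  defines "r \<equiv> component (odot_sym (Q_tensor (E \<mu>) (Eh \<mu>)) (Q_tensor (E \<nu>) (Eh \<nu>)))"
  shows "\<lbrakk>a \<in> {1..n}; b \<in> {1..n}; a \<noteq> b\<rbrakk> \<Longrightarrow>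
      sectional r (Plus a) (Plus b) = - (of_bool (\<mu> = a \<and> \<nu> = b) + of_bool (\<mu> = b \<and> \<nu> = a)) / 32"
    and "\<lbrakk>a \<in> {1..n}; b \<in> {1..n}; a \<noteq> b\<rbrakk> \<Longrightarrow>
      sectional r (Plus a) (Minus b) = - (of_bool (\<mu> = a \<and> \<nu> = b) + of_bool (\<mu> = b \<and> \<nu> = a)) / 32"
    and "a \<in> {1..n} \<Longrightarrow> sectional r (Plus a) (Minus a) = - (1 / 16) * of_bool (\<mu> = a \<and> \<nu> = a)"
    and "\<lbrakk>a \<in> {1..n}; Hat0 \<in> J\<rbrakk> \<Longrightarrow> sectional r (Plus a) Hat0 = 0"
  using assms(1,2)
  by (simp_all add: r_def sectional_def component_odot_sym component2_Q_values indices_mem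
      del: atLeastAtMost_iff, (auto simp: of_bool_def)?)

lemma sectional_QG:
  assumes "\<mu> \<in> {1..n}"
  defines "r \<equiv> component (odot_sym (Q_tensor (E \<mu>) (Eh \<mu>)) (real \<epsilon> *\<^sub>R G))"
  shows "\<lbrakk>a \<in> {1..n}; b \<in> {1..n}; a \<noteq> b\<rbrakk> \<Longrightarrow>
      sectional r (Plus a) (Plus b) = - of_nat \<epsilon> * (of_bool (\<mu> = a) + of_bool (\<mu> = b)) / 32"
    and "\<lbrakk>a \<in> {1..n}; b \<in> {1..n}; a \<noteq> b\<rbrakk> \<Longrightarrow>
      sectional r (Plus a) (Minus b) = - of_nat \<epsilon> * (of_bool (\<mu> = a) + of_bool (\<mu> = b)) / 32"
    and "a \<in> {1..n} \<Longrightarrow> sectional r (Plus a) (Minus a) = - of_nat \<epsilon> * of_bool (\<mu> = a) / 16"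
    and "\<lbrakk>a \<in> {1..n}; Hat0 \<in> J\<rbrakk> \<Longrightarrow> sectional r (Plus a) Hat0 = - of_nat \<epsilon> * of_bool (\<mu> = a) / 16"
  using assms(1)
  by (simp_all add: r_def sectional_def component_odot_sym component2_Q_values component2_metric
      indices_mem frame_scale_def del: atLeastAtMost_iff, (auto simp: of_bool_def)?)

lemma sectional_zero_weight_tensor_expand:
  "sectional (component (zero_weight_tensor G n \<epsilon> E Eh (\<Omega>, \<alpha>, \<alpha>\<epsilon>))) i j =
    (\<Sum>\<mu>\<in>{1..n}. \<Sum>\<nu>\<in>{\<mu><..n}.
       \<Omega> \<mu> \<nu> * sectional (component (odot_antisym (wedge (E \<mu>) (Eh \<mu>)) (wedge (E \<nu>) (Eh \<nu>)))) i j
     + \<alpha> \<mu> \<nu> * sectional (component (odot_sym (Q_tensor (E \<mu>) (Eh \<mu>)) (Q_tensor (E \<nu>) (Eh \<nu>)))) i j)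
  + (\<Sum>\<mu>\<in>{1..n}.
       \<Omega> \<mu> \<mu> / 2 * sectional (component (odot_antisym (wedge (E \<mu>) (Eh \<mu>)) (wedge (E \<mu>) (Eh \<mu>)))) i j
     + \<alpha>\<epsilon> \<mu> * sectional (component (odot_sym (Q_tensor (E \<mu>) (Eh \<mu>)) (real \<epsilon> *\<^sub>R G))) i j)"
  unfolding zero_weight_tensor_def Let_def prod.case sectional_def
  by (simp only: component_linear component_sum) simp

text \<open>
  The system is triangular: the axis component gives \<open>\<alpha>\<epsilon>\<close>, the components in mixed planes give the
  sum and the difference of \<open>\<Omega>\<close> and \<open>\<alpha>\<close> up to \<open>\<alpha>\<epsilon>\<close>, and those with \<open>(Plus \<mu>, Minus \<mu>)\<close> give the
  diagonal of \<open>\<Omega>\<close>.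
\<close>

lemma sectional_zero_weight_tensor:
  assumes "(\<Omega>, \<alpha>, \<alpha>\<epsilon>) \<in> coefficient_systems n \<epsilon>"
  defines "A \<equiv> sectional (component (zero_weight_tensor G n \<epsilon> E Eh (\<Omega>, \<alpha>, \<alpha>\<epsilon>)))"
  shows "\<lbrakk>a \<in> {1..n}; b \<in> {1..n}; a \<noteq> b\<rbrakk> \<Longrightarrow>
      A (Plus a) (Plus b) = - complex_of_real ((\<Omega> a b + \<alpha> a b + real \<epsilon> * (\<alpha>\<epsilon> a + \<alpha>\<epsilon> b)) / 32)"
    and "\<lbrakk>a \<in> {1..n}; b \<in> {1..n}; a \<noteq> b\<rbrakk> \<Longrightarrow>
      A (Plus a) (Minus b) = complex_of_real ((\<Omega> a b - \<alpha> a b - real \<epsilon> * (\<alpha>\<epsilon> a + \<alpha>\<epsilon> b)) / 32)"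
    and "a \<in> {1..n} \<Longrightarrow>
      A (Plus a) (Minus a) = complex_of_real (3 / 32 * \<Omega> a a - real \<epsilon> * \<alpha>\<epsilon> a / 16)"
    and "\<lbrakk>a \<in> {1..n}; Hat0 \<in> J\<rbrakk> \<Longrightarrow> A (Plus a) Hat0 = - complex_of_real (real \<epsilon> * \<alpha>\<epsilon> a / 16)"
proof -
  have sym: "\<Omega> \<mu> \<nu> = \<Omega> \<nu> \<mu>" "\<alpha> \<mu> \<nu> = \<alpha> \<nu> \<mu>" for \<mu> \<nu>
    using assms(1) by (auto simp: coefficient_systems_def)
  {
    assume ab: "a \<in> {1..n}" "b \<in> {1..n}" "a \<noteq> b"
    have "A (Plus a) (Plus b) =
      (\<Sum>\<mu>\<in>{1..n}. \<Sum>\<nu>\<in>{\<mu><..n}. - complex_of_real (\<Omega> \<mu> \<nu> + \<alpha> \<mu> \<nu>) / 32 *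
          (of_bool (\<mu> = a \<and> \<nu> = b) + of_bool (\<mu> = b \<and> \<nu> = a)))
      + (\<Sum>\<mu>\<in>{1..n}. - (of_nat \<epsilon> * \<alpha>\<epsilon> \<mu>) / 32 * (of_bool (\<mu> = a) + of_bool (\<mu> = b) :: complex))"
      unfolding A_def sectional_zero_weight_tensor_expand using ab
      by (intro arg_cong2[of _ _ _ _ "(+)"] sum.cong refl)
        (auto simp: sectional_hh sectional_QQ sectional_QG of_bool_def)
    also have "(\<Sum>\<mu>\<in>{1..n}. \<Sum>\<nu>\<in>{\<mu><..n}. - complex_of_real (\<Omega> \<mu> \<nu> + \<alpha> \<mu> \<nu>) / 32 *
          (of_bool (\<mu> = a \<and> \<nu> = b) + of_bool (\<mu> = b \<and> \<nu> = a))) = - complex_of_real (\<Omega> a b + \<alpha> a b) / 32"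
      using ab sym[of a b] by (intro sum_pairs_delta) auto
    also have "(\<Sum>\<mu>\<in>{1..n}. - (of_nat \<epsilon> * \<alpha>\<epsilon> \<mu>) / 32 * (of_bool (\<mu> = a) + of_bool (\<mu> = b) :: complex)) =
        - of_nat \<epsilon> * (complex_of_real (\<alpha>\<epsilon> a) + \<alpha>\<epsilon> b) / 32"
      using ab by (simp only: distrib_left sum.distrib sum_of_bool_delta finite_atLeastAtMost)
        (simp add: field_simps)
    finally show "A (Plus a) (Plus b) =
        - complex_of_real ((\<Omega> a b + \<alpha> a b + real \<epsilon> * (\<alpha>\<epsilon> a + \<alpha>\<epsilon> b)) / 32)"
      by (simp add: add_divide_distrib diff_divide_distrib algebra_simps)
  }
  {
    assume ab: "a \<in> {1..n}" "b \<in> {1..n}" "a \<noteq> b"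
    have "A (Plus a) (Minus b) =
      (\<Sum>\<mu>\<in>{1..n}. \<Sum>\<nu>\<in>{\<mu><..n}. complex_of_real (\<Omega> \<mu> \<nu> - \<alpha> \<mu> \<nu>) / 32 *
          (of_bool (\<mu> = a \<and> \<nu> = b) + of_bool (\<mu> = b \<and> \<nu> = a)))
      + (\<Sum>\<mu>\<in>{1..n}. - (of_nat \<epsilon> * \<alpha>\<epsilon> \<mu>) / 32 * (of_bool (\<mu> = a) + of_bool (\<mu> = b) :: complex))"
      unfolding A_def sectional_zero_weight_tensor_expand using ab
      by (intro arg_cong2[of _ _ _ _ "(+)"] sum.cong refl)
        (auto simp: sectional_hh sectional_QQ sectional_QG of_bool_def)
    also have "(\<Sum>\<mu>\<in>{1..n}. \<Sum>\<nu>\<in>{\<mu><..n}. complex_of_real (\<Omega> \<mu> \<nu> - \<alpha> \<mu> \<nu>) / 32 *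
          (of_bool (\<mu> = a \<and> \<nu> = b) + of_bool (\<mu> = b \<and> \<nu> = a))) = complex_of_real (\<Omega> a b - \<alpha> a b) / 32"
      using ab sym[of a b] by (intro sum_pairs_delta) auto
    also have "(\<Sum>\<mu>\<in>{1..n}. - (of_nat \<epsilon> * \<alpha>\<epsilon> \<mu>) / 32 * (of_bool (\<mu> = a) + of_bool (\<mu> = b) :: complex)) =
        - of_nat \<epsilon> * (complex_of_real (\<alpha>\<epsilon> a) + \<alpha>\<epsilon> b) / 32"
      using ab by (simp only: distrib_left sum.distrib sum_of_bool_delta finite_atLeastAtMost)
        (simp add: field_simps)
    finally show "A (Plus a) (Minus b) =
        complex_of_real ((\<Omega> a b - \<alpha> a b - real \<epsilon> * (\<alpha>\<epsilon> a + \<alpha>\<epsilon> b)) / 32)"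
      by (simp add: add_divide_distrib diff_divide_distrib algebra_simps)
  }
  {
    assume a: "a \<in> {1..n}"
    have "A (Plus a) (Minus a) =
      (\<Sum>\<mu>\<in>{1..n}. \<Sum>\<nu>\<in>{\<mu><..n}. complex_of_real (3 / 16 * \<Omega> \<mu> \<nu> - \<alpha> \<mu> \<nu> / 16) * of_bool (\<mu> = a \<and> \<nu> = a))
      + (\<Sum>\<mu>\<in>{1..n}. complex_of_real (3 / 32 * \<Omega> \<mu> \<mu> - real \<epsilon> * \<alpha>\<epsilon> \<mu> / 16) * of_bool (\<mu> = a))"
      unfolding A_def sectional_zero_weight_tensor_expand using a
      by (intro arg_cong2[of _ _ _ _ "(+)"] sum.cong refl)
        (auto simp: sectional_hh sectional_QQ sectional_QG of_bool_def ac_simps)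
    also have "(\<Sum>\<mu>\<in>{1..n}. complex_of_real (3 / 32 * \<Omega> \<mu> \<mu> - real \<epsilon> * \<alpha>\<epsilon> \<mu> / 16) * of_bool (\<mu> = a)) =
        complex_of_real (3 / 32 * \<Omega> a a - real \<epsilon> * \<alpha>\<epsilon> a / 16)"
      using a by (simp only: sum_of_bool_delta finite_atLeastAtMost)
    finally show "A (Plus a) (Minus a) = complex_of_real (3 / 32 * \<Omega> a a - real \<epsilon> * \<alpha>\<epsilon> a / 16)"
      by (simp only: sum_pairs_same_delta add_0)
  }
  {
    assume a: "a \<in> {1..n}" "Hat0 \<in> J"
    have "A (Plus a) Hat0 =
      (\<Sum>\<mu>\<in>{1..n}. \<Sum>\<nu>\<in>{\<mu><..n}. 0) + (\<Sum>\<mu>\<in>{1..n}. - complex_of_real (real \<epsilon> * \<alpha>\<epsilon> \<mu> / 16) * of_bool (\<mu> = a))"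
      unfolding A_def sectional_zero_weight_tensor_expand using a
      by (intro arg_cong2[of _ _ _ _ "(+)"] sum.cong refl)
        (auto simp: sectional_hh sectional_QQ sectional_QG of_bool_def)
    also have "\<dots> = - complex_of_real (real \<epsilon> * \<alpha>\<epsilon> a / 16)"
      using a by (simp only: sum_of_bool_delta finite_atLeastAtMost sum.neutral_const add_0)
    finally show "A (Plus a) Hat0 = - complex_of_real (real \<epsilon> * \<alpha>\<epsilon> a / 16)" .
  }
qed

end

section \<open>Coefficients and parameters\<close>

text \<open>
  The equations determine \<open>v + u\<close> and \<open>u - v\<close> separately, by division by the two factors of
  \<open>x\<^sup>2 - y\<^sup>2\<close>.
\<close>

lemma crossed_system_iff:
  fixes x y d d' u v :: real
  assumes "x\<^sup>2 \<noteq> y\<^sup>2"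
  shows "(x + y) * (v + u) = d + d' \<and> (x - y) * (u - v) = d - d' \<longleftrightarrow>
    u = (x * d - y * d') / (x\<^sup>2 - y\<^sup>2) \<and> v = (x * d' - y * d) / (x\<^sup>2 - y\<^sup>2)"
proof -
  let ?D = "x\<^sup>2 - y\<^sup>2"
  have D: "?D \<noteq> 0" "?D = (x + y) * (x - y)" using assms by (auto simp: power2_eq_square algebra_simps)
  then have xy: "x + y \<noteq> 0" "x - y \<noteq> 0" by auto
  show ?thesis
  proof
    assume "(x + y) * (v + u) = d + d' \<and> (x - y) * (u - v) = d - d'"
    then have L: "(x + y) * (v + u) = d + d'" "(x - y) * (u - v) = d - d'" by simp_all
    have "2 * (u * ?D) = (x - y) * ((x + y) * (v + u)) + (x + y) * ((x - y) * (u - v))"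
      by (simp add: power2_eq_square algebra_simps)
    also have "\<dots> = 2 * (x * d - y * d')" unfolding L by (simp add: algebra_simps)
    finally have u: "u * ?D = x * d - y * d'" by simp
    have "2 * (v * ?D) = (x - y) * ((x + y) * (v + u)) - (x + y) * ((x - y) * (u - v))"
      by (simp add: power2_eq_square algebra_simps)
    also have "\<dots> = 2 * (x * d' - y * d)" unfolding L by (simp add: algebra_simps)
    finally have v: "v * ?D = x * d' - y * d" by simp
    show "u = (x * d - y * d') / ?D \<and> v = (x * d' - y * d) / ?D"
      using u v D(1) by (simp add: eq_divide_eq)
  next
    assume R: "u = (x * d - y * d') / ?D \<and> v = (x * d' - y * d) / ?D"
    have "v + u = (x - y) * (d + d') / ?D" "u - v = (x + y) * (d - d') / ?D"
      using R by (simp_all add: add_divide_distrib[symmetric] diff_divide_distrib[symmetric] algebra_simps)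
    then show "(x + y) * (v + u) = d + d' \<and> (x - y) * (u - v) = d - d'"
      using xy by (simp add: D(2))
  qed
qed

definition solves :: "nat \<Rightarrow> nat \<Rightarrow> (nat \<Rightarrow> real) \<Rightarrow> coefficients \<Rightarrow> (nat \<Rightarrow> real) \<Rightarrow> bool" where
  "solves n \<epsilon> X = (\<lambda>(\<Omega>, \<alpha>, \<alpha>\<epsilon>) d.
     (\<forall>\<mu>. \<mu> \<notin> {1..n} \<longrightarrow> d \<mu> = 0) \<and>
     (\<forall>\<mu>\<in>{1..n}. \<forall>\<nu>\<in>{1..n}. \<mu> \<noteq> \<nu> \<longrightarrow>
        \<alpha> \<mu> \<nu> = (X \<mu> * d \<mu> - X \<nu> * d \<nu>) / ((X \<mu>)\<^sup>2 - (X \<nu>)\<^sup>2)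
                 - real \<epsilon> * (d \<mu> / X \<mu> + d \<nu> / X \<nu>) \<and>
        \<Omega> \<mu> \<nu> = (X \<mu> * d \<nu> - X \<nu> * d \<mu>) / ((X \<mu>)\<^sup>2 - (X \<nu>)\<^sup>2)) \<and>
     (\<forall>\<mu>\<in>{1..n}. \<alpha>\<epsilon> \<mu> = real \<epsilon> * (d \<mu> / X \<mu>)))"

text \<open>
  An index different from \<open>\<mu>\<close>, which lies in the range \<open>{1..n}\<close> as soon as \<open>n \<ge> 2\<close>.
\<close>

definition other :: "nat \<Rightarrow> nat" where
  "other \<mu> = (if \<mu> = 1 then 2 else 1)"

text \<open>
  The combination of the two formulas for \<open>\<alpha>\<close> and \<open>\<Omega>\<close> that eliminates the second parameter:
  \<open>x * (x * d - y * d') + y * (x * d' - y * d) = (x\<^sup>2 - y\<^sup>2) * d\<close>. It reads off \<open>d \<mu>\<close> linearly from the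
  coefficients, which gives uniqueness and serves as a coordinate on the solution space.
\<close>

definition parameter :: "nat \<Rightarrow> (nat \<Rightarrow> real) \<Rightarrow> coefficients \<Rightarrow> nat \<Rightarrow> real" where
  "parameter \<epsilon> X = (\<lambda>(\<Omega>, \<alpha>, \<alpha>\<epsilon>) \<mu>.
     X \<mu> * (\<alpha> \<mu> (other \<mu>) + real \<epsilon> * (\<alpha>\<epsilon> \<mu> + \<alpha>\<epsilon> (other \<mu>))) + X (other \<mu>) * \<Omega> \<mu> (other \<mu>))"

lemma other: "n \<ge> 2 \<Longrightarrow> \<mu> \<in> {1..n} \<Longrightarrow> other \<mu> \<in> {1..n} \<and> other \<mu> \<noteq> \<mu>"
  by (auto simp: other_def)

lemma parameter_solves:
  assumes "solves n \<epsilon> X w d" and n: "n \<ge> 2" and "\<epsilon> \<in> {0, 1}" and \<mu>: "\<mu> \<in> {1..n}"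
    and X: "inj_on (\<lambda>\<mu>. (X \<mu>)\<^sup>2) {1..n}"
  shows "parameter \<epsilon> X w \<mu> = d \<mu>"
proof -
  obtain \<Omega> \<alpha> \<alpha>\<epsilon> where w: "w = (\<Omega>, \<alpha>, \<alpha>\<epsilon>)" by (cases w) auto
  define \<nu> where "\<nu> = other \<mu>"
  have \<nu>: "\<nu> \<in> {1..n}" "\<nu> \<noteq> \<mu>" using other[OF n \<mu>] by (auto simp: \<nu>_def)
  let ?D = "(X \<mu>)\<^sup>2 - (X \<nu>)\<^sup>2"
  have D: "?D \<noteq> 0" using inj_onD[OF X, of \<mu> \<nu>] \<mu> \<nu> by auto
  have \<alpha>: "\<alpha> \<mu> \<nu> = (X \<mu> * d \<mu> - X \<nu> * d \<nu>) / ?D - real \<epsilon> * (d \<mu> / X \<mu> + d \<nu> / X \<nu>)"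
    and \<Omega>: "\<Omega> \<mu> \<nu> = (X \<mu> * d \<nu> - X \<nu> * d \<mu>) / ?D"
    and \<alpha>\<epsilon>: "\<alpha>\<epsilon> \<mu> = real \<epsilon> * (d \<mu> / X \<mu>)" "\<alpha>\<epsilon> \<nu> = real \<epsilon> * (d \<nu> / X \<nu>)"
    using assms(1) \<mu> \<nu> \<nu>(2)[symmetric] unfolding solves_def w prod.case by blast+
  have "\<alpha> \<mu> \<nu> + real \<epsilon> * (\<alpha>\<epsilon> \<mu> + \<alpha>\<epsilon> \<nu>) = (X \<mu> * d \<mu> - X \<nu> * d \<nu>) / ?D"
    using \<open>\<epsilon> \<in> {0, 1}\<close> unfolding \<alpha> \<alpha>\<epsilon> by auto
  then have "parameter \<epsilon> X w \<mu> = (X \<mu> * (X \<mu> * d \<mu> - X \<nu> * d \<nu>) + X \<nu> * (X \<mu> * d \<nu> - X \<nu> * d \<mu>)) / ?D"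
    unfolding parameter_def w prod.case \<nu>_def[symmetric] \<Omega> by (simp add: add_divide_distrib)
  also have "\<dots> = d \<mu> * ?D / ?D"
    by (simp add: power2_eq_square algebra_simps)
  finally show ?thesis using D by simp
qed

context point_coframe
begin

text \<open>
  The inverse of the triangular system \<open>sectional_zero_weight_tensor\<close>; outside the index range the
  coefficients have the default value 0 that \<open>coefficient_systems\<close> prescribes.
\<close>

definition coefficients_of :: "real^'d^'d^'d^'d \<Rightarrow> coefficients" where
  "coefficients_of R = (
     let A = (\<lambda>i j. Re (sectional (component R) i j));
         \<alpha>\<epsilon> = (\<lambda>\<mu>. if \<mu> \<in> {1..n} \<and> Hat0 \<in> J then - 16 * A (Plus \<mu>) Hat0 else 0)
     in (\<lambda>\<mu> \<nu>. if \<mu> \<in> {1..n} \<and> \<nu> \<in> {1..n}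
           then if \<mu> = \<nu> then 32 / 3 * A (Plus \<mu>) (Minus \<mu>) + 2 / 3 * (real \<epsilon> * \<alpha>\<epsilon> \<mu>)
                else 16 * (A (Plus \<mu>) (Minus \<nu>) - A (Plus \<mu>) (Plus \<nu>))
           else 0,
         \<lambda>\<mu> \<nu>. if \<mu> \<in> {1..n} \<and> \<nu> \<in> {1..n} \<and> \<mu> \<noteq> \<nu>
           then - 16 * (A (Plus \<mu>) (Plus \<nu>) + A (Plus \<mu>) (Minus \<nu>)) - real \<epsilon> * (\<alpha>\<epsilon> \<mu> + \<alpha>\<epsilon> \<nu>)
           else 0,
         \<alpha>\<epsilon>))"

lemma Hat0_mem: "Hat0 \<in> J \<longleftrightarrow> \<epsilon> = 1"
  by (auto simp: weight_indices_def)

lemma coefficients_of_mem: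
  assumes "R \<in> zero_weight_riemann"
  shows "coefficients_of R \<in> coefficient_systems n \<epsilon>"
proof -
  interpret zero_weight_components n \<epsilon> "component R" by (rule zero_weight_components[OF assms])
  have s: "sec (Plus b) (Plus a) = sec (Plus a) (Plus b)"
    "sec (Plus b) (Minus a) = sec (Plus a) (Minus b)" for a b
    using sec_sym[of "Plus b" "Plus a"] sec_sym[of "Minus a" "Plus b"] sec_bar[of "Plus a" "Minus b"]
    by simp_all
  show ?thesis
    unfolding coefficient_systems_def coefficients_of_def Let_def
    using Hat0_mem by (auto simp: s algebra_simps)
qed

lemma coefficients_of_zero_weight_tensor:
  assumes "w \<in> coefficient_systems n \<epsilon>"
  shows "coefficients_of (zero_weight_tensor G n \<epsilon> E Eh w) = w"
proof -
  obtain \<Omega> \<alpha> \<alpha>\<epsilon> where w: "w = (\<Omega>, \<alpha>, \<alpha>\<epsilon>)" by (cases w) auto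
  have c: "\<Omega> \<mu> \<nu> = \<Omega> \<nu> \<mu>" "\<alpha> \<mu> \<nu> = \<alpha> \<nu> \<mu>" "\<alpha> \<mu> \<mu> = 0"
    "\<mu> \<notin> {1..n} \<Longrightarrow> \<Omega> \<mu> \<nu> = 0" "\<mu> \<notin> {1..n} \<Longrightarrow> \<alpha> \<mu> \<nu> = 0" "\<mu> \<notin> {1..n} \<Longrightarrow> \<alpha>\<epsilon> \<mu> = 0"
    "\<epsilon> = 0 \<Longrightarrow> \<alpha>\<epsilon> \<mu> = 0" for \<mu> \<nu>
    using assms unfolding w coefficient_systems_def by blast+
  have c': "\<nu> \<notin> {1..n} \<Longrightarrow> \<Omega> \<mu> \<nu> = 0" "\<nu> \<notin> {1..n} \<Longrightarrow> \<alpha> \<mu> \<nu> = 0" for \<mu> \<nu>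
    using c(1)[of \<mu> \<nu>] c(2)[of \<mu> \<nu>] c(4)[of \<nu> \<mu>] c(5)[of \<nu> \<mu>] by simp_all
  note S = sectional_zero_weight_tensor[OF assms[unfolded w]]
  have \<epsilon>: "real \<epsilon> * \<alpha>\<epsilon> \<mu> = \<alpha>\<epsilon> \<mu>" "Hat0 \<notin> J \<Longrightarrow> \<alpha>\<epsilon> \<mu> = 0" for \<mu>
    using eps c(7)[of \<mu>] by (auto simp: Hat0_mem)
  show ?thesis
    unfolding w coefficients_of_def Let_def prod.inject
  proof (intro conjI ext)
    show \<alpha>\<epsilon>: "(if \<mu> \<in> {1..n} \<and> Hat0 \<in> J then - 16 * Re (sectional
        (component (zero_weight_tensor G n \<epsilon> E Eh (\<Omega>, \<alpha>, \<alpha>\<epsilon>))) (Plus \<mu>) Hat0) else 0) = \<alpha>\<epsilon> \<mu>" for \<mu>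
      using \<epsilon> c(6) by (auto simp: S(4) simp del: atLeastAtMost_iff)
    show "(if \<mu> \<in> {1..n} \<and> \<nu> \<in> {1..n}
           then if \<mu> = \<nu> then 32 / 3 * Re (sectional (component (zero_weight_tensor G n \<epsilon> E Eh (\<Omega>, \<alpha>, \<alpha>\<epsilon>))) (Plus \<mu>) (Minus \<mu>))
               + 2 / 3 * (real \<epsilon> * (if \<mu> \<in> {1..n} \<and> Hat0 \<in> J then - 16 * Re (sectional
        (component (zero_weight_tensor G n \<epsilon> E Eh (\<Omega>, \<alpha>, \<alpha>\<epsilon>))) (Plus \<mu>) Hat0) else 0))
                else 16 * (Re (sectional (component (zero_weight_tensor G n \<epsilon> E Eh (\<Omega>, \<alpha>, \<alpha>\<epsilon>))) (Plus \<mu>) (Minus \<nu>))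
                  - Re (sectional (component (zero_weight_tensor G n \<epsilon> E Eh (\<Omega>, \<alpha>, \<alpha>\<epsilon>))) (Plus \<mu>) (Plus \<nu>)))
           else 0) = \<Omega> \<mu> \<nu>" for \<mu> \<nu>
      unfolding \<alpha>\<epsilon> \<epsilon>(1) using c(4)[of \<mu> \<nu>] c'(1)[of \<nu> \<mu>]
      by (auto simp: S \<epsilon>(1) field_simps simp del: atLeastAtMost_iff)
    show "(if \<mu> \<in> {1..n} \<and> \<nu> \<in> {1..n} \<and> \<mu> \<noteq> \<nu>
           then - 16 * (Re (sectional (component (zero_weight_tensor G n \<epsilon> E Eh (\<Omega>, \<alpha>, \<alpha>\<epsilon>))) (Plus \<mu>) (Plus \<nu>))
               + Re (sectional (component (zero_weight_tensor G n \<epsilon> E Eh (\<Omega>, \<alpha>, \<alpha>\<epsilon>))) (Plus \<mu>) (Minus \<nu>)))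
             - real \<epsilon> * ((if \<mu> \<in> {1..n} \<and> Hat0 \<in> J then - 16 * Re (sectional
        (component (zero_weight_tensor G n \<epsilon> E Eh (\<Omega>, \<alpha>, \<alpha>\<epsilon>))) (Plus \<mu>) Hat0) else 0) +
           (if \<nu> \<in> {1..n} \<and> Hat0 \<in> J then - 16 * Re (sectional
        (component (zero_weight_tensor G n \<epsilon> E Eh (\<Omega>, \<alpha>, \<alpha>\<epsilon>))) (Plus \<nu>) Hat0) else 0))
           else 0) = \<alpha> \<mu> \<nu>" for \<mu> \<nu>
      unfolding \<alpha>\<epsilon> using c(3)[of \<mu>] c(5)[of \<mu> \<nu>] c'(2)[of \<nu> \<mu>]
      by (auto simp: S field_simps simp del: atLeastAtMost_iff)
  qed
qed

lemma zero_weight_tensor_coefficients_of: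
  assumes "R \<in> zero_weight_riemann"
  shows "zero_weight_tensor G n \<epsilon> E Eh (coefficients_of R) = R"
proof -
  obtain \<Omega> \<alpha> \<alpha>\<epsilon> where w: "coefficients_of R = (\<Omega>, \<alpha>, \<alpha>\<epsilon>)" by (cases "coefficients_of R") auto
  have mem: "(\<Omega>, \<alpha>, \<alpha>\<epsilon>) \<in> coefficient_systems n \<epsilon>"
    using coefficients_of_mem[OF assms] w by simp
  define A where "A i j = Re (sectional (component R) i j)" for i j
  have A: "sectional (component R) i j = complex_of_real (A i j)" for i j
    using sectional_real[OF assms] by (simp add: A_def)
  have c1: "\<alpha>\<epsilon> = (\<lambda>\<mu>. if \<mu> \<in> {1..n} \<and> Hat0 \<in> J then - 16 * A (Plus \<mu>) Hat0 else 0)"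
    using arg_cong[OF w, of "\<lambda>w. snd (snd w)"]
    unfolding coefficients_of_def Let_def A_def[symmetric] snd_conv by (rule sym)
  have c2: "\<Omega> = (\<lambda>\<mu> \<nu>. if \<mu> \<in> {1..n} \<and> \<nu> \<in> {1..n}
           then if \<mu> = \<nu> then 32 / 3 * A (Plus \<mu>) (Minus \<mu>) + 2 / 3 * (real \<epsilon> * \<alpha>\<epsilon> \<mu>)
                else 16 * (A (Plus \<mu>) (Minus \<nu>) - A (Plus \<mu>) (Plus \<nu>))
           else 0)"
    using arg_cong[OF w, of fst]
    unfolding coefficients_of_def Let_def A_def[symmetric] fst_conv c1 by (rule sym)
  have c3: "\<alpha> = (\<lambda>\<mu> \<nu>. if \<mu> \<in> {1..n} \<and> \<nu> \<in> {1..n} \<and> \<mu> \<noteq> \<nu>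
           then - 16 * (A (Plus \<mu>) (Plus \<nu>) + A (Plus \<mu>) (Minus \<nu>)) - real \<epsilon> * (\<alpha>\<epsilon> \<mu> + \<alpha>\<epsilon> \<nu>)
           else 0)"
    using arg_cong[OF w, of "\<lambda>w. fst (snd w)"]
    unfolding coefficients_of_def Let_def A_def[symmetric] fst_conv snd_conv c1 by (rule sym)
  have \<Omega>: "\<Omega> a b = 16 * (A (Plus a) (Minus b) - A (Plus a) (Plus b))"
    and \<alpha>: "\<alpha> a b = - 16 * (A (Plus a) (Plus b) + A (Plus a) (Minus b)) - real \<epsilon> * (\<alpha>\<epsilon> a + \<alpha>\<epsilon> b)"
    if "a \<in> {1..n}" "b \<in> {1..n}" "a \<noteq> b" for a b
    using that unfolding c2 c3 by simp_all
  have \<Omega>': "\<Omega> a a = 32 / 3 * A (Plus a) (Minus a) + 2 / 3 * (real \<epsilon> * \<alpha>\<epsilon> a)" if "a \<in> {1..n}" for a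
    using that unfolding c2 by simp
  have \<alpha>\<epsilon>: "\<alpha>\<epsilon> a = - 16 * A (Plus a) Hat0" if "a \<in> {1..n}" "Hat0 \<in> J" for a
    using that unfolding c1 by simp
  note S = sectional_zero_weight_tensor[OF mem]
  show ?thesis
    unfolding w
  proof (rule zero_weight_riemann_eqI[OF zero_weight_tensor_mem assms])
    fix i j assume "i \<in> J" "j \<in> J" "i \<noteq> j"
    then show "sectional (component (zero_weight_tensor G n \<epsilon> E Eh (\<Omega>, \<alpha>, \<alpha>\<epsilon>))) i j =
        sectional (component R) i j"
    proof (rule sectional_eqI[OF zero_weight_components[OF zero_weight_tensor_mem] zero_weight_components[OF assms], rotated -3])
      fix a b assume ab: "a \<in> {1..n}" "b \<in> {1..n}" "a \<noteq> b"
      show "sectional (component (zero_weight_tensor G n \<epsilon> E Eh (\<Omega>, \<alpha>, \<alpha>\<epsilon>))) (Plus a) (Plus b) =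
          sectional (component R) (Plus a) (Plus b)"
        unfolding S(1)[OF ab] A \<Omega>[OF ab] \<alpha>[OF ab] of_real_minus[symmetric] by (rule arg_cong[of _ _ complex_of_real]) simp
      show "sectional (component (zero_weight_tensor G n \<epsilon> E Eh (\<Omega>, \<alpha>, \<alpha>\<epsilon>))) (Plus a) (Minus b) =
          sectional (component R) (Plus a) (Minus b)"
        unfolding S(2)[OF ab] A \<Omega>[OF ab] \<alpha>[OF ab] by (rule arg_cong[of _ _ complex_of_real]) simp
    next
      fix a assume a: "a \<in> {1..n}"
      show "sectional (component (zero_weight_tensor G n \<epsilon> E Eh (\<Omega>, \<alpha>, \<alpha>\<epsilon>))) (Plus a) (Minus a) =
          sectional (component R) (Plus a) (Minus a)"
        unfolding S(3)[OF a] A \<Omega>'[OF a] by (rule arg_cong[of _ _ complex_of_real]) (simp add: field_simps)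
    next
      fix a assume a: "a \<in> {1..n}" "Hat0 \<in> J"
      show "sectional (component (zero_weight_tensor G n \<epsilon> E Eh (\<Omega>, \<alpha>, \<alpha>\<epsilon>))) (Plus a) Hat0 =
          sectional (component R) (Plus a) Hat0"
        unfolding S(4)[OF a] A \<alpha>\<epsilon>[OF a] of_real_minus[symmetric]
        using a(2) by (intro arg_cong[of _ _ complex_of_real]) (simp add: Hat0_mem)
    qed
  qed
qed

lemma bij_betw_zero_weight_tensor:
  "bij_betw (zero_weight_tensor G n \<epsilon> E Eh) (coefficient_systems n \<epsilon>) zero_weight_riemann"
  by (rule bij_betw_byWitness[where f' = coefficients_of])
    (auto simp: coefficients_of_zero_weight_tensor zero_weight_tensor_coefficients_of
      zero_weight_tensor_mem coefficients_of_mem)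

end

section \<open>The general solution and the rank\<close>

lemma linear_integrability: "linear (integrability G h)"
proof -
  have asym: "asym (\<lambda>a b. F a b + F' a b) a b = asym F a b + asym F' a b"
    "asym (\<lambda>a b. s * F a b) a b = s * asym F a b" for F F' :: "'a \<Rightarrow> 'a \<Rightarrow> real" and s a b
    by (simp_all add: asym_def field_simps)
  show ?thesis
  proof (rule linearI)
    fix R S :: "real^'a^'a^'a^'a"
    have "riem_up2 G (R + S) = (\<lambda>a b c d. riem_up2 G R a b c d + riem_up2 G S a b c d)"
      "riem_up3 G (R + S) = (\<lambda>a b c d. riem_up3 G R a b c d + riem_up3 G S a b c d)"
      by (simp_all add: fun_eq_iff riem_up2_def riem_up3_def distrib_left sum.distrib)
    moreover have ric: "ricci G (R + S) = (\<lambda>a b. ricci G R a b + ricci G S a b)"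
      by (simp add: fun_eq_iff ricci_def distrib_left sum.distrib)
    moreover have "ricci_up G (R + S) = (\<lambda>a b. ricci_up G R a b + ricci_up G S a b)"
      by (simp add: fun_eq_iff ricci_up_def ric distrib_left sum.distrib)
    ultimately show "integrability G h (R + S) = integrability G h R + integrability G h S"
      by (simp add: vec_eq_iff integrability_def distrib_left distrib_right sum.distrib asym)
  next
    fix s :: real and R :: "real^'a^'a^'a^'a"
    have "riem_up2 G (s *\<^sub>R R) = (\<lambda>a b c d. s * riem_up2 G R a b c d)"
      "riem_up3 G (s *\<^sub>R R) = (\<lambda>a b c d. s * riem_up3 G R a b c d)"
      by (simp_all add: fun_eq_iff riem_up2_def riem_up3_def sum_distrib_left ac_simps)
    moreover have ric: "ricci G (s *\<^sub>R R) = (\<lambda>a b. s * ricci G R a b)"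
      by (simp add: fun_eq_iff ricci_def sum_distrib_left ac_simps)
    moreover have "ricci_up G (s *\<^sub>R R) = (\<lambda>a b. s * ricci_up G R a b)"
      by (simp add: fun_eq_iff ricci_up_def ric sum_distrib_left ac_simps)
    ultimately show "integrability G h (s *\<^sub>R R) = s *\<^sub>R integrability G h R"
      by (simp add: vec_eq_iff integrability_def mult.assoc mult.left_commute[of _ s]
          sum_distrib_left[symmetric] asym right_diff_distrib)
  qed
qed

lemma card_hat_indices: "\<epsilon> \<in> {0, 1} \<Longrightarrow> card (hat_indices n \<epsilon>) = n + \<epsilon>"
  by (auto simp: hat_indices_def)

lemma positive_definite_invertible:
  fixes G :: "real^'d^'d"
  assumes "\<And>v. v \<noteq> 0 \<Longrightarrow> v \<bullet> (G *v v) > 0"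
  shows "invertible G"
proof -
  have "\<forall>v. G *v v = 0 \<longrightarrow> v = 0" using assms by (metis inner_zero_right less_irrefl)
  then show ?thesis by (simp add: invertible_left_inverse matrix_left_invertible_ker)
qed

context point_coframe
begin

context
  fixes X :: "nat \<Rightarrow> real"
  assumes n: "n \<ge> 2"
    and X_inj: "inj_on (\<lambda>\<mu>. (X \<mu>)\<^sup>2) {1..n}"
    and X_nonzero: "\<And>\<mu>. \<mu> \<in> {1..n} \<Longrightarrow> X \<mu> \<noteq> 0"
begin

lemma X_squares: "\<lbrakk>a \<in> {1..n}; b \<in> {1..n}; a \<noteq> b\<rbrakk> \<Longrightarrow> (X a)\<^sup>2 \<noteq> (X b)\<^sup>2"
  using inj_onD[OF X_inj, of a b] by auto

text \<open>
  The fluxes at \<open>(Plus a, Plus b)\<close>, \<open>(Plus a, Minus b)\<close> and \<open>(Plus a, Hat0)\<close> are \<open>\<i> / 8\<close> times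
  \<open>(X a + X b) * (\<beta> a b + \<Omega> a b)\<close>, \<open>(X a - X b) * (\<beta> a b - \<Omega> a b)\<close> and \<open>X a * \<alpha>\<epsilon> a\<close>, where
  \<open>\<beta>\<close> is \<open>\<alpha>\<close> corrected by \<open>\<alpha>\<epsilon>\<close>. With \<open>\<delta> (Plus a) = \<i> / 8 * d a\<close> the flux equation becomes the crossed
  system for \<open>\<beta>\<close> and \<open>\<Omega>\<close>, and \<open>X a * \<alpha>\<epsilon> a = d a\<close>.
\<close>

lemma integrability_zero_weight_tensor_iff:
  assumes w: "w \<in> coefficient_systems n \<epsilon>"
  shows "integrability G (skew_form n X E Eh) (zero_weight_tensor G n \<epsilon> E Eh w) = 0 \<longleftrightarrow>
    (\<exists>d. solves n \<epsilon> X w d)"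
proof -
  obtain \<Omega> \<alpha> \<alpha>\<epsilon> where w_eq: "w = (\<Omega>, \<alpha>, \<alpha>\<epsilon>)" by (cases w) auto
  let ?R = "zero_weight_tensor G n \<epsilon> E Eh w"
  let ?lam = "skew_eigenvalue X"
  interpret zero_weight_components n \<epsilon> "component ?R"
    by (rule zero_weight_components[OF zero_weight_tensor_mem])
  define \<beta> where "\<beta> a b = \<alpha> a b + real \<epsilon> * (\<alpha>\<epsilon> a + \<alpha>\<epsilon> b)" for a b
  have \<alpha>\<epsilon>0: "\<epsilon> = 0 \<Longrightarrow> \<alpha>\<epsilon> a = 0" for a
    using w unfolding w_eq coefficient_systems_def by blast
  note S = sectional_zero_weight_tensor[OF w[unfolded w_eq], folded w_eq]
  have pp: "flux ?lam (Plus a) (Plus b) = \<i> / 8 * complex_of_real ((X a + X b) * (\<Omega> a b + \<beta> a b))"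
    if "a \<in> {1..n}" "b \<in> {1..n}" "a \<noteq> b" for a b
    unfolding flux_def S(1)[OF that] \<beta>_def
    by (simp add: frame_scale_def skew_eigenvalue_def algebra_simps add_divide_distrib diff_divide_distrib)
  have pm: "flux ?lam (Plus a) (Minus b) = \<i> / 8 * complex_of_real ((X a - X b) * (\<beta> a b - \<Omega> a b))"
    if "a \<in> {1..n}" "b \<in> {1..n}" "a \<noteq> b" for a b
    unfolding flux_def S(2)[OF that] \<beta>_def
    by (simp add: frame_scale_def skew_eigenvalue_def algebra_simps add_divide_distrib diff_divide_distrib)
  have p0: "flux ?lam (Plus a) Hat0 = \<i> / 8 * complex_of_real (X a * (real \<epsilon> * \<alpha>\<epsilon> a))"
    if "a \<in> {1..n}" "Hat0 \<in> J" for a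
    unfolding flux_def S(4)[OF that]
    by (simp add: frame_scale_def skew_eigenvalue_def)
  have Im8: "Im (\<i> / 8 * complex_of_real u) = u / 8" for u by simp
  have "card J > 2" using card_weight_indices[OF eps, of n] n by simp
  then have "integrability G (skew_form n X E Eh) ?R = 0 \<longleftrightarrow>
     (\<exists>\<delta>. (\<forall>i. \<delta> (bar i) = - \<delta> i) \<and>
     (\<forall>i\<in>J. \<forall>j\<in>J. j \<noteq> i \<and> j \<noteq> bar i \<longrightarrow> flux ?lam i j = \<delta> i + \<delta> j))"
    unfolding integrability_eq_0_iff integrability_component_iff[of ?lam, OF skew_eigenvalue_bar]
    by (rule flux_equation_iff[of ?lam, OF skew_eigenvalue_bar])
  also have "\<dots> \<longleftrightarrow> (\<exists>d. solves n \<epsilon> X w d)"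
  proof
    assume "\<exists>\<delta>. (\<forall>i. \<delta> (bar i) = - \<delta> i) \<and>
     (\<forall>i\<in>J. \<forall>j\<in>J. j \<noteq> i \<and> j \<noteq> bar i \<longrightarrow> flux ?lam i j = \<delta> i + \<delta> j)"
    then obtain \<delta> where odd: "\<And>i. \<delta> (bar i) = - \<delta> i"
      and \<delta>: "\<And>i j. \<lbrakk>i \<in> J; j \<in> J; j \<noteq> i; j \<noteq> bar i\<rbrakk> \<Longrightarrow> flux ?lam i j = \<delta> i + \<delta> j"
      by blast
    \<comment> \<open>The fluxes are imaginary, so only the imaginary part of \<open>\<delta>\<close> matters; it should be \<open>d \<mu> / 8\<close>.\<close>
    define d where "d \<mu> = (if \<mu> \<in> {1..n} then 8 * Im (\<delta> (Plus \<mu>)) else 0)" for \<mu>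
    have d: "8 * Im (\<delta> (Plus a)) = d a" if "a \<in> {1..n}" for a using that by (simp only: d_def if_True)
    have \<delta>0: "\<delta> Hat0 = 0" using odd[of Hat0] by simp
    have \<delta>m: "\<delta> (Minus a) = - \<delta> (Plus a)" for a using odd[of "Plus a"] by simp
    have off: "\<beta> a b = (X a * d a - X b * d b) / ((X a)\<^sup>2 - (X b)\<^sup>2) \<and>
        \<Omega> a b = (X a * d b - X b * d a) / ((X a)\<^sup>2 - (X b)\<^sup>2)"
      if ab: "a \<in> {1..n}" "b \<in> {1..n}" "a \<noteq> b" for a b
    proof -
      have "\<i> / 8 * complex_of_real ((X a + X b) * (\<Omega> a b + \<beta> a b)) = \<delta> (Plus a) + \<delta> (Plus b)"
        using \<delta>[of "Plus a" "Plus b"] pp[OF ab] indices_mem ab by simp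
      from arg_cong[OF this, of Im] have 1: "(X a + X b) * (\<Omega> a b + \<beta> a b) = d a + d b"
        unfolding Im8 d[OF ab(1), symmetric] d[OF ab(2), symmetric] by simp
      have "\<i> / 8 * complex_of_real ((X a - X b) * (\<beta> a b - \<Omega> a b)) = \<delta> (Plus a) + \<delta> (Minus b)"
        using \<delta>[of "Plus a" "Minus b"] pm[OF ab] indices_mem ab by simp
      from arg_cong[OF this, of Im] have 2: "(X a - X b) * (\<beta> a b - \<Omega> a b) = d a - d b"
        unfolding Im8 d[OF ab(1), symmetric] d[OF ab(2), symmetric] \<delta>m by simp
      show ?thesis using crossed_system_iff[OF X_squares[OF ab]] 1 2 by blast
    qed
    have hat: "\<alpha>\<epsilon> a = real \<epsilon> * (d a / X a)" if a: "a \<in> {1..n}" for a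
    proof (cases "\<epsilon> = 0")
      case False
      then have \<epsilon>: "\<epsilon> = 1" using eps by simp
      then have H: "Hat0 \<in> J" using Hat0_mem by blast
      have "\<i> / 8 * complex_of_real (X a * (real \<epsilon> * \<alpha>\<epsilon> a)) = \<delta> (Plus a)"
        using \<delta>[of "Plus a" Hat0] p0[OF a H] indices_mem(1)[OF a] H by (simp add: \<delta>0)
      from arg_cong[OF this, of Im] have "X a * (real \<epsilon> * \<alpha>\<epsilon> a) = d a"
        unfolding Im8 d[OF a, symmetric] by simp
      then show ?thesis using X_nonzero[OF a] \<epsilon> by (simp add: field_simps)
    qed (simp add: \<alpha>\<epsilon>0)
    have "solves n \<epsilon> X w d"
      unfolding solves_def w_eq prod.case
    proof (intro conjI allI ballI impI)
      show "d \<mu> = 0" if "\<mu> \<notin> {1..n}" for \<mu> using that by (simp only: d_def if_False)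
      show "\<alpha>\<epsilon> \<mu> = real \<epsilon> * (d \<mu> / X \<mu>)" if "\<mu> \<in> {1..n}" for \<mu> by (rule hat[OF that])
      fix \<mu> \<nu> assume \<mu>\<nu>: "\<mu> \<in> {1..n}" "\<nu> \<in> {1..n}" "\<mu> \<noteq> \<nu>"
      show "\<Omega> \<mu> \<nu> = (X \<mu> * d \<nu> - X \<nu> * d \<mu>) / ((X \<mu>)\<^sup>2 - (X \<nu>)\<^sup>2)"
        using off[OF \<mu>\<nu>] by blast
      have "real \<epsilon> * (\<alpha>\<epsilon> \<mu> + \<alpha>\<epsilon> \<nu>) = real \<epsilon> * (d \<mu> / X \<mu> + d \<nu> / X \<nu>)"
        unfolding hat[OF \<mu>\<nu>(1)] hat[OF \<mu>\<nu>(2)] using eps by auto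
      then show "\<alpha> \<mu> \<nu> = (X \<mu> * d \<mu> - X \<nu> * d \<nu>) / ((X \<mu>)\<^sup>2 - (X \<nu>)\<^sup>2)
          - real \<epsilon> * (d \<mu> / X \<mu> + d \<nu> / X \<nu>)"
        using off[OF \<mu>\<nu>, THEN conjunct1] unfolding \<beta>_def by (simp only: eq_diff_eq)
    qed
    then show "\<exists>d. solves n \<epsilon> X w d" by blast
  next
    assume "\<exists>d. solves n \<epsilon> X w d"
    then obtain d where d: "solves n \<epsilon> X w d" by blast
    have hat: "\<alpha>\<epsilon> a = real \<epsilon> * (d a / X a)" if "a \<in> {1..n}" for a
      using d that unfolding solves_def w_eq prod.case by blast
    have sys: "(X a + X b) * (\<Omega> a b + \<beta> a b) = d a + d b \<and> (X a - X b) * (\<beta> a b - \<Omega> a b) = d a - d b"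
      if ab: "a \<in> {1..n}" "b \<in> {1..n}" "a \<noteq> b" for a b
    proof -
      have \<alpha>: "\<alpha> a b = (X a * d a - X b * d b) / ((X a)\<^sup>2 - (X b)\<^sup>2) - real \<epsilon> * (d a / X a + d b / X b)"
        and \<Omega>: "\<Omega> a b = (X a * d b - X b * d a) / ((X a)\<^sup>2 - (X b)\<^sup>2)"
        using d ab unfolding solves_def w_eq prod.case by blast+
      have "real \<epsilon> * (\<alpha>\<epsilon> a + \<alpha>\<epsilon> b) = real \<epsilon> * (d a / X a + d b / X b)"
        unfolding hat[OF ab(1)] hat[OF ab(2)] using eps by auto
      then have "\<beta> a b = (X a * d a - X b * d b) / ((X a)\<^sup>2 - (X b)\<^sup>2)"
        unfolding \<beta>_def \<alpha> by simp
      then show ?thesis using crossed_system_iff[OF X_squares[OF ab]] \<Omega> by blast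
    qed
    define \<delta> where "\<delta> i = (case i of Plus \<mu> \<Rightarrow> \<i> / 8 * complex_of_real (d \<mu>)
      | Minus \<mu> \<Rightarrow> - (\<i> / 8 * complex_of_real (d \<mu>)) | Hat0 \<Rightarrow> 0)" for i
    have odd: "\<delta> (bar i) = - \<delta> i" for i by (cases i) (simp_all add: \<delta>_def)
    have flux: "j \<noteq> bar i \<longrightarrow> flux ?lam i j = \<delta> i + \<delta> j" if "i \<in> J" "j \<in> J" "i \<noteq> j" for i j
      using that
    proof (induction rule: weight_index_pair_cases)
      case (sym i j)
      have "flux ?lam j i = flux ?lam i j"
        unfolding flux_def using sec_sym[of i j] by (simp add: ac_simps)
      then show ?case using sym by (auto simp: add.commute)
    next
      case (bar i j)
      then show ?case
        using flux_odd[of ?lam i j, OF skew_eigenvalue_bar] by (auto simp: odd)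
    next
      case (plus_plus a b)
      show ?case
        unfolding pp[OF plus_plus] sys[OF plus_plus, THEN conjunct1] by (simp add: \<delta>_def algebra_simps)
    next
      case (plus_minus a b)
      show ?case
        unfolding pm[OF plus_minus] sys[OF plus_minus, THEN conjunct2]
        by (simp add: \<delta>_def right_diff_distrib diff_divide_distrib)
    next
      case (plane a)
      show ?case by simp
    next
      case (axis a)
      then have "real \<epsilon> = 1" by (simp add: Hat0_mem)
      then have "X a * (real \<epsilon> * \<alpha>\<epsilon> a) = d a"
        unfolding hat[OF axis(1)] using X_nonzero[OF axis(1)] by simp
      then show ?case unfolding p0[OF axis] by (simp add: \<delta>_def)
    qed
    then show "\<exists>\<delta>. (\<forall>i. \<delta> (bar i) = - \<delta> i) \<and>
     (\<forall>i\<in>J. \<forall>j\<in>J. j \<noteq> i \<and> j \<noteq> bar i \<longrightarrow> flux ?lam i j = \<delta> i + \<delta> j)"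
      using odd by blast
  qed
  finally show ?thesis .
qed

lemma coefficients_of_linear:
  fixes R S :: "real^'d^'d^'d^'d" and s :: real
  shows "fst (coefficients_of (R + S)) \<mu> \<nu> = fst (coefficients_of R) \<mu> \<nu> + fst (coefficients_of S) \<mu> \<nu>"
    and "fst (coefficients_of (s *\<^sub>R R)) \<mu> \<nu> = s * fst (coefficients_of R) \<mu> \<nu>"
    and "fst (snd (coefficients_of (R + S))) \<mu> \<nu> =
      fst (snd (coefficients_of R)) \<mu> \<nu> + fst (snd (coefficients_of S)) \<mu> \<nu>"
    and "fst (snd (coefficients_of (s *\<^sub>R R))) \<mu> \<nu> = s * fst (snd (coefficients_of R)) \<mu> \<nu>"
    and "snd (snd (coefficients_of (R + S))) \<mu> = snd (snd (coefficients_of R)) \<mu> + snd (snd (coefficients_of S)) \<mu>"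
    and "snd (snd (coefficients_of (s *\<^sub>R R))) \<mu> = s * snd (snd (coefficients_of R)) \<mu>"
  by (cases "\<mu> \<in> {1..n}"; cases "\<nu> \<in> {1..n}"; cases "Hat0 \<in> J"; cases "\<mu> = \<nu>";
      simp add: coefficients_of_def Let_def sectional_def component_linear algebra_simps
        del: atLeastAtMost_iff)+

lemma coefficients_of_0: "coefficients_of 0 = (\<lambda>\<mu> \<nu>. 0, \<lambda>\<mu> \<nu>. 0, \<lambda>\<mu>. 0)"
  by (simp add: coefficients_of_def Let_def sectional_def component_linear fun_eq_iff)

lemma zero_weight_riemann_eq_0I:
  assumes R: "R \<in> zero_weight_riemann"
    and zero: "coefficients_of R = (\<lambda>\<mu> \<nu>. 0, \<lambda>\<mu> \<nu>. 0, \<lambda>\<mu>. 0)"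
  shows "R = 0"
proof -
  have "R = zero_weight_tensor G n \<epsilon> E Eh (coefficients_of 0)"
    using zero_weight_tensor_coefficients_of[OF R] by (simp add: zero coefficients_of_0)
  also have "\<dots> = 0"
    by (intro zero_weight_tensor_coefficients_of subspace_0 subspace_zero_weight_riemann)
  finally show ?thesis .
qed

text \<open>
  The independent coefficients are arranged in the rectangle \<open>hat_indices n \<epsilon> \<times> {1..n}\<close>: the weakly
  upper triangle holds \<open>\<Omega>\<close>, the strictly lower one \<open>\<alpha>\<close>, and the row 0, which is present for \<open>\<epsilon> = 1\<close>,
  holds \<open>\<alpha>\<epsilon>\<close>.
\<close>

lemma dim_zero_weight_riemann: "dim zero_weight_riemann = (n + \<epsilon>) * n"
proof -
  define \<phi> where "\<phi> = (\<lambda>(\<mu>, \<nu>) R. if \<mu> = 0 then snd (snd (coefficients_of R)) \<nu>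
     else if \<mu> \<le> \<nu> then fst (coefficients_of R) \<mu> \<nu> else fst (snd (coefficients_of R)) \<mu> (\<nu> :: nat))"
  let ?K = "hat_indices n \<epsilon> \<times> {1..n}"
  have "dim zero_weight_riemann = card ?K"
  proof (rule dim_eq_card_coordinates[where \<phi> = \<phi>])
    show "finite ?K" by (simp add: hat_indices_def)
    show "linear (\<phi> k)" for k
      by (cases k) (simp add: linear_iff \<phi>_def coefficients_of_linear)
    show "R = 0" if R: "R \<in> zero_weight_riemann" and zero: "\<And>k. k \<in> ?K \<Longrightarrow> \<phi> k R = 0" for R
    proof (rule zero_weight_riemann_eq_0I[OF R])
      obtain \<Omega> \<alpha> \<alpha>\<epsilon> where c: "coefficients_of R = (\<Omega>, \<alpha>, \<alpha>\<epsilon>)" by (cases "coefficients_of R") auto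
      have mem: "(\<Omega>, \<alpha>, \<alpha>\<epsilon>) \<in> coefficient_systems n \<epsilon>" using coefficients_of_mem[OF R] c by simp
      then have sym: "\<Omega> \<mu> \<nu> = \<Omega> \<nu> \<mu>" "\<alpha> \<mu> \<nu> = \<alpha> \<nu> \<mu>" "\<alpha> \<mu> \<mu> = 0" "\<epsilon> = 0 \<Longrightarrow> \<alpha>\<epsilon> \<mu> = 0"
        and out: "\<mu> \<notin> {1..n} \<Longrightarrow> \<Omega> \<mu> \<nu> = 0 \<and> \<alpha> \<mu> \<nu> = 0 \<and> \<alpha>\<epsilon> \<mu> = 0" for \<mu> \<nu>
        unfolding coefficient_systems_def by blast+
      have \<Omega>: "\<Omega> \<mu> \<nu> = 0" if "\<mu> \<in> {1..n}" "\<nu> \<in> {1..n}" "\<mu> \<le> \<nu>" for \<mu> \<nu>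
        using zero[of "(\<mu>, \<nu>)"] that by (simp add: \<phi>_def c hat_indices_def)
      have \<alpha>: "\<alpha> \<mu> \<nu> = 0" if "\<mu> \<in> {1..n}" "\<nu> \<in> {1..n}" "\<nu> < \<mu>" for \<mu> \<nu>
        using zero[of "(\<mu>, \<nu>)"] that by (simp add: \<phi>_def c hat_indices_def)
      have \<alpha>\<epsilon>: "\<alpha>\<epsilon> \<nu> = 0" for \<nu>
      proof (cases "\<nu> \<in> {1..n} \<and> \<epsilon> = 1")
        case True
        then have "(0, \<nu>) \<in> ?K" by (simp add: hat_indices_def)
        from zero[OF this] show ?thesis by (simp add: \<phi>_def c)
      qed (use out sym(4) eps in blast)
      have "\<Omega> \<mu> \<nu> = 0 \<and> \<alpha> \<mu> \<nu> = 0" for \<mu> \<nu>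
      proof (cases "\<mu> \<in> {1..n} \<and> \<nu> \<in> {1..n}")
        case True
        then consider "\<mu> < \<nu>" | "\<nu> < \<mu>" | "\<mu> = \<nu>" by linarith
        then show ?thesis
        proof cases
          case 1
          then show ?thesis using True \<Omega>[of \<mu> \<nu>] \<alpha>[of \<nu> \<mu>] sym(2)[of \<mu> \<nu>] by simp
        next
          case 2
          then show ?thesis using True \<Omega>[of \<nu> \<mu>] \<alpha>[of \<mu> \<nu>] sym(1)[of \<mu> \<nu>] by simp
        next
          case 3
          then show ?thesis using True \<Omega>[of \<mu> \<mu>] sym(3)[of \<mu>] by simp
        qed
      next
        case False
        then show ?thesis using out[of \<mu> \<nu>] out[of \<nu> \<mu>] sym(1,2)[of \<mu> \<nu>] by auto
      qed
      then show "coefficients_of R = (\<lambda>\<mu> \<nu>. 0, \<lambda>\<mu> \<nu>. 0, \<lambda>\<mu>. 0)"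
        by (simp add: c fun_eq_iff \<alpha>\<epsilon>)
    qed
    show "\<exists>R\<in>zero_weight_riemann. \<forall>k\<in>?K. \<phi> k R = t k" for t
    proof -
      define w :: coefficients where "w =
        (\<lambda>\<mu> \<nu>. if \<mu> \<in> {1..n} \<and> \<nu> \<in> {1..n} then t (min \<mu> \<nu>, max \<mu> \<nu>) else 0,
         \<lambda>\<mu> \<nu>. if \<mu> \<in> {1..n} \<and> \<nu> \<in> {1..n} \<and> \<mu> \<noteq> \<nu> then t (max \<mu> \<nu>, min \<mu> \<nu>) else 0,
         \<lambda>\<mu>. if \<mu> \<in> {1..n} \<and> \<epsilon> = 1 then t (0, \<mu>) else 0)"
      have "w \<in> coefficient_systems n \<epsilon>"
        by (auto simp: coefficient_systems_def w_def min.commute max.commute)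
      then have c: "coefficients_of (zero_weight_tensor G n \<epsilon> E Eh w) = w"
        by (rule coefficients_of_zero_weight_tensor)
      have "\<phi> k (zero_weight_tensor G n \<epsilon> E Eh w) = t k" if "k \<in> ?K" for k
      proof -
        obtain \<mu> \<nu> where k: "k = (\<mu>, \<nu>)" by (cases k) auto
        have "\<phi> k (zero_weight_tensor G n \<epsilon> E Eh w) = (if \<mu> = 0 then snd (snd w) \<nu>
            else if \<mu> \<le> \<nu> then fst w \<mu> \<nu> else fst (snd w) \<mu> \<nu>)"
          by (simp add: \<phi>_def c k)
        also have "\<dots> = t k"
          using that unfolding k w_def by (auto simp: hat_indices_def split: if_splits)
        finally show ?thesis .
      qed
      then show ?thesis using zero_weight_tensor_mem by blast
    qed
  qed (rule subspace_zero_weight_riemann)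
  then show ?thesis by (simp add: card_cartesian_product card_hat_indices[OF eps])
qed

lemma solves_unique:
  assumes "solves n \<epsilon> X w d" "solves n \<epsilon> X w d'"
  shows "d = d'"
proof
  fix \<mu>
  show "d \<mu> = d' \<mu>"
  proof (cases "\<mu> \<in> {1..n}")
    case True
    then show ?thesis
      using parameter_solves[OF assms(1) n eps True X_inj] parameter_solves[OF assms(2) n eps True X_inj]
      by simp
  next
    case False
    then have "d \<mu> = 0" "d' \<mu> = 0"
      using assms unfolding solves_def by (auto split: prod.splits)
    then show ?thesis by simp
  qed
qed

text \<open>
  A solution is determined by its parameters \<open>d\<close> and by the diagonal of \<open>\<Omega>\<close>, on which the condition
  imposes nothing.
\<close>

lemma dim_kernel:
  "dim {R \<in> zero_weight_riemann. integrability G (skew_form n X E Eh) R = 0} = 2 * n"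
proof -
  let ?I = "integrability G (skew_form n X E Eh)"
  let ?V = "{R \<in> zero_weight_riemann. ?I R = 0}"
  define \<phi> where "\<phi> = (\<lambda>(b, \<mu>) R. if b then fst (coefficients_of R) \<mu> \<mu>
     else parameter \<epsilon> X (coefficients_of R) \<mu>)"
  let ?K = "(UNIV :: bool set) \<times> {1..n}"
  interpret I: linear ?I by (rule linear_integrability)
  have "dim ?V = card ?K"
  proof (rule dim_eq_card_coordinates[where \<phi> = \<phi>])
    show "subspace ?V"
      using subspace_zero_weight_riemann by (auto simp: subspace_def I.add I.scale)
    show "linear (\<phi> k)" for k
      by (cases k)
        (simp add: linear_iff \<phi>_def parameter_def case_prod_unfold coefficients_of_linear algebra_simps)
    show "R = 0" if "R \<in> ?V" and zero: "\<And>k. k \<in> ?K \<Longrightarrow> \<phi> k R = 0" for R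
    proof -
      have R: "R \<in> zero_weight_riemann" "?I R = 0" using that(1) by auto
      obtain \<Omega> \<alpha> \<alpha>\<epsilon> where c: "coefficients_of R = (\<Omega>, \<alpha>, \<alpha>\<epsilon>)" by (cases "coefficients_of R") auto
      have mem: "(\<Omega>, \<alpha>, \<alpha>\<epsilon>) \<in> coefficient_systems n \<epsilon>" using coefficients_of_mem[OF R(1)] c by simp
      then have sym: "\<Omega> \<mu> \<nu> = \<Omega> \<nu> \<mu>" "\<alpha> \<mu> \<nu> = \<alpha> \<nu> \<mu>" "\<alpha> \<mu> \<mu> = 0"
        and out: "\<mu> \<notin> {1..n} \<Longrightarrow> \<Omega> \<mu> \<nu> = 0 \<and> \<alpha> \<mu> \<nu> = 0 \<and> \<alpha>\<epsilon> \<mu> = 0" for \<mu> \<nu>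
        unfolding coefficient_systems_def by blast+
      have "R = zero_weight_tensor G n \<epsilon> E Eh (\<Omega>, \<alpha>, \<alpha>\<epsilon>)"
        using zero_weight_tensor_coefficients_of[OF R(1)] c by simp
      then obtain d where d: "solves n \<epsilon> X (\<Omega>, \<alpha>, \<alpha>\<epsilon>) d"
        using integrability_zero_weight_tensor_iff[OF mem] R(2) by auto
      have d0: "d \<mu> = 0" if "\<mu> \<in> {1..n}" for \<mu>
        using parameter_solves[OF d n eps that X_inj] zero[of "(False, \<mu>)"] that
        by (simp add: \<phi>_def c)
      have off: "\<Omega> \<mu> \<nu> = 0 \<and> \<alpha> \<mu> \<nu> = 0" if "\<mu> \<in> {1..n}" "\<nu> \<in> {1..n}" "\<mu> \<noteq> \<nu>" for \<mu> \<nu>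
      proof -
        have "\<alpha> \<mu> \<nu> = (X \<mu> * d \<mu> - X \<nu> * d \<nu>) / ((X \<mu>)\<^sup>2 - (X \<nu>)\<^sup>2) - real \<epsilon> * (d \<mu> / X \<mu> + d \<nu> / X \<nu>)"
          "\<Omega> \<mu> \<nu> = (X \<mu> * d \<nu> - X \<nu> * d \<mu>) / ((X \<mu>)\<^sup>2 - (X \<nu>)\<^sup>2)"
          using d that unfolding solves_def prod.case by blast+
        then show ?thesis using d0 that by simp
      qed
      have diag: "\<Omega> \<mu> \<mu> = 0" if "\<mu> \<in> {1..n}" for \<mu>
        using zero[of "(True, \<mu>)"] that by (simp add: \<phi>_def c)
      have hat: "\<alpha>\<epsilon> \<mu> = 0" for \<mu>
      proof (cases "\<mu> \<in> {1..n}")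
        case True
        then have "\<alpha>\<epsilon> \<mu> = real \<epsilon> * (d \<mu> / X \<mu>)" using d unfolding solves_def prod.case by blast
        then show ?thesis using d0[OF True] by simp
      qed (use out in blast)
      have "\<Omega> \<mu> \<nu> = 0 \<and> \<alpha> \<mu> \<nu> = 0" for \<mu> \<nu>
      proof (cases "\<mu> \<in> {1..n} \<and> \<nu> \<in> {1..n}")
        case True
        then show ?thesis using off diag sym(3) by (cases "\<mu> = \<nu>") auto
      next
        case False
        then show ?thesis using out[of \<mu> \<nu>] out[of \<nu> \<mu>] sym(1,2)[of \<mu> \<nu>] by auto
      qed
      then show ?thesis
        by (intro zero_weight_riemann_eq_0I[OF R(1)]) (simp add: c fun_eq_iff hat)
    qed
    show "\<exists>R\<in>?V. \<forall>k\<in>?K. \<phi> k R = t k" for t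
    proof -
      define d where "d \<mu> = (if \<mu> \<in> {1..n} then t (False, \<mu>) else 0)" for \<mu>
      define \<Omega> where "\<Omega> \<mu> \<nu> = (if \<mu> \<in> {1..n} \<and> \<nu> \<in> {1..n}
          then if \<mu> = \<nu> then t (True, \<mu>) else (X \<mu> * d \<nu> - X \<nu> * d \<mu>) / ((X \<mu>)\<^sup>2 - (X \<nu>)\<^sup>2) else 0)" for \<mu> \<nu>
      define \<alpha> where "\<alpha> \<mu> \<nu> = (if \<mu> \<in> {1..n} \<and> \<nu> \<in> {1..n} \<and> \<mu> \<noteq> \<nu>
          then (X \<mu> * d \<mu> - X \<nu> * d \<nu>) / ((X \<mu>)\<^sup>2 - (X \<nu>)\<^sup>2) - real \<epsilon> * (d \<mu> / X \<mu> + d \<nu> / X \<nu>) else 0)" for \<mu> \<nu>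
      define \<alpha>\<epsilon> where "\<alpha>\<epsilon> \<mu> = (if \<mu> \<in> {1..n} then real \<epsilon> * (d \<mu> / X \<mu>) else 0)" for \<mu>
      have flip: "(p - q) / (s - u) = (q - p) / (u - s)" for p q s u :: real
        by (metis minus_diff_eq minus_divide_divide)
      have "\<Omega> \<mu> \<nu> = \<Omega> \<nu> \<mu>" "\<alpha> \<mu> \<nu> = \<alpha> \<nu> \<mu>" for \<mu> \<nu>
        unfolding \<Omega>_def \<alpha>_def
        using flip[of "X \<mu> * d \<nu>" "X \<nu> * d \<mu>" "(X \<mu>)\<^sup>2" "(X \<nu>)\<^sup>2"]
          flip[of "X \<mu> * d \<mu>" "X \<nu> * d \<nu>" "(X \<mu>)\<^sup>2" "(X \<nu>)\<^sup>2"]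
        by (auto simp: add.commute)
      then have mem: "(\<Omega>, \<alpha>, \<alpha>\<epsilon>) \<in> coefficient_systems n \<epsilon>"
        unfolding coefficient_systems_def
        by (auto simp: \<Omega>_def \<alpha>_def \<alpha>\<epsilon>_def)
      have d: "solves n \<epsilon> X (\<Omega>, \<alpha>, \<alpha>\<epsilon>) d"
        unfolding solves_def prod.case
        by (simp add: \<Omega>_def \<alpha>_def \<alpha>\<epsilon>_def del: atLeastAtMost_iff) (simp add: d_def)
      let ?R = "zero_weight_tensor G n \<epsilon> E Eh (\<Omega>, \<alpha>, \<alpha>\<epsilon>)"
      have "?R \<in> ?V"
        using zero_weight_tensor_mem integrability_zero_weight_tensor_iff[OF mem] d by blast
      moreover have "\<phi> k ?R = t k" if "k \<in> ?K" for k
      proof -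
        from that obtain b \<mu> where k: "k = (b, \<mu>)" "\<mu> \<in> {1..n}" by (rule SigmaE)
        have c: "coefficients_of ?R = (\<Omega>, \<alpha>, \<alpha>\<epsilon>)"
          by (rule coefficients_of_zero_weight_tensor[OF mem])
        have "\<phi> k ?R = (if b then \<Omega> \<mu> \<mu> else d \<mu>)"
          using parameter_solves[OF d n eps k(2) X_inj] by (simp add: \<phi>_def k(1) c)
        then show ?thesis using k by (cases b) (auto simp: \<Omega>_def d_def)
      qed
      ultimately show ?thesis by blast
    qed
  qed simp
  then show ?thesis by (simp add: card_cartesian_product)
qed

lemma dim_integrability_image:
  "int (dim (integrability G (skew_form n X E Eh) ` zero_weight_riemann)) = int n ^ 2 + (int \<epsilon> - 2) * int n"
proof -
  have "dim (integrability G (skew_form n X E Eh) ` zero_weight_riemann) + 2 * n = (n + \<epsilon>) * n"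
    using rank_nullity_on_subspace[OF linear_integrability subspace_zero_weight_riemann,
        of G "skew_form n X E Eh"]
    by (simp only: dim_kernel dim_zero_weight_riemann)
  then have "int (dim (integrability G (skew_form n X E Eh) ` zero_weight_riemann)) + 2 * int n =
      (int n + int \<epsilon>) * int n"
    by (metis of_nat_add of_nat_mult of_nat_numeral)
  then show ?thesis by (simp add: power2_eq_square algebra_simps)
qed

end

end

theorem theorem6:
  fixes A :: "('m::{t2_space, second_countable_topology}, 'd::finite) chart set"
    and n \<epsilon> :: nat
    and g :: "('m, 'd) chart \<Rightarrow> 'm \<Rightarrow> real^'d^'d"
    and e eh :: "nat \<Rightarrow> ('m, 'd) chart \<Rightarrow> 'm \<Rightarrow> real^'d"
    and x :: "nat \<Rightarrow> 'm \<Rightarrow> real"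
    and c :: "('m, 'd) chart" and p :: 'm
    and X :: "nat \<Rightarrow> real" and G h :: "real^'d^'d" and E Eh :: "nat \<Rightarrow> real^'d"
  assumes "n \<ge> 2" and "\<epsilon> \<in> {0, 1}" and "CARD('d) = 2 * n + \<epsilon>"
    and "smooth_atlas A" and "riemannian_metric A g"
    and "\<And>\<mu>. \<mu> \<in> {1..n} \<Longrightarrow> covector_field A (e \<mu>)"
    and "\<And>\<mu>. \<mu> \<in> hat_indices n \<epsilon> \<Longrightarrow> covector_field A (eh \<mu>)"
    and "\<And>c p. c \<in> A \<Longrightarrow> p \<in> fst c \<Longrightarrow>
           orthonormal_coframe (g c p) n \<epsilon> (\<lambda>\<mu>. e \<mu> c p) (\<lambda>\<mu>. eh \<mu> c p)"
    and "\<And>\<mu>. \<mu> \<in> {1..n} \<Longrightarrow> smooth_function A (x \<mu>)"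
    and "functionally_independent A n x"
    and "c \<in> A" and "p \<in> fst c"
    and "inj_on (\<lambda>\<mu>. (x \<mu> p)\<^sup>2) {1..n}" and "\<And>\<mu>. \<mu> \<in> {1..n} \<Longrightarrow> x \<mu> p \<noteq> 0"
    and "X = (\<lambda>\<mu>. x \<mu> p)" and "G = g c p"
    and "E = (\<lambda>\<mu>. e \<mu> c p)" and "Eh = (\<lambda>\<mu>. eh \<mu> c p)"
    and "h = (\<Sum>\<mu>\<in>{1..n}. X \<mu> *\<^sub>R wedge (E \<mu>) (Eh \<mu>))"
  shows "int (dim (integrability G h ` (riemann_symmetric \<inter> zero_weight n \<epsilon> E Eh))) =
           int n ^ 2 + (int \<epsilon> - 2) * int n \<and>
      bij_betw (zero_weight_tensor G n \<epsilon> E Eh) (coefficient_systems n \<epsilon>)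
        (riemann_symmetric \<inter> zero_weight n \<epsilon> E Eh) \<and>
      (\<forall>\<Omega> \<alpha> \<alpha>\<epsilon>. (\<Omega>, \<alpha>, \<alpha>\<epsilon>) \<in> coefficient_systems n \<epsilon> \<longrightarrow>
        (integrability G h (zero_weight_tensor G n \<epsilon> E Eh (\<Omega>, \<alpha>, \<alpha>\<epsilon>)) = 0 \<longleftrightarrow>
          (\<exists>!d :: nat \<Rightarrow> real.
            (\<forall>\<mu>. \<mu> \<notin> {1..n} \<longrightarrow> d \<mu> = 0) \<and>
            (\<forall>\<mu>\<in>{1..n}. \<forall>\<nu>\<in>{1..n}. \<mu> \<noteq> \<nu> \<longrightarrow>
              \<alpha> \<mu> \<nu> = (X \<mu> * d \<mu> - X \<nu> * d \<nu>) / ((X \<mu>)\<^sup>2 - (X \<nu>)\<^sup>2)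
                       - real \<epsilon> * (d \<mu> / X \<mu> + d \<nu> / X \<nu>) \<and>
              \<Omega> \<mu> \<nu> = (X \<mu> * d \<nu> - X \<nu> * d \<mu>) / ((X \<mu>)\<^sup>2 - (X \<nu>)\<^sup>2)) \<and>
            (\<forall>\<mu>\<in>{1..n}. \<alpha>\<epsilon> \<mu> = real \<epsilon> * (d \<mu> / X \<mu>)))))"
proof -
  have metric: "transpose G = G" "\<And>v. v \<noteq> 0 \<Longrightarrow> v \<bullet> (G *v v) > 0"
    using assms(5,11,12) unfolding riemannian_metric_def \<open>G = g c p\<close> by blast+
  interpret point_coframe G n \<epsilon> E Eh
  proof
    show "\<epsilon> \<in> {0, 1}" by fact
    show "CARD('d) = 2 * n + \<epsilon>" by fact
    show "transpose G = G" by (rule metric)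
    show "invertible G" by (rule positive_definite_invertible[OF metric(2)])
    show "orthonormal_coframe G n \<epsilon> E Eh"
      using assms(8)[OF assms(11,12)] by (simp add: \<open>G = g c p\<close> \<open>E = _\<close> \<open>Eh = _\<close>)
  qed
  have h: "h = skew_form n X E Eh" by (simp add: skew_form_def assms(19))
  have X: "inj_on (\<lambda>\<mu>. (X \<mu>)\<^sup>2) {1..n}" "\<And>\<mu>. \<mu> \<in> {1..n} \<Longrightarrow> X \<mu> \<noteq> 0"
    using assms(13,14) by (simp_all add: assms(15))
  have general_solution: "integrability G h (zero_weight_tensor G n \<epsilon> E Eh w) = 0 \<longleftrightarrow> (\<exists>!d. solves n \<epsilon> X w d)"
    if "w \<in> coefficient_systems n \<epsilon>" for w
  proof -
    have "integrability G h (zero_weight_tensor G n \<epsilon> E Eh w) = 0 \<longleftrightarrow> (\<exists>d. solves n \<epsilon> X w d)"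
      unfolding h by (rule integrability_zero_weight_tensor_iff[OF assms(1) X that])
    moreover have "d = d'" if "solves n \<epsilon> X w d" "solves n \<epsilon> X w d'" for d d'
      by (rule solves_unique[OF assms(1) X that])
    ultimately show ?thesis by blast
  qed
  have rank: "int (dim (integrability G h ` zero_weight_riemann)) = int n ^ 2 + (int \<epsilon> - 2) * int n"
    unfolding h by (rule dim_integrability_image[OF assms(1) X])
  show ?thesis
    unfolding zero_weight_riemann_def[symmetric]
    by (intro conjI allI impI rank bij_betw_zero_weight_tensor
        general_solution[of "(\<Omega>, \<alpha>, \<alpha>\<epsilon>)" for \<Omega> \<alpha> \<alpha>\<epsilon>, unfolded solves_def prod.case])
qed

end
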